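(* Suppose that $\gamma:\mathbb{R}^d\to\mathbb{R}$ is positively homogeneous of degree one ($\gamma(\lambda q)=\lambda\gamma(q)$ for all $q\in\mathbb{R}^d\setminus\{0\}$, $\lambda\ge 0$), positive for non-zero vectors ($\gamma(q)>0$ for all $q\in\mathbb{R}^d\setminus\{0\}$), and convex, and let $A(q)=\tfrac12|\gamma(q)|^2$ for $q\in\mathbb{R}^d$. Let $(\boldsymbol f,\boldsymbol g)\in L^2(\Omega,\mathbb{R}^d)\times L^2(\Gamma_g,\mathbb{R}^d)$, and let $\overline{\varphi}\in\mathcal{V}_m$ be an optimal design variable, i.e. a minimizer of $\phi\mapsto J(\phi,S(\phi))$ over $\mathcal{V}_m$, with associated state $\overline{u}=S(\overline{\varphi})$. Then there exists $\xi\in\partial A(\nabla\overline{\varphi})$ almost everywhere in $\Omega$ such that $$\widehat\alpha\int_\Omega\varepsilon\,\xi\cdot\nabla(\phi-\overline{\varphi})+\frac1\varepsilon\Psi_0'(\overline{\varphi})(\phi-\overline{\varphi})\,dx+\beta\int_\Omega 2h'(\overline{\varphi})(\phi-\overline{\varphi})\boldsymbol f\cdot\overline{u}-\mathcal{C}'(\overline{\varphi})(\phi-\overline{\varphi})\mathcal{E}(\overline{u}):\mathcal{E}(\overline{u})\,dx\ \ge\ 0$$ for all $\phi\in\mathcal{V}_m$.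
   Context: Setting. $\Omega\subset\mathbb{R}^d$ is a bounded domain with Lipschitz boundary $\Gamma=\partial\Omega$ that admits a decomposition $\Gamma=\Gamma_D\cup\Gamma_g\cup\Gamma_0$, and $\mathcal{H}^{d-1}$ is the $(d-1)$-dimensional Hausdorff measure. Put $H^1_D(\Omega,\mathbb{R}^d)=\{v\in H^1(\Omega,\mathbb{R}^d): v=0\text{ on }\Gamma_D\}$ and $\mathcal{E}(u)=\tfrac12(\nabla u+(\nabla u)^\top)$; $M:B=\sum_{i,j}M_{ij}B_{ij}$ for matrices $M,B$. Elasticity tensors. $\mathcal{C}_0,\mathcal{C}_1$ are fourth order elasticity tensors satisfying $\mathcal{C}_{ijkl}=\mathcal{C}_{jikl}=\mathcal{C}_{ijlk}$ for $i,j,k,l\in\{1,\dots,d\}$, and there are constants $\theta,\Lambda>0$ such that $\theta|M|^2\le\mathcal{C}M:M\le\Lambda|M|^2$ for all non-zero symmetric $M\in\mathbb{R}^{d\times d}$ and $\mathcal{C}\in\{\mathcal{C}_0,\mathcal{C}_1\}$. For $s\in[-1,1]$, $\mathcal{C}(s)=\tfrac12 g(s)(\mathcal{C}_0-\mathcal{C}_1)+\tfrac12(\mathcal{C}_0+\mathcal{C}_1)$, where the (scalar) interpolation function $g:\mathbb{R}\to[-1,1]$ is monotone with $g(-1)=-1$ and $g(1)=1$; $\mathcal{C}'$ denotes the derivative of $s\mapsto\mathcal{C}(s)$. Also $h(s)=\tfrac12(1-s)$ for $s\in[-1,1]$, extended by $1$ for $s<-1$ and by $0$ for $s>1$, and $h'(s)=-\tfrac12$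 on $[-1,1]$. State system. $\boldsymbol f$ is a body force and $\boldsymbol g$ (a vector field, not to be confused with the scalar function $g$) is a surface traction force. For $\varphi\in L^\infty(\Omega)$, $u=S(\varphi)\in H^1_D(\Omega,\mathbb{R}^d)$ denotes the unique solution of the state system in weak form $$\int_\Omega \mathcal{C}(\varphi)\mathcal{E}(u):\mathcal{E}(v)\,dx=\int_\Omega h(\varphi)\boldsymbol f\cdot v\,dx+\int_{\Gamma_g}\boldsymbol g\cdot v\,d\mathcal{H}^{d-1}\quad\text{for all }v\in H^1_D(\Omega,\mathbb{R}^d).$$ Design space and cost. For fixed $m\in(-1,1)$, $\mathcal{V}_m=\{\phi\in H^1(\Omega):\phi\in[-1,1]\text{ a.e. in }\Omega,\ \int_\Omega\phi\,dx=m|\Omega|\}$. For fixed constants $\widehat\alpha,\beta,\varepsilon>0$, $$J(\varphi,u)=\widehat\alpha\int_\Omega\frac{\varepsilon}{2}|\gamma(\nabla\varphi)|^2+\frac1\varepsilon\Psi(\varphi)\,dx+\beta\Big(\int_\Omega h(\varphi)\boldsymbol f\cdot u\,dx+\int_{\Gamma_g}\boldsymbol g\cdot u\,d\mathcal{H}^{d-1}\Big),$$ where $\Psi(s)=\Psi_0(s):=\tfrac12(1-s^2)$ for $s\in[-1,1]$ and $\Psi(s)=+\infty$ otherwise; $\Psi_0'(s)=-s$. Subdifferential. $\partial A(q)=\{\zeta\in\mathbb{R}^d: A(r)-A(q)\ge\zeta\cdot(r-q)\ \text{for all } r\in\mathbb{R}^d\}$ is the convex subdifferential of $A$ at $q$;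 "$\xi\in\partial A(\nabla\overline\varphi)$ almost everywhere in $\Omega$" means that $\xi$ is an $\mathbb{R}^d$-valued function on $\Omega$ with $\xi(x)\in\partial A(\nabla\overline\varphi(x))$ for almost every $x\in\Omega$.
   Formalization: The elasticity tensors are also assumed to have the major symmetry C_ijkl = C_klij (without it the claim is false, as the adjoint state differs from u), and g is assumed differentiable and Lipschitz on [-1,1] so that C' exists and the last integral is well defined. *)

theory Defs
  imports "HOL-Analysis.Analysis"
begin

section \<open>Hausdorff measure\<close>

text \<open>The value at the empty set is set to 0 separately because \<open>0 ^ 0 = 1\<close>; this matters for
  \<open>s = 0\<close>, where the result has to be the counting measure.\<close>

definition hausdorff_gauge :: "nat \<Rightarrow> 'a::metric_space set \<Rightarrow> ennreal" where
  "hausdorff_gauge s U =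
     (if U = {} then 0 else ennreal (unit_ball_vol (real s) * (diameter U / 2) ^ s))"

definition hausdorff_pre :: "nat \<Rightarrow> real \<Rightarrow> 'a::metric_space set \<Rightarrow> ennreal" where
  "hausdorff_pre s \<delta> A =
     (INF U\<in>{U :: nat \<Rightarrow> 'a set. A \<subseteq> (\<Union>i. U i) \<and> (\<forall>i. bounded (U i) \<and> diameter (U i) \<le> \<delta>)}.
        \<Sum>i. hausdorff_gauge s (U i))"

definition hausdorff_outer :: "nat \<Rightarrow> 'a::metric_space set \<Rightarrow> ennreal" where
  "hausdorff_outer s A = (SUP \<delta>\<in>{0<..}. hausdorff_pre s \<delta> A)"

text \<open>\<open>lambda_system UNIV UNIV\<close> is the sigma-algebra of Caratheodory-measurable sets.\<close>

definition hausdorff_measure :: "nat \<Rightarrow> 'a::metric_space measure" where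
  "hausdorff_measure s =
     measure_of UNIV (lambda_system UNIV UNIV (hausdorff_outer s)) (hausdorff_outer s)"

definition surface_measure :: "(real ^ 'd) set \<Rightarrow> (real ^ 'd) measure" where
  "surface_measure S = restrict_space (hausdorff_measure (CARD('d) - 1)) S"


section \<open>Bounded Lipschitz domains\<close>

text \<open>Near each boundary point the domain is the region below the graph of a Lipschitz function
  over the hyperplane orthogonal to a unit vector \<open>n\<close>; \<open>x - (x \<bullet> n) *\<^sub>R n\<close> is the projection onto
  that hyperplane.\<close>

definition lipschitz_boundary :: "'a::euclidean_space set \<Rightarrow> bool" where
  "lipschitz_boundary \<Omega> \<longleftrightarrow>
     (\<forall>x0\<in>frontier \<Omega>. \<exists>n r L. \<exists>\<rho> :: 'a \<Rightarrow> real. norm n = 1 \<and> r > 0 \<and> L-lipschitz_on UNIV \<rho> \<and>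
        \<Omega> \<inter> ball x0 r = {x \<in> ball x0 r. x \<bullet> n < \<rho> (x - (x \<bullet> n) *\<^sub>R n)})"

definition bounded_lipschitz_domain :: "'a::euclidean_space set \<Rightarrow> bool" where
  "bounded_lipschitz_domain \<Omega> \<longleftrightarrow>
     open \<Omega> \<and> connected \<Omega> \<and> \<Omega> \<noteq> {} \<and> bounded \<Omega> \<and> lipschitz_boundary \<Omega>"


section \<open>Lebesgue and Sobolev spaces\<close>

definition L2 :: "'a measure \<Rightarrow> ('a \<Rightarrow> 'b::euclidean_space) set" where
  "L2 M = {f \<in> borel_measurable M. integrable M (\<lambda>x. (norm (f x))\<^sup>2)}"

definition Linf :: "'a measure \<Rightarrow> ('a \<Rightarrow> real) set" where
  "Linf M = {f \<in> borel_measurable M. \<exists>K. AE x in M. \<bar>f x\<bar> \<le> K}"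

definition pderiv_at :: "'d \<Rightarrow> (real ^ 'd \<Rightarrow> real) \<Rightarrow> real ^ 'd \<Rightarrow> real" where
  "pderiv_at i f x = frechet_derivative f (at x) (axis i 1)"

fun iter_pderiv :: "'d list \<Rightarrow> (real ^ 'd \<Rightarrow> real) \<Rightarrow> real ^ 'd \<Rightarrow> real" where
  "iter_pderiv [] f = f"
| "iter_pderiv (i # is) f = pderiv_at i (iter_pderiv is f)"

definition smooth_fun :: "(real ^ 'd \<Rightarrow> real) \<Rightarrow> bool" where
  "smooth_fun f \<longleftrightarrow> (\<forall>is x. iter_pderiv is f differentiable (at x))"

definition test_fun :: "(real ^ 'd) set \<Rightarrow> (real ^ 'd \<Rightarrow> real) \<Rightarrow> bool" where
  "test_fun \<Omega> \<psi> \<longleftrightarrow> smooth_fun \<psi> \<and> compact (closure {x. \<psi> x \<noteq> 0}) \<and> closure {x. \<psi> x \<noteq> 0} \<subseteq> \<Omega>"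

definition is_weak_grad ::
    "(real ^ 'd) set \<Rightarrow> (real ^ 'd \<Rightarrow> real) \<Rightarrow> (real ^ 'd \<Rightarrow> real ^ 'd) \<Rightarrow> bool" where
  "is_weak_grad \<Omega> u G \<longleftrightarrow> G \<in> L2 (lebesgue_on \<Omega>) \<and>
     (\<forall>\<psi> i. test_fun \<Omega> \<psi> \<longrightarrow>
        (LINT x|lebesgue_on \<Omega>. u x * pderiv_at i \<psi> x) = - (LINT x|lebesgue_on \<Omega>. G x $ i * \<psi> x))"

text \<open>Elements of the function spaces are functions, not classes modulo null sets; \<open>weak_grad\<close> and
  \<open>bdry_trace\<close> below pick one representative of an object that is unique almost everywhere.\<close>

definition H1 :: "(real ^ 'd) set \<Rightarrow> (real ^ 'd \<Rightarrow> real) set" where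
  "H1 \<Omega> = {u \<in> L2 (lebesgue_on \<Omega>). \<exists>G. is_weak_grad \<Omega> u G}"

definition weak_grad :: "(real ^ 'd) set \<Rightarrow> (real ^ 'd \<Rightarrow> real) \<Rightarrow> real ^ 'd \<Rightarrow> real ^ 'd" where
  "weak_grad \<Omega> u = (SOME G. is_weak_grad \<Omega> u G)"

definition H1_vec :: "(real ^ 'd) set \<Rightarrow> (real ^ 'd \<Rightarrow> real ^ 'd) set" where
  "H1_vec \<Omega> = {u. \<forall>i. (\<lambda>x. u x $ i) \<in> H1 \<Omega>}"

definition weak_jacobian :: "(real ^ 'd) set \<Rightarrow> (real ^ 'd \<Rightarrow> real ^ 'd) \<Rightarrow> real ^ 'd \<Rightarrow> real ^ 'd ^ 'd" where
  "weak_jacobian \<Omega> u x = (\<chi> i. weak_grad \<Omega> (\<lambda>y. u y $ i) x)"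

definition sym_grad :: "(real ^ 'd) set \<Rightarrow> (real ^ 'd \<Rightarrow> real ^ 'd) \<Rightarrow> real ^ 'd \<Rightarrow> real ^ 'd ^ 'd" where
  "sym_grad \<Omega> u x = (1/2) *\<^sub>R (weak_jacobian \<Omega> u x + transpose (weak_jacobian \<Omega> u x))"

text \<open>The trace operator is the continuous extension to \<open>H\<^sup>1\<close> of the restriction map on functions
  that are smooth up to the boundary.\<close>

definition is_trace :: "(real ^ 'd) set \<Rightarrow> (real ^ 'd \<Rightarrow> real) \<Rightarrow> (real ^ 'd \<Rightarrow> real) \<Rightarrow> bool" where
  "is_trace \<Omega> u \<tau> \<longleftrightarrow> \<tau> \<in> L2 (surface_measure (frontier \<Omega>)) \<and>
     (\<exists>w :: nat \<Rightarrow> real ^ 'd \<Rightarrow> real. (\<forall>n. smooth_fun (w n)) \<and>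
        (\<lambda>n. LINT x|lebesgue_on \<Omega>. (w n x - u x)\<^sup>2) \<longlonglongrightarrow> 0 \<and>
        (\<lambda>n. LINT x|lebesgue_on \<Omega>. (norm ((\<chi> i. pderiv_at i (w n) x) - weak_grad \<Omega> u x))\<^sup>2) \<longlonglongrightarrow> 0 \<and>
        (\<lambda>n. LINT x|surface_measure (frontier \<Omega>). (w n x - \<tau> x)\<^sup>2) \<longlonglongrightarrow> 0)"

definition bdry_trace :: "(real ^ 'd) set \<Rightarrow> (real ^ 'd \<Rightarrow> real) \<Rightarrow> real ^ 'd \<Rightarrow> real" where
  "bdry_trace \<Omega> u = (SOME \<tau>. is_trace \<Omega> u \<tau>)"

definition bdry_trace_vec :: "(real ^ 'd) set \<Rightarrow> (real ^ 'd \<Rightarrow> real ^ 'd) \<Rightarrow> real ^ 'd \<Rightarrow> real ^ 'd" where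
  "bdry_trace_vec \<Omega> u x = (\<chi> i. bdry_trace \<Omega> (\<lambda>y. u y $ i) x)"

definition H1D :: "(real ^ 'd) set \<Rightarrow> (real ^ 'd) set \<Rightarrow> (real ^ 'd \<Rightarrow> real ^ 'd) set" where
  "H1D \<Omega> \<Gamma>\<^sub>D = {v \<in> H1_vec \<Omega>. AE x in surface_measure \<Gamma>\<^sub>D. bdry_trace_vec \<Omega> v x = 0}"


section \<open>Elasticity tensors\<close>

type_synonym 'd tensor4 = "real ^ 'd ^ 'd ^ 'd ^ 'd"

text \<open>\<open>C $ i $ j $ k $ l\<close> is the entry \<open>C\<^sub>i\<^sub>j\<^sub>k\<^sub>l\<close>. For matrices the library inner product
  \<open>M \<bullet> B\<close> is \<open>M : B\<close>, and \<open>norm\<close> is the Frobenius norm.\<close>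

definition tensor_apply :: "'d::finite tensor4 \<Rightarrow> real ^ 'd ^ 'd \<Rightarrow> real ^ 'd ^ 'd" where
  "tensor_apply C M = (\<chi> i j. \<Sum>k\<in>UNIV. \<Sum>l\<in>UNIV. C $ i $ j $ k $ l * M $ k $ l)"

text \<open>An elasticity tensor has the two minor symmetries and the major symmetry
  \<open>C\<^sub>i\<^sub>j\<^sub>k\<^sub>l = C\<^sub>k\<^sub>l\<^sub>i\<^sub>j\<close>. The latter makes the bilinear form
  of the state system symmetric.\<close>

definition elasticity_tensor :: "'d::finite tensor4 \<Rightarrow> bool" where
  "elasticity_tensor C \<longleftrightarrow> (\<forall>i j k l.
     C $ i $ j $ k $ l = C $ j $ i $ k $ l \<and>
     C $ i $ j $ k $ l = C $ i $ j $ l $ k \<and>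
     C $ i $ j $ k $ l = C $ k $ l $ i $ j)"

definition elliptic_tensor :: "real \<Rightarrow> real \<Rightarrow> 'd::finite tensor4 \<Rightarrow> bool" where
  "elliptic_tensor \<theta> \<Lambda> C \<longleftrightarrow> (\<forall>M. M \<noteq> 0 \<and> transpose M = M \<longrightarrow>
     \<theta> * (norm M)\<^sup>2 \<le> tensor_apply C M \<bullet> M \<and> tensor_apply C M \<bullet> M \<le> \<Lambda> * (norm M)\<^sup>2)"

definition interp_tensor :: "(real \<Rightarrow> real) \<Rightarrow> 'd::finite tensor4 \<Rightarrow> 'd tensor4 \<Rightarrow> real \<Rightarrow> 'd tensor4" where
  "interp_tensor g C0 C1 s = (1/2 * g s) *\<^sub>R (C0 - C1) + (1/2) *\<^sub>R (C0 + C1)"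

text \<open>Derivative on \<open>[-1,1]\<close>, one-sided at the end points.\<close>

definition interp_tensor' :: "(real \<Rightarrow> real) \<Rightarrow> 'd::finite tensor4 \<Rightarrow> 'd tensor4 \<Rightarrow> real \<Rightarrow> 'd tensor4" where
  "interp_tensor' g C0 C1 s = vector_derivative (interp_tensor g C0 C1) (at s within {-1..1})"

definition h_load :: "real \<Rightarrow> real" where
  "h_load s = (if s < -1 then 1 else if s > 1 then 0 else 1/2 * (1 - s))"

text \<open>Only the values on \<open>[-1,1]\<close> matter.\<close>

definition h_load' :: "real \<Rightarrow> real" where
  "h_load' s = (if s \<in> {-1..1} then - 1/2 else 0)"


section \<open>State system, design space and cost\<close>

definition load ::
    "(real ^ 'd) set \<Rightarrow> (real ^ 'd) set \<Rightarrow> (real ^ 'd \<Rightarrow> real ^ 'd) \<Rightarrow> (real ^ 'd \<Rightarrow> real ^ 'd) \<Rightarrow>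
     (real ^ 'd \<Rightarrow> real) \<Rightarrow> (real ^ 'd \<Rightarrow> real ^ 'd) \<Rightarrow> real" where
  "load \<Omega> \<Gamma>\<^sub>g f gs \<phi> v =
     (LINT x|lebesgue_on \<Omega>. h_load (\<phi> x) * (f x \<bullet> v x)) +
     (LINT x|surface_measure \<Gamma>\<^sub>g. gs x \<bullet> bdry_trace_vec \<Omega> v x)"

definition is_state ::
    "(real ^ 'd) set \<Rightarrow> (real ^ 'd) set \<Rightarrow> (real ^ 'd) set \<Rightarrow> (real \<Rightarrow> 'd::finite tensor4) \<Rightarrow>
     (real ^ 'd \<Rightarrow> real ^ 'd) \<Rightarrow> (real ^ 'd \<Rightarrow> real ^ 'd) \<Rightarrow>
     (real ^ 'd \<Rightarrow> real) \<Rightarrow> (real ^ 'd \<Rightarrow> real ^ 'd) \<Rightarrow> bool" where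
  "is_state \<Omega> \<Gamma>\<^sub>D \<Gamma>\<^sub>g C f gs \<phi> u \<longleftrightarrow> u \<in> H1D \<Omega> \<Gamma>\<^sub>D \<and>
     (\<forall>v\<in>H1D \<Omega> \<Gamma>\<^sub>D.
        (LINT x|lebesgue_on \<Omega>. tensor_apply (C (\<phi> x)) (sym_grad \<Omega> u x) \<bullet> sym_grad \<Omega> v x)
        = load \<Omega> \<Gamma>\<^sub>g f gs \<phi> v)"

definition uniquely_solvable ::
    "(real ^ 'd) set \<Rightarrow> (real ^ 'd) set \<Rightarrow> (real ^ 'd) set \<Rightarrow> (real \<Rightarrow> 'd::finite tensor4) \<Rightarrow>
     (real ^ 'd \<Rightarrow> real ^ 'd) \<Rightarrow> (real ^ 'd \<Rightarrow> real ^ 'd) \<Rightarrow> bool" where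
  "uniquely_solvable \<Omega> \<Gamma>\<^sub>D \<Gamma>\<^sub>g C f gs \<longleftrightarrow>
     (\<forall>\<phi>\<in>Linf (lebesgue_on \<Omega>). \<exists>u. is_state \<Omega> \<Gamma>\<^sub>D \<Gamma>\<^sub>g C f gs \<phi> u \<and>
        (\<forall>w. is_state \<Omega> \<Gamma>\<^sub>D \<Gamma>\<^sub>g C f gs \<phi> w \<longrightarrow> (AE x in lebesgue_on \<Omega>. w x = u x)))"

definition state_op ::
    "(real ^ 'd) set \<Rightarrow> (real ^ 'd) set \<Rightarrow> (real ^ 'd) set \<Rightarrow> (real \<Rightarrow> 'd::finite tensor4) \<Rightarrow>
     (real ^ 'd \<Rightarrow> real ^ 'd) \<Rightarrow> (real ^ 'd \<Rightarrow> real ^ 'd) \<Rightarrow>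
     (real ^ 'd \<Rightarrow> real) \<Rightarrow> real ^ 'd \<Rightarrow> real ^ 'd" where
  "state_op \<Omega> \<Gamma>\<^sub>D \<Gamma>\<^sub>g C f gs \<phi> = (SOME u. is_state \<Omega> \<Gamma>\<^sub>D \<Gamma>\<^sub>g C f gs \<phi> u)"

definition design_space :: "(real ^ 'd) set \<Rightarrow> real \<Rightarrow> (real ^ 'd \<Rightarrow> real) set" where
  "design_space \<Omega> m = {\<phi> \<in> H1 \<Omega>. (AE x in lebesgue_on \<Omega>. \<phi> x \<in> {-1..1}) \<and>
     (LINT x|lebesgue_on \<Omega>. \<phi> x) = m * measure lebesgue \<Omega>}"

definition obstacle_potential :: "real \<Rightarrow> ennreal" where
  "obstacle_potential s = (if s \<in> {-1..1} then ennreal (1/2 * (1 - s\<^sup>2)) else \<infinity>)"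

definition Psi0' :: "real \<Rightarrow> real" where
  "Psi0' s = - s"

text \<open>The first integrand is nonnegative and possibly infinite, hence the integral over
  \<open>ennreal\<close>; the cost takes values in \<open>ereal\<close>.\<close>

definition cost ::
    "(real ^ 'd) set \<Rightarrow> (real ^ 'd) set \<Rightarrow> (real ^ 'd \<Rightarrow> real) \<Rightarrow> real \<Rightarrow> real \<Rightarrow> real \<Rightarrow>
     (real ^ 'd \<Rightarrow> real ^ 'd) \<Rightarrow> (real ^ 'd \<Rightarrow> real ^ 'd) \<Rightarrow>
     (real ^ 'd \<Rightarrow> real) \<Rightarrow> (real ^ 'd \<Rightarrow> real ^ 'd) \<Rightarrow> ereal" where
  "cost \<Omega> \<Gamma>\<^sub>g \<gamma> \<alpha> \<beta> \<epsilon> f gs \<phi> u =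
     ereal \<alpha> * enn2ereal (\<integral>\<^sup>+x. ennreal (\<epsilon>/2 * \<bar>\<gamma> (weak_grad \<Omega> \<phi> x)\<bar>\<^sup>2)
                              + ennreal (1/\<epsilon>) * obstacle_potential (\<phi> x) \<partial>lebesgue_on \<Omega>)
     + ereal (\<beta> * load \<Omega> \<Gamma>\<^sub>g f gs \<phi> u)"

definition convex_subdifferential :: "('a::real_inner \<Rightarrow> real) \<Rightarrow> 'a \<Rightarrow> 'a set" where
  "convex_subdifferential A q = {\<zeta>. \<forall>r. A r - A q \<ge> \<zeta> \<bullet> (r - q)}"

end

theory Submission
  imports Defs
begin

text \<open>
  Along the segment \<open>(1 - t) \<phi>\<^sub>b + t \<phi>\<close> the compliance is a maximum of energies that are explicit in
  the design, which bounds its increment from above by the linear term of the claim; the interface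
  energy is estimated by convexity of \<open>A\<close>. Hence \<open>\<phi>\<^sub>b\<close> minimizes a convex functional, the
  integral of \<open>A\<close> of the gradient plus a linear term, over the design space.

  The subgradient is then found without Hahn-Banach or weak compactness. The function \<open>A\<close> is
  replaced by its Moreau envelope and a quadratic penalty is added; gradients of the envelope at
  almost minimizers satisfy the variational inequality up to a small error. By the parallelogram
  law suitable convex combinations of them converge strongly in \<open>L\<^sup>2\<close>, and both the inequality
  and the inclusion in the subdifferential survive convex combinations and the limit.
\<close>

section \<open>Square-integrable functions\<close>

text \<open>The obstacle is the order of quantifiers: \<gamma> need not be differentiable, and for a
  fixed competitor convexity only yields a subgradient depending on that competitor, whereas one
  \<xi> has to serve all of them. Smoothing makes the subgradient single valued, so that an almost
  minimizer supplies one field for all directions at once. A direction is recorded as a pair of a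
  gradient field and a real number. The linear part of the functional is thus carried along without
  being estimated by the gradient. No adjoint state appears because the compliance is the maximum
  over v of twice the load minus the elastic form: at fixed v the load changes with factor
  \<open>2 * h_load'\<close> and the form with \<open>C'\<close>, which are the two terms of the
  claim. Inserting the new state at the old design gives a one-sided estimate in the right
  direction; its limit only asks that the strains of the states converge. Since
  \<open>weak_grad\<close> chooses a representative, its linearity holds up to null sets and rests
  on uniqueness, for which enough test functions have to be constructed.\<close>

definition l2_norm :: "'a measure \<Rightarrow> ('a \<Rightarrow> 'b::euclidean_space) \<Rightarrow> real" where
  "l2_norm M f = sqrt (LINT x|M. (norm (f x))\<^sup>2)"

lemma L2_measurable: "f \<in> L2 M \<Longrightarrow> f \<in> borel_measurable M"
  by (simp add: L2_def)

lemma L2_integrable_square: "f \<in> L2 M \<Longrightarrow> integrable M (\<lambda>x. (norm (f x))\<^sup>2)"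
  by (simp add: L2_def)

lemma L2_mult_integrable:
  assumes "f \<in> L2 M" "g \<in> L2 M"
  shows "integrable M (\<lambda>x. norm (f x) * norm (g x))"
proof (rule Bochner_Integration.integrable_bound)
  show "integrable M (\<lambda>x. (norm (f x))\<^sup>2 + (norm (g x))\<^sup>2)"
    using assms by (simp add: L2_def)
  show "(\<lambda>x. norm (f x) * norm (g x)) \<in> borel_measurable M"
    using assms[THEN L2_measurable] by simp
  have "a * b \<le> a\<^sup>2 + b\<^sup>2" if "0 \<le> a" "0 \<le> b" for a b :: real
    using that sum_squares_bound[of a b] mult_nonneg_nonneg[OF that] by linarith
  then show "AE x in M. norm (norm (f x) * norm (g x)) \<le> norm ((norm (f x))\<^sup>2 + (norm (g x))\<^sup>2)"
    by simp
qed

lemma L2_dominated: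
  assumes "g \<in> borel_measurable M" "AE x in M. norm (g x) \<le> c * norm (f x)" "f \<in> L2 M"
  shows "g \<in> L2 M"
proof -
  have "integrable M (\<lambda>x. (norm (g x))\<^sup>2)"
  proof (rule Bochner_Integration.integrable_bound)
    show "integrable M (\<lambda>x. c\<^sup>2 * (norm (f x))\<^sup>2)"
      using assms(3) by (simp add: L2_def)
    show "(\<lambda>x. (norm (g x))\<^sup>2) \<in> borel_measurable M"
      using assms(1) by simp
    show "AE x in M. norm ((norm (g x))\<^sup>2) \<le> norm (c\<^sup>2 * (norm (f x))\<^sup>2)"
      using assms(2)
    proof eventually_elim
      case (elim x)
      then have "(norm (g x))\<^sup>2 \<le> (c * norm (f x))\<^sup>2"
        by (intro power_mono) auto
      then show ?case by (simp add: power_mult_distrib)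
    qed
  qed
  then show ?thesis using assms(1) by (simp add: L2_def)
qed

lemma L2_add:
  assumes "f \<in> L2 M" "g \<in> L2 M"
  shows "(\<lambda>x. f x + g x) \<in> L2 M"
proof -
  have "integrable M (\<lambda>x. (norm (f x + g x))\<^sup>2)"
  proof (rule Bochner_Integration.integrable_bound)
    show "integrable M (\<lambda>x. 2 * (norm (f x))\<^sup>2 + 2 * (norm (g x))\<^sup>2)"
      using assms by (simp add: L2_def)
    show "(\<lambda>x. (norm (f x + g x))\<^sup>2) \<in> borel_measurable M"
      using assms[THEN L2_measurable] by simp
    have "(norm (a + b))\<^sup>2 \<le> 2 * (norm a)\<^sup>2 + 2 * (norm b)\<^sup>2" for a b :: 'b
    proof -
      have "(norm (a + b))\<^sup>2 \<le> (norm a + norm b)\<^sup>2"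
        by (intro power_mono norm_triangle_ineq) auto
      also have "\<dots> \<le> 2 * (norm a)\<^sup>2 + 2 * (norm b)\<^sup>2"
        using sum_squares_bound[of "norm a" "norm b"] by (simp add: power2_sum)
      finally show ?thesis .
    qed
    then show "AE x in M. norm ((norm (f x + g x))\<^sup>2) \<le> norm (2 * (norm (f x))\<^sup>2 + 2 * (norm (g x))\<^sup>2)"
      by simp
  qed
  moreover have "(\<lambda>x. f x + g x) \<in> borel_measurable M"
    using assms[THEN L2_measurable] by simp
  ultimately show ?thesis by (simp add: L2_def)
qed

lemma L2_scaleR: "f \<in> L2 M \<Longrightarrow> (\<lambda>x. c *\<^sub>R f x) \<in> L2 M"
  by (rule L2_dominated[where c = "\<bar>c\<bar>" and f = f]) (auto simp: L2_def)

lemma L2_diff: "f \<in> L2 M \<Longrightarrow> g \<in> L2 M \<Longrightarrow> (\<lambda>x. f x - g x) \<in> L2 M"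
  using L2_add[OF _ L2_scaleR[of g M "-1"], of f] by simp

lemma L2_zero: "(\<lambda>x. 0) \<in> L2 M"
  by (simp add: L2_def)

lemma L2_inner_integrable:
  assumes "f \<in> L2 M" "g \<in> L2 M"
  shows "integrable M (\<lambda>x. f x \<bullet> g x)"
  using assms
  by (intro Bochner_Integration.integrable_bound[OF L2_mult_integrable[OF assms]])
     (auto simp: L2_def Cauchy_Schwarz_ineq2)

lemma (in finite_measure) L2_integrable:
  assumes "f \<in> L2 M"
  shows "integrable M f"
proof -
  have "(\<lambda>x. 1::real) \<in> L2 M" by (simp add: L2_def)
  from L2_mult_integrable[OF assms this] show ?thesis
    using assms by (simp add: L2_def integrable_norm_iff)
qed

lemma l2_norm_nonneg: "0 \<le> l2_norm M f"
  by (simp add: l2_norm_def)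

lemma l2_norm_square: "(l2_norm M f)\<^sup>2 = (LINT x|M. (norm (f x))\<^sup>2)"
  by (simp add: l2_norm_def)

text \<open>The quadratic t -> integral of (t |f| - |g|)^2 is nonnegative, so its discriminant is
  not positive. Stated for products of norms so that the factors may take values in different
  spaces, such as the constant 1 in \<open>l1_le_l2\<close>.\<close>

lemma l2_norm_Cauchy_Schwarz_norm:
  assumes f: "f \<in> L2 M" and g: "g \<in> L2 M"
  shows "(LINT x|M. norm (f x) * norm (g x)) \<le> l2_norm M f * l2_norm M g"
proof -
  define a b c where "a = (LINT x|M. (norm (f x))\<^sup>2)" and "b = (LINT x|M. (norm (g x))\<^sup>2)"
    and "c = (LINT x|M. norm (f x) * norm (g x))"
  have a0: "0 \<le> a" and c0: "0 \<le> c" by (auto simp: a_def c_def)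
  have quad: "0 \<le> t\<^sup>2 * a - 2 * t * c + b" for t
  proof -
    have "0 \<le> (LINT x|M. (t * norm (f x) - norm (g x))\<^sup>2)" by simp
    also have "\<dots> = (LINT x|M. t\<^sup>2 * (norm (f x))\<^sup>2 - 2 * t * (norm (f x) * norm (g x)) + (norm (g x))\<^sup>2)"
      by (rule Bochner_Integration.integral_cong) (auto simp: power2_eq_square algebra_simps)
    also have "\<dots> = t\<^sup>2 * a - 2 * t * c + b"
      using L2_mult_integrable[OF f g] f g by (simp add: a_def b_def c_def L2_def)
    finally show ?thesis .
  qed
  have "c\<^sup>2 \<le> a * b"
  proof (cases "a = 0")
    case True
    have "c = 0"
    proof (rule ccontr)
      assume "c \<noteq> 0"
      \<comment> \<open>For a = 0 the quadratic is affine in t, and this t gives it the value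
        -1.\<close>
      with quad[of "(b + 1) / (2 * c)"] True show False by simp
    qed
    then show ?thesis using True by simp
  next
    case False
    with a0 have "a > 0" by simp
    then show ?thesis using quad[of "c / a"]
      by (simp add: field_simps power2_eq_square)
  qed
  then have "c \<le> sqrt (a * b)" using c0 by (simp add: real_le_rsqrt)
  then show ?thesis by (simp add: a_def b_def c_def l2_norm_def real_sqrt_mult)
qed

lemma l2_norm_Cauchy_Schwarz:
  assumes "f \<in> L2 M" "g \<in> L2 M"
  shows "\<bar>LINT x|M. f x \<bullet> g x\<bar> \<le> l2_norm M f * l2_norm M g"
proof -
  have "\<bar>LINT x|M. f x \<bullet> g x\<bar> \<le> (LINT x|M. \<bar>f x \<bullet> g x\<bar>)"
    by (rule integral_abs_bound)
  also have "\<dots> \<le> (LINT x|M. norm (f x) * norm (g x))"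
    using assms by (intro integral_mono L2_mult_integrable integrable_abs L2_inner_integrable
        Cauchy_Schwarz_ineq2)
  also have "\<dots> \<le> l2_norm M f * l2_norm M g"
    by (rule l2_norm_Cauchy_Schwarz_norm[OF assms])
  finally show ?thesis .
qed

lemma l2_norm_mono:
  assumes "AE x in M. norm (f x) \<le> norm (g x)" "f \<in> borel_measurable M" "g \<in> L2 M"
  shows "l2_norm M f \<le> l2_norm M g"
proof -
  have "f \<in> L2 M" using L2_dominated[of f M 1 g] assms by simp
  then have "(LINT x|M. (norm (f x))\<^sup>2) \<le> (LINT x|M. (norm (g x))\<^sup>2)"
    using assms by (intro integral_mono_AE L2_integrable_square) (auto elim!: eventually_mono intro: power_mono)
  then show ?thesis by (simp add: l2_norm_def)
qed

lemma l2_norm_scaleR: "l2_norm M (\<lambda>x. c *\<^sub>R f x) = \<bar>c\<bar> * l2_norm M f"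
  by (simp add: l2_norm_def power_mult_distrib real_sqrt_mult)

lemma l2_norm_triangle:
  assumes f: "f \<in> L2 M" and g: "g \<in> L2 M"
  shows "l2_norm M (\<lambda>x. f x + g x) \<le> l2_norm M f + l2_norm M g"
proof (rule power2_le_imp_le)
  have "(l2_norm M (\<lambda>x. f x + g x))\<^sup>2 = (LINT x|M. (norm (f x))\<^sup>2 + 2 * (f x \<bullet> g x) + (norm (g x))\<^sup>2)"
    by (simp add: l2_norm_square power2_norm_eq_inner algebra_simps inner_commute)
  also have "\<dots> = (l2_norm M f)\<^sup>2 + 2 * (LINT x|M. f x \<bullet> g x) + (l2_norm M g)\<^sup>2"
    using L2_inner_integrable[OF f g] f g by (simp add: l2_norm_square L2_def)
  also have "\<dots> \<le> (l2_norm M f + l2_norm M g)\<^sup>2"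
    using l2_norm_Cauchy_Schwarz[OF f g] by (simp add: power2_sum)
  finally show "(l2_norm M (\<lambda>x. f x + g x))\<^sup>2 \<le> (l2_norm M f + l2_norm M g)\<^sup>2" .
qed (simp add: l2_norm_nonneg)

lemma l2_norm_triangle_diff:
  assumes "f \<in> L2 M" "g \<in> L2 M"
  shows "l2_norm M (\<lambda>x. f x - g x) \<le> l2_norm M f + l2_norm M g"
  using l2_norm_triangle[OF assms(1) L2_scaleR[OF assms(2), of "-1"]] l2_norm_scaleR[of M "-1" g]
  by simp

text \<open>In midpoint form, because in \<open>L2_bounded_Mazur\<close> the midpoint stays in the
  hull and its norm is bounded below by the infimum.\<close>

lemma l2_norm_parallelogram:
  assumes f: "f \<in> L2 M" and g: "g \<in> L2 M"
  shows "(l2_norm M (\<lambda>x. f x - g x))\<^sup>2 =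
    2 * (l2_norm M f)\<^sup>2 + 2 * (l2_norm M g)\<^sup>2 - 4 * (l2_norm M (\<lambda>x. (1/2) *\<^sub>R (f x + g x)))\<^sup>2"
proof -
  have m: "(\<lambda>x. (1/2) *\<^sub>R (f x + g x)) \<in> L2 M" by (intro L2_scaleR L2_add f g)
  have "(l2_norm M (\<lambda>x. f x - g x))\<^sup>2 = (LINT x|M. 2 * (norm (f x))\<^sup>2 + 2 * (norm (g x))\<^sup>2
      - 4 * (norm ((1/2) *\<^sub>R (f x + g x)))\<^sup>2)"
    unfolding l2_norm_square
    by (rule Bochner_Integration.integral_cong)
       (auto simp: power2_norm_eq_inner algebra_simps inner_commute)
  also have "\<dots> = 2 * (l2_norm M f)\<^sup>2 + 2 * (l2_norm M g)\<^sup>2 - 4 * (l2_norm M (\<lambda>x. (1/2) *\<^sub>R (f x + g x)))\<^sup>2"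
    unfolding l2_norm_square using L2_integrable_square[OF m] L2_integrable_square[OF f] L2_integrable_square[OF g]
    by (subst Bochner_Integration.integral_diff) auto
  finally show ?thesis .
qed

section \<open>Completeness of L2 over a finite measure\<close>

lemma (in finite_measure) l1_le_l2:
  assumes "f \<in> L2 M"
  shows "(LINT x|M. norm (f x)) \<le> l2_norm M f * sqrt (measure M (space M))"
proof -
  have "(\<lambda>x. 1::real) \<in> L2 M" by (simp add: L2_def)
  from l2_norm_Cauchy_Schwarz_norm[OF assms this] show ?thesis
    by (simp add: l2_norm_def)
qed

text \<open>On a finite measure space the L2 bounds control the L1 norms of the increments, whose
  sum is then finite; so the telescoping series converges absolutely at almost every point.\<close>

lemma (in finite_measure) L2_fast_Cauchy_AE_convergent:
  assumes f: "\<And>n. f n \<in> L2 M" and fast: "\<And>n. l2_norm M (\<lambda>x. f (Suc n) x - f n x) \<le> (1/2) ^ n"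
  shows "AE x in M. convergent (\<lambda>n. f n x)"
proof -
  let ?d = "\<lambda>n x. f (Suc n) x - f n x"
  let ?m = "sqrt (measure M (space M))"
  have d: "?d n \<in> L2 M" for n by (intro L2_diff f)
  have dm: "?d n \<in> borel_measurable M" for n by (rule L2_measurable[OF d])
  have nn: "(\<integral>\<^sup>+x. ennreal (norm (?d n x)) \<partial>M) \<le> ennreal ((1/2)^n * ?m)" for n
  proof -
    have "(\<integral>\<^sup>+x. ennreal (norm (?d n x)) \<partial>M) = ennreal (LINT x|M. norm (?d n x))"
      by (intro nn_integral_eq_integral integrable_norm L2_integrable d) auto
    also have "\<dots> \<le> ennreal ((1/2)^n * ?m)"
      using l1_le_l2[OF d[of n]] mult_right_mono[OF fast[of n], of ?m] by (intro ennreal_leI) simp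
    finally show ?thesis .
  qed
  have "(\<integral>\<^sup>+x. (\<Sum>n. ennreal (norm (?d n x))) \<partial>M) = (\<Sum>n. \<integral>\<^sup>+x. ennreal (norm (?d n x)) \<partial>M)"
    using dm by (intro nn_integral_suminf) auto
  also have "\<dots> \<le> (\<Sum>n. ennreal ((1/2)^n * ?m))"
    by (intro suminf_le nn) auto
  also have "\<dots> = ennreal (\<Sum>n. (1/2)^n * ?m)"
    by (intro suminf_ennreal2 summable_mult2 summable_geometric) auto
  also have "\<dots> < \<infinity>" by simp
  finally have "(\<integral>\<^sup>+x. (\<Sum>n. ennreal (norm (?d n x))) \<partial>M) \<noteq> \<infinity>" by simp
  then have "AE x in M. (\<Sum>n. ennreal (norm (?d n x))) \<noteq> \<infinity>"
    using dm by (intro nn_integral_PInf_AE) auto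
  then show ?thesis
  proof eventually_elim
    case (elim x)
    then have "summable (\<lambda>n. norm (?d n x))"
      by (intro summable_suminf_not_top) auto
    then have "summable (\<lambda>n. ?d n x)" by (rule summable_norm_cancel)
    then have "convergent (\<lambda>n. (\<Sum>k<n. ?d k x) + f 0 x)"
      by (intro convergent_add convergent_const) (simp add: summable_iff_convergent)
    then show ?case using sum_lessThan_telescope[of "\<lambda>n. f n x"] by simp
  qed
qed

text \<open>Riesz-Fischer. The subsequence provides the pointwise limit; convergence in norm then
  holds for the whole sequence by Fatou's lemma.\<close>

lemma (in finite_measure) L2_complete:
  assumes f: "\<And>n. f n \<in> L2 M"
    and Cauchy: "\<And>e. 0 < e \<Longrightarrow> \<exists>N. \<forall>m\<ge>N. \<forall>n\<ge>N. l2_norm M (\<lambda>x. f m x - f n x) \<le> e"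
  shows "\<exists>y\<in>L2 M. \<exists>r. strict_mono r \<and> (AE x in M. (\<lambda>n. f (r n) x) \<longlonglongrightarrow> y x) \<and>
    (\<lambda>n. l2_norm M (\<lambda>x. f n x - y x)) \<longlonglongrightarrow> 0"
proof -
  have "\<exists>r. strict_mono r \<and> (\<forall>n. \<forall>m\<ge>r n. l2_norm M (\<lambda>x. f m x - f (r n) x) \<le> (1/2)^n)"
  proof -
    have "\<exists>N. \<forall>m\<ge>N. \<forall>n\<ge>N. l2_norm M (\<lambda>x. f m x - f n x) \<le> (1/2)^k" for k :: nat
      by (rule Cauchy) simp
    then obtain N where N: "\<And>k m n. m \<ge> N k \<Longrightarrow> n \<ge> N k \<Longrightarrow> l2_norm M (\<lambda>x. f m x - f n x) \<le> (1/2)^k"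
      by metis
    \<comment> \<open>The sum dominates \<open>N n\<close>, and the added n makes r strictly
      increasing.\<close>
    define r where "r n = (\<Sum>k\<le>n. N k) + n" for n
    have "strict_mono r" by (rule strict_monoI_Suc) (simp add: r_def)
    moreover have "N n \<le> r n" for n
      unfolding r_def by (rule trans_le_add1) (rule member_le_sum, auto)
    then have "\<forall>n. \<forall>m\<ge>r n. l2_norm M (\<lambda>x. f m x - f (r n) x) \<le> (1/2)^n"
      using N order_trans by blast
    ultimately show ?thesis by blast
  qed
  then obtain r where r: "strict_mono r"
    and rd: "\<And>n m. m \<ge> r n \<Longrightarrow> l2_norm M (\<lambda>x. f m x - f (r n) x) \<le> (1/2)^n" by blast
  have conv: "AE x in M. convergent (\<lambda>n. f (r n) x)"
    by (rule L2_fast_Cauchy_AE_convergent[of "\<lambda>n. f (r n)"])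
       (auto intro!: f rd simp: strict_mono_less_eq[OF r])
  define y where "y x = lim (\<lambda>n. f (r n) x)" for x
  have fm [measurable]: "f n \<in> borel_measurable M" for n by (rule L2_measurable[OF f])
  have ym [measurable]: "y \<in> borel_measurable M"
    unfolding y_def by measurable
  have lim: "AE x in M. (\<lambda>n. f (r n) x) \<longlonglongrightarrow> y x"
    using conv by eventually_elim (simp add: y_def convergent_LIMSEQ_iff)
  have est: "(\<lambda>x. f m x - y x) \<in> L2 M \<and> l2_norm M (\<lambda>x. f m x - y x) \<le> e"
    if m: "m \<ge> N" and N: "\<forall>m\<ge>N. \<forall>n\<ge>N. l2_norm M (\<lambda>x. f m x - f n x) \<le> e" for m N e
  proof -
    let ?g = "\<lambda>n x. (norm (f m x - f (r n) x))\<^sup>2"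
    have d: "(\<lambda>x. f m x - f (r n) x) \<in> L2 M" for n by (intro L2_diff f)
    have e: "0 \<le> e" using N m l2_norm_nonneg[of M "\<lambda>x. f m x - f m x"] by (meson order_trans)
    have "(\<integral>\<^sup>+x. ennreal ((norm (f m x - y x))\<^sup>2) \<partial>M) = (\<integral>\<^sup>+x. liminf (\<lambda>n. ennreal (?g n x)) \<partial>M)"
      using lim
    proof (intro nn_integral_cong_AE, eventually_elim)
      case (elim x)
      have "(\<lambda>n. ennreal (?g n x)) \<longlonglongrightarrow> ennreal ((norm (f m x - y x))\<^sup>2)"
        by (intro tendsto_intros elim)
      then show ?case using lim_imp_Liminf[OF trivial_limit_sequentially] by metis
    qed
    \<comment> \<open>Fatou's lemma along the subsequence turns the Cauchy bound into a bound for
      the distance to the limit.\<close>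
    also have "\<dots> \<le> liminf (\<lambda>n. \<integral>\<^sup>+x. ennreal (?g n x) \<partial>M)"
      by (rule nn_integral_liminf) measurable
    also have "\<dots> \<le> liminf (\<lambda>n::nat. ennreal (e\<^sup>2))"
    proof (rule Liminf_mono, rule eventually_sequentiallyI)
      fix n assume "N \<le> n"
      then have "N \<le> r n" using seq_suble[OF r, of n] by simp
      then have "(l2_norm M (\<lambda>x. f m x - f (r n) x))\<^sup>2 \<le> e\<^sup>2"
        using N m by (intro power_mono l2_norm_nonneg) auto
      then show "(\<integral>\<^sup>+x. ennreal (?g n x) \<partial>M) \<le> ennreal (e\<^sup>2)"
        using L2_integrable_square[OF d] 
        by (subst nn_integral_eq_integral) (auto simp: l2_norm_square intro: ennreal_leI)
    qed
    finally have nn: "(\<integral>\<^sup>+x. ennreal ((norm (f m x - y x))\<^sup>2) \<partial>M) \<le> ennreal (e\<^sup>2)"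
      by (simp add: Liminf_const)
    have int: "integrable M (\<lambda>x. (norm (f m x - y x))\<^sup>2)"
      by (rule integrableI_bounded) (use nn in \<open>auto intro: le_less_trans\<close>)
    have "(LINT x|M. (norm (f m x - y x))\<^sup>2) \<le> e\<^sup>2"
      using nn nn_integral_eq_integral[OF int] by (simp add: ennreal_le_iff)
    then have "l2_norm M (\<lambda>x. f m x - y x) \<le> e"
      using e by (simp add: l2_norm_def real_le_lsqrt)
    then show ?thesis using int by (auto simp: L2_def)
  qed
  obtain N0 where N0: "\<forall>m\<ge>N0. \<forall>n\<ge>N0. l2_norm M (\<lambda>x. f m x - f n x) \<le> 1"
    using Cauchy[of 1] by auto
  \<comment> \<open>Square integrability of y is read off from its difference to
    \<open>f N0\<close>, which is already estimated.\<close>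
  have "(\<lambda>x. f N0 x - (f N0 x - y x)) \<in> L2 M"
    by (rule L2_diff[OF f conjunct1[OF est[OF order_refl N0]]])
  then have y: "y \<in> L2 M" by simp
  have "(\<lambda>n. l2_norm M (\<lambda>x. f n x - y x)) \<longlonglongrightarrow> 0"
  proof (rule LIMSEQ_I)
    fix e :: real assume "0 < e"
    then obtain N where N: "\<forall>m\<ge>N. \<forall>n\<ge>N. l2_norm M (\<lambda>x. f m x - f n x) \<le> e / 2"
      using Cauchy[of "e / 2"] by auto
    have "norm (l2_norm M (\<lambda>x. f n x - y x) - 0) < e" if "n \<ge> N" for n
      using est[OF that N] \<open>0 < e\<close> l2_norm_nonneg[of M "\<lambda>x. f n x - y x"] by auto
    then show "\<exists>no. \<forall>n\<ge>no. norm (l2_norm M (\<lambda>x. f n x - y x) - 0) < e" by blast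
  qed
  with y r lim show ?thesis by blast
qed

text \<open>Midpoints are the combinations that the parallelogram law asks for, and they reduce
  every closure proof to one binary step.\<close>

inductive_set midpoint_hull :: "('a \<Rightarrow> 'b::real_vector) set \<Rightarrow> ('a \<Rightarrow> 'b) set" for S where
  base: "f \<in> S \<Longrightarrow> f \<in> midpoint_hull S"
| midpoint: "f \<in> midpoint_hull S \<Longrightarrow> g \<in> midpoint_hull S \<Longrightarrow> (\<lambda>x. (1/2) *\<^sub>R (f x + g x)) \<in> midpoint_hull S"

lemma midpoint_hull_mono:
  assumes "S \<subseteq> T" shows "midpoint_hull S \<subseteq> midpoint_hull T"
proof
  fix f assume "f \<in> midpoint_hull S"
  then show "f \<in> midpoint_hull T"
    by induction (use assms in \<open>auto intro: midpoint_hull.intros\<close>)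
qed

text \<open>A substitute for weak sequential compactness: almost minimal elements of the hulls of the
  tails are Cauchy by the parallelogram law.\<close>

lemma (in finite_measure) L2_bounded_Mazur:
  assumes xi: "\<And>n. \<xi> n \<in> L2 M" and R: "\<And>n. l2_norm M (\<xi> n) \<le> R"
  shows "\<exists>y\<in>L2 M. \<exists>z. (\<forall>n. z n \<in> midpoint_hull (\<xi> ` {n..})) \<and>
    (AE x in M. (\<lambda>n. z n x) \<longlonglongrightarrow> y x) \<and> (\<lambda>n. l2_norm M (\<lambda>x. z n x - y x)) \<longlonglongrightarrow> 0"
proof -
  define H where "H n = midpoint_hull (\<xi> ` {n..})" for n
  have H_L2: "f \<in> L2 M" if "f \<in> H n" for f n
    using that unfolding H_def by induction (auto intro!: xi L2_scaleR L2_add)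
  have H_mono: "H n \<subseteq> H m" if "m \<le> n" for m n
    unfolding H_def using that by (intro midpoint_hull_mono image_mono) auto
  \<comment> \<open>The hulls of the tails shrink, so these infima increase; they stay below
    \<open>R\<^sup>2\<close>.\<close>
  define a where "a n = (INF f\<in>H n. (l2_norm M f)\<^sup>2)" for n
  have bdd: "bdd_below ((\<lambda>f. (l2_norm M f)\<^sup>2) ` H n)" for n
    by (rule bdd_belowI[of _ 0]) auto
  have ne: "\<xi> n \<in> H n" for n unfolding H_def by (rule midpoint_hull.base) auto
  have a_le: "a n \<le> (l2_norm M f)\<^sup>2" if "f \<in> H n" for f n
    unfolding a_def by (rule cINF_lower[OF bdd that])
  have a_mono: "incseq a"
    unfolding a_def by (intro monoI cINF_superset_mono bdd H_mono) (use ne in auto)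
  have "a n \<le> R\<^sup>2" for n
    using a_le[OF ne] power_mono[OF R l2_norm_nonneg, of n 2] by (meson order_trans)
  then obtain L where L: "a \<longlonglongrightarrow> L" and aL: "\<And>n. a n \<le> L"
    using incseq_convergent[OF a_mono] by metis
  have "\<exists>f\<in>H n. (l2_norm M f)\<^sup>2 < a n + inverse (real (Suc n))" for n
    using cINF_less_iff[OF _ bdd, of n "a n + inverse (real (Suc n))"] ne[of n]
    by (auto simp: a_def)
  then obtain z where zH: "\<And>n. z n \<in> H n"
    and z: "\<And>n. (l2_norm M (z n))\<^sup>2 < a n + inverse (real (Suc n))" by metis
  have z_L2: "z n \<in> L2 M" for n by (rule H_L2[OF zH])
  \<comment> \<open>Both elements and their midpoint lie in \<open>H N\<close>: the midpoint is
    bounded below by \<open>a N\<close>, the squared norms of the elements above by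
    \<open>L + inverse (real (Suc N))\<close>.\<close>
  have dist: "(l2_norm M (\<lambda>x. z m x - z n x))\<^sup>2 \<le> 4 * (L - a N) + 4 * inverse (real (Suc N))"
    if "N \<le> m" "N \<le> n" for m n N
  proof -
    have "z m \<in> H N" "z n \<in> H N" using zH H_mono that by blast+
    then have "(\<lambda>x. (1/2) *\<^sub>R (z m x + z n x)) \<in> H N"
      unfolding H_def by (rule midpoint_hull.midpoint)
    note a_le[OF this]
    moreover have "(l2_norm M (z k))\<^sup>2 \<le> L + inverse (real (Suc N))" if "N \<le> k" for k
    proof -
      have "inverse (real (Suc k)) \<le> inverse (real (Suc N))"
        using that by (intro le_imp_inverse_le) auto
      then show ?thesis using z[of k] aL[of k] by linarith
    qed
    note this[OF that(1)] this[OF that(2)]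
    moreover have "2 * A + 2 * B - 4 * Q \<le> 4 * (L - P) + 4 * d"
      if "P \<le> Q" "A \<le> L + d" "B \<le> L + d" for A B P Q d :: real
      using that by argo
    ultimately show ?thesis unfolding l2_norm_parallelogram[OF z_L2 z_L2] by blast
  qed
  have "(\<lambda>N. 4 * (L - a N) + 4 * inverse (real (Suc N))) \<longlonglongrightarrow> 4 * (L - L) + 4 * 0"
    by (intro tendsto_intros L LIMSEQ_inverse_real_of_nat)
  then have small: "(\<lambda>N. 4 * (L - a N) + 4 * inverse (real (Suc N))) \<longlonglongrightarrow> 0" by simp
  have "\<exists>N. \<forall>m\<ge>N. \<forall>n\<ge>N. l2_norm M (\<lambda>x. z m x - z n x) \<le> e" if "0 < e" for e
  proof -
    have "eventually (\<lambda>N. 4 * (L - a N) + 4 * inverse (real (Suc N)) < e\<^sup>2) sequentially"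
      using that by (intro order_tendstoD[OF small]) simp
    then obtain N where N: "4 * (L - a N) + 4 * inverse (real (Suc N)) < e\<^sup>2"
      by (auto simp: eventually_sequentially)
    have "l2_norm M (\<lambda>x. z m x - z n x) \<le> e" if "m \<ge> N" "n \<ge> N" for m n
      using order_trans[OF dist[OF that] less_imp_le[OF N]] \<open>0 < e\<close> by (rule power2_le_imp_le[OF _ less_imp_le])
    then show ?thesis by blast
  qed
  from L2_complete[OF z_L2 this] obtain y r where y: "y \<in> L2 M" and r: "strict_mono r"
    and ae: "AE x in M. (\<lambda>n. z (r n) x) \<longlonglongrightarrow> y x"
    and lim: "(\<lambda>n. l2_norm M (\<lambda>x. z n x - y x)) \<longlonglongrightarrow> 0" by blast
  have "z (r n) \<in> H n" for n using zH[of "r n"] H_mono[OF seq_suble[OF r, of n]] by blast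
  moreover have "(\<lambda>n. l2_norm M (\<lambda>x. z (r n) x - y x)) \<longlonglongrightarrow> 0"
    using LIMSEQ_subseq_LIMSEQ[OF lim r] by (simp add: comp_def)
  ultimately show ?thesis using y ae unfolding H_def
    by (intro bexI[of _ y] exI[of _ "\<lambda>n. z (r n)"]) auto
qed

section \<open>Moreau envelopes\<close>

text \<open>Removes the second order remainder of a variation after division by the step length
  s.\<close>

lemma nonneg_if_nonneg_perturbed:
  fixes a b :: real
  assumes "\<And>s. 0 < s \<Longrightarrow> s < 1 \<Longrightarrow> 0 \<le> a + s * b"
  shows "0 \<le> a"
proof (rule tendsto_lowerbound)
  have "((\<lambda>s. a + s * b) \<longlongrightarrow> a + 0 * b) (at_right 0)"
    by (intro tendsto_intros)
  then show "((\<lambda>s. a + s * b) \<longlongrightarrow> a) (at_right 0)" by simp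
  show "\<forall>\<^sub>F s in at_right 0. 0 \<le> a + s * b"
    using assms by (auto simp: eventually_at_right_field intro!: exI[of _ 1])
qed simp

text \<open>The properties of \<open>1/2 * \<bar>\<gamma> q\<bar>\<^sup>2\<close> on which the
  construction of the subgradient rests. Homogeneity survives as a Lipschitz bound with linearly
  growing constant: it makes \<open>A\<close> of an L2 field integrable, its integral continuous,
  and the fields \<open>yosida l p\<close> bounded in L2.\<close>

locale quadratic_convex =
  fixes A :: "'a::euclidean_space \<Rightarrow> real" and c :: real
  assumes convex: "convex_on UNIV A"
    and nonneg: "0 \<le> A p"
    and zero: "A 0 = 0"
    and c_nonneg: "0 \<le> c"
    and lipschitz: "\<bar>A p - A q\<bar> \<le> c * norm (p - q) * (norm p + norm q)"
begin

lemma quadratic_bound: "A p \<le> c * (norm p)\<^sup>2"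
  using lipschitz[of p 0] nonneg[of p] by (simp add: zero power2_eq_square mult.assoc)

lemma continuous: "continuous_on S A"
proof (rule continuous_on_subset)
  show "continuous_on UNIV A"
    by (rule convex_on_continuous) (auto intro: convex)
qed simp

definition prox :: "real \<Rightarrow> 'a \<Rightarrow> 'a" where
  "prox l p = (SOME z. \<forall>r. A z + (norm (p - z))\<^sup>2 / (2 * l) \<le> A r + (norm (p - r))\<^sup>2 / (2 * l))"

text \<open>The Yosida approximation of the subdifferential. It is the gradient of
  \<open>envelope l\<close> at p and at the same time a subgradient of \<open>A\<close> at
  \<open>prox l p\<close>; the first role enters through \<open>envelope_add_le\<close>, the second
  through \<open>yosida_subgradient\<close>.\<close>

definition yosida :: "real \<Rightarrow> 'a \<Rightarrow> 'a" where
  "yosida l p = (1 / l) *\<^sub>R (p - prox l p)"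

definition envelope :: "real \<Rightarrow> 'a \<Rightarrow> real" where
  "envelope l p = A (prox l p) + (norm (p - prox l p))\<^sup>2 / (2 * l)"

context
  fixes l :: real
  assumes l: "0 < l"
begin

text \<open>A minimizer exists by compactness: outside the ball of radius |p| about p the quadratic
  term alone exceeds |p|^2 / (2 l), which is the value at 0.\<close>

lemma prox_minimal: "envelope l p \<le> A r + (norm (p - r))\<^sup>2 / (2 * l)"
proof -
  let ?f = "\<lambda>r. A r + (norm (p - r))\<^sup>2 / (2 * l)"
  have "continuous_on (cball p (norm p)) ?f"
    using l by (intro continuous_intros continuous) auto
  moreover have "cball p (norm p) \<noteq> {}" by simp
  ultimately have "\<exists>z\<in>cball p (norm p). \<forall>r\<in>cball p (norm p). ?f z \<le> ?f r"
    by (intro continuous_attains_inf compact_cball)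
  then obtain z where z: "z \<in> cball p (norm p)" "\<And>r. r \<in> cball p (norm p) \<Longrightarrow> ?f z \<le> ?f r"
    by blast
  have "?f z \<le> ?f r" for r
  proof (cases "r \<in> cball p (norm p)")
    case False
    have "?f z \<le> ?f 0" by (rule z(2)) (simp add: dist_norm)
    also have "\<dots> \<le> (norm (p - r))\<^sup>2 / (2 * l)"
      using False l by (auto simp: zero dist_norm intro!: divide_right_mono power_mono)
    also have "\<dots> \<le> ?f r" using nonneg by simp
    finally show ?thesis .
  qed (rule z(2))
  then have "\<forall>r. ?f (prox l p) \<le> ?f r"
    unfolding prox_def by (intro someI_ex[of "\<lambda>z. \<forall>r. ?f z \<le> ?f r"]) blast
  then show ?thesis by (simp add: envelope_def)
qed

lemma inner_yosida: "yosida l p \<bullet> v = ((p - prox l p) \<bullet> v) / l"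
  by (simp add: yosida_def)

text \<open>Fermat's rule at the proximal point: comparison with points of the segment towards r,
  division by s, and s tending to 0.\<close>

lemma yosida_subgradient: "A (prox l p) + yosida l p \<bullet> (r - prox l p) \<le> A r"
proof -
  let ?z = "prox l p"
  have "0 \<le> (A r - A ?z - yosida l p \<bullet> (r - ?z)) + s * ((norm (r - ?z))\<^sup>2 / (2 * l))"
    if s: "0 < s" "s < 1" for s
  proof -
    let ?r = "(1 - s) *\<^sub>R ?z + s *\<^sub>R r"
    have Ar: "A ?r \<le> (1 - s) * A ?z + s * A r"
      using s convex_onD[OF convex, of s ?z r] by simp
    have "p - ?r = (p - ?z) - s *\<^sub>R (r - ?z)" by (simp add: algebra_simps)
    then have "(norm (p - ?r))\<^sup>2 = (norm (p - ?z))\<^sup>2 - 2 * s * ((p - ?z) \<bullet> (r - ?z)) + s\<^sup>2 * (norm (r - ?z))\<^sup>2"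
      by (simp only: power2_norm_eq_inner) (simp add: inner_diff_left inner_diff_right inner_commute algebra_simps power2_eq_square)
    then have "(norm (p - ?r))\<^sup>2 / (2 * l) =
        (norm (p - ?z))\<^sup>2 / (2 * l) - s * (yosida l p \<bullet> (r - ?z)) + s\<^sup>2 * ((norm (r - ?z))\<^sup>2 / (2 * l))"
      unfolding inner_yosida by (simp add: add_divide_distrib diff_divide_distrib)
    then have "0 \<le> s * ((A r - A ?z - yosida l p \<bullet> (r - ?z)) + s * ((norm (r - ?z))\<^sup>2 / (2 * l)))"
      using prox_minimal[of p ?r] Ar by (simp add: envelope_def algebra_simps power2_eq_square)
    then show ?thesis using s by (simp only: zero_le_mult_iff) simp
  qed
  from nonneg_if_nonneg_perturbed[OF this] show ?thesis by simp
qed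

lemma prox_plus_yosida: "p = prox l p + l *\<^sub>R yosida l p"
  using l by (simp add: yosida_def)

text \<open>Since 0 minimizes \<open>A\<close>, the subgradient at the proximal point has a
  nonnegative inner product with that point.\<close>

lemma norm_prox_le: "norm (prox l p) \<le> norm p"
proof -
  have "0 \<le> yosida l p \<bullet> prox l p"
    using yosida_subgradient[of p 0] nonneg[of "prox l p"] by (simp add: zero)
  then have "(norm (prox l p))\<^sup>2 \<le> p \<bullet> prox l p"
    using l by (subst (3) prox_plus_yosida) (simp add: inner_add_left power2_norm_eq_inner)
  also have "\<dots> \<le> norm p * norm (prox l p)" by (rule norm_cauchy_schwarz)
  finally show ?thesis
    by (cases "prox l p = 0") (simp_all add: power2_eq_square mult_le_cancel_right)
qed

text \<open>Adding the subgradient inequalities at the two proximal points gives monotonicity. The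
  estimate supplies continuity, hence measurability, of \<open>prox l\<close>.\<close>

lemma prox_nonexpansive: "norm (prox l p - prox l q) \<le> norm (p - q)"
proof -
  let ?d = "prox l p - prox l q"
  have "0 \<le> (yosida l p - yosida l q) \<bullet> ?d"
    using yosida_subgradient[of p "prox l q"] yosida_subgradient[of q "prox l p"]
    by (simp add: inner_diff_left inner_diff_right)
  then have "0 \<le> l * ((yosida l p - yosida l q) \<bullet> ?d)" using l by simp
  also have "\<dots> = (p - q) \<bullet> ?d - (norm ?d)\<^sup>2"
    using l by (simp add: yosida_def power2_norm_eq_inner inner_diff_left inner_diff_right algebra_simps)
  also have "(p - q) \<bullet> ?d \<le> norm (p - q) * norm ?d" by (rule norm_cauchy_schwarz)
  finally show ?thesis
    by (cases "?d = 0") (simp_all add: power2_eq_square mult_le_cancel_right)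
qed

lemma continuous_prox: "continuous_on S (prox l)"
  by (rule lipschitz_on_continuous_on[of 1])
     (auto intro!: lipschitz_onI simp: dist_norm prox_nonexpansive)

text \<open>The subgradient inequality is tested in the direction of the subgradient itself, and the
  Lipschitz bound limits the slope. The result is uniform in l, which keeps the approximate
  subgradients bounded in L2.\<close>

lemma norm_yosida_le: "norm (yosida l p) \<le> 2 * c * norm p"
proof -
  let ?z = "prox l p" and ?x = "yosida l p"
  have "norm ?x \<le> 2 * c * norm ?z"
  proof (cases "?x = 0")
    case True
    then show ?thesis using c_nonneg by simp
  next
    case False
    have "0 \<le> (2 * c * norm ?z - norm ?x) + t * (c * norm ?x)" if "0 < t" for t
    proof -
      have "t * (norm ?x)\<^sup>2 \<le> A (?z + t *\<^sub>R ?x) - A ?z"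
        using yosida_subgradient[of p "?z + t *\<^sub>R ?x"] by (simp add: power2_norm_eq_inner)
      also have "\<dots> \<le> c * norm (t *\<^sub>R ?x) * (norm (?z + t *\<^sub>R ?x) + norm ?z)"
        using lipschitz[of "?z + t *\<^sub>R ?x" ?z] by simp
      also have "\<dots> \<le> c * norm (t *\<^sub>R ?x) * ((norm ?z + norm (t *\<^sub>R ?x)) + norm ?z)"
        using c_nonneg by (intro mult_left_mono add_right_mono norm_triangle_ineq) auto
      finally have "(t * norm ?x) * norm ?x \<le> (t * norm ?x) * (c * (2 * norm ?z + t * norm ?x))"
        using that by (simp add: power2_eq_square algebra_simps)
      then have "norm ?x \<le> c * (2 * norm ?z + t * norm ?x)"
        using that False by (subst (asm) mult_le_cancel_left_pos) auto
      then show ?thesis by (simp add: algebra_simps)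
    qed
    from nonneg_if_nonneg_perturbed[OF this] show ?thesis by simp
  qed
  also have "\<dots> \<le> 2 * c * norm p"
    using norm_prox_le c_nonneg by (intro mult_left_mono) auto
  finally show ?thesis .
qed

lemma norm_diff_prox_le: "norm (p - prox l p) \<le> 2 * c * l * norm p"
proof -
  have "norm (p - prox l p) = l * norm (yosida l p)"
    using l by (simp add: yosida_def)
  also have "\<dots> \<le> l * (2 * c * norm p)"
    using l norm_yosida_le by (intro mult_left_mono) auto
  finally show ?thesis by (simp add: ac_simps)
qed

lemma envelope_nonneg: "0 \<le> envelope l p"
  using l nonneg by (simp add: envelope_def)

lemma envelope_le: "envelope l p \<le> A p"
  using prox_minimal[of p p] by simp

text \<open>The loss is a Lipschitz factor times the distance to the proximal point, which
  \<open>norm_diff_prox_le\<close> makes of order l; the penalty in \<open>energy_ge\<close> absorbs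
  it.\<close>

lemma envelope_ge: "A p - 4 * c\<^sup>2 * l * (norm p)\<^sup>2 \<le> envelope l p"
proof -
  have "A p - A (prox l p) \<le> c * norm (p - prox l p) * (norm p + norm (prox l p))"
    using lipschitz[of p "prox l p"] by simp
  also have "\<dots> \<le> c * (2 * c * l * norm p) * (norm p + norm p)"
    using c_nonneg l by (intro mult_mono mult_left_mono norm_diff_prox_le add_left_mono norm_prox_le) auto
  also have "\<dots> = 4 * c\<^sup>2 * l * (norm p)\<^sup>2" by (simp add: power2_eq_square)
  finally have "A p - A (prox l p) \<le> 4 * c\<^sup>2 * l * (norm p)\<^sup>2" .
  moreover have "0 \<le> (norm (p - prox l p))\<^sup>2 / (2 * l)" using l by simp
  ultimately show ?thesis unfolding envelope_def by argo
qed

text \<open>The proximal point of p is inserted as a competitor at p + v. The price of smoothing is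
  the curvature 1 / l, which later dictates the step length.\<close>

lemma envelope_add_le:
  "envelope l (p + v) \<le> envelope l p + yosida l p \<bullet> v + (norm v)\<^sup>2 / (2 * l)"
proof -
  let ?z = "prox l p"
  have "(norm (p + v - ?z))\<^sup>2 = (norm (p - ?z))\<^sup>2 + 2 * ((p - ?z) \<bullet> v) + (norm v)\<^sup>2"
    by (simp only: power2_norm_eq_inner) (simp add: inner_diff_left inner_diff_right inner_add_left inner_add_right inner_commute)
  then have "A ?z + (norm (p + v - ?z))\<^sup>2 / (2 * l) =
      envelope l p + yosida l p \<bullet> v + (norm v)\<^sup>2 / (2 * l)"
    unfolding inner_yosida envelope_def by (simp add: add_divide_distrib diff_divide_distrib)
  then show ?thesis using prox_minimal[of "p + v" ?z] by simp
qed

lemma borel_measurable_prox [measurable]: "prox l \<in> borel_measurable borel"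
  by (intro borel_measurable_continuous_onI continuous_prox)

lemma borel_measurable_yosida [measurable]: "yosida l \<in> borel_measurable borel"
  unfolding yosida_def[abs_def] by measurable

end

lemma borel_measurable [measurable]: "A \<in> borel_measurable borel"
  by (intro borel_measurable_continuous_onI continuous)

lemma borel_measurable_envelope: "0 < l \<Longrightarrow> envelope l \<in> borel_measurable borel"
  unfolding envelope_def[abs_def] by measurable

lemma integrable_quadratic:
  assumes p: "p \<in> L2 M" and f: "f \<in> borel_measurable borel" and "\<And>r. 0 \<le> f r" "\<And>r. f r \<le> A r"
  shows "integrable M (\<lambda>x. f (p x))"
proof (rule Bochner_Integration.integrable_bound)
  show "integrable M (\<lambda>x. c * (norm (p x))\<^sup>2)" using p by (simp add: L2_def)
  show "(\<lambda>x. f (p x)) \<in> borel_measurable M"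
    using L2_measurable[OF p] f by simp
  show "AE x in M. norm (f (p x)) \<le> norm (c * (norm (p x))\<^sup>2)"
    using order_trans[OF assms(4) quadratic_bound] assms(3) c_nonneg by (intro AE_I2) simp
qed

lemma integrable_comp: "p \<in> L2 M \<Longrightarrow> integrable M (\<lambda>x. A (p x))"
  by (rule integrable_quadratic) (auto intro: nonneg)

lemma integrable_envelope: "p \<in> L2 M \<Longrightarrow> 0 < l \<Longrightarrow> integrable M (\<lambda>x. envelope l (p x))"
  by (rule integrable_quadratic) (auto intro: borel_measurable_envelope envelope_nonneg envelope_le)

lemma integral_lipschitz:
  assumes p: "p \<in> L2 M" and q: "q \<in> L2 M"
  shows "(LINT x|M. \<bar>A (p x) - A (q x)\<bar>) \<le> c * l2_norm M (\<lambda>x. p x - q x) * (l2_norm M p + l2_norm M q)"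
proof -
  let ?d = "\<lambda>x. p x - q x"
  have d: "?d \<in> L2 M" by (intro L2_diff p q)
  have "(LINT x|M. \<bar>A (p x) - A (q x)\<bar>) \<le>
      (LINT x|M. c * (norm (?d x) * norm (p x) + norm (?d x) * norm (q x)))"
  proof (rule integral_mono)
    show "integrable M (\<lambda>x. c * (norm (?d x) * norm (p x) + norm (?d x) * norm (q x)))"
      by (intro integrable_mult_right Bochner_Integration.integrable_add L2_mult_integrable d p q)
    show "\<bar>A (p x) - A (q x)\<bar> \<le> c * (norm (?d x) * norm (p x) + norm (?d x) * norm (q x))" for x
      using lipschitz[of "p x" "q x"] by (simp add: algebra_simps)
  qed (intro integrable_abs Bochner_Integration.integrable_diff integrable_comp p q)
  also have "\<dots> = c * ((LINT x|M. norm (?d x) * norm (p x)) + (LINT x|M. norm (?d x) * norm (q x)))"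
    by (simp add: L2_mult_integrable d p q)
  also have "\<dots> \<le> c * (l2_norm M ?d * l2_norm M p + l2_norm M ?d * l2_norm M q)"
    using c_nonneg by (intro mult_left_mono add_mono l2_norm_Cauchy_Schwarz_norm d p q) auto
  finally show ?thesis by (simp add: algebra_simps)
qed

end

section \<open>A subgradient of an integral functional along a convex set of directions\<close>

text \<open>In a pair (w, d), w is an increment of the argument of \<open>A\<close> and d the value
  of the linear part, which is not given as a continuous functional of w.\<close>

locale convex_directions = quadratic_convex A c + finite_measure M
  for A :: "'a::euclidean_space \<Rightarrow> real" and c :: real and M :: "'x measure" +
  fixes q :: "'x \<Rightarrow> 'a" and K :: "(('x \<Rightarrow> 'a) \<times> real) set"
  assumes q: "q \<in> L2 M"
    and K_L2: "(w, d) \<in> K \<Longrightarrow> w \<in> L2 M"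
    and K_zero: "(\<lambda>x. 0, 0) \<in> K"
    and K_convex: "(v, d) \<in> K \<Longrightarrow> (w, e) \<in> K \<Longrightarrow> 0 \<le> s \<Longrightarrow> s \<le> 1 \<Longrightarrow>
      (\<lambda>x. v x + s *\<^sub>R (w x - v x), d + s * (e - d)) \<in> K"
    and K_minimal: "(w, d) \<in> K \<Longrightarrow> 0 \<le> (LINT x|M. A (q x + w x) - A (q x)) + d"
begin

section \<open>Almost minimizers of the penalized energy\<close>

abbreviation n2 :: "('x \<Rightarrow> 'a) \<Rightarrow> real" where "n2 \<equiv> l2_norm M"

lemma shifted_L2: "(w, d) \<in> K \<Longrightarrow> (\<lambda>x. q x + w x) \<in> L2 M"
  by (intro L2_add q K_L2)

text \<open>Together with \<open>K_minimal\<close> this bounds the linear part of a direction from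
  below in terms of its gradient part.\<close>

lemma integral_A_diff_le:
  assumes w: "w \<in> L2 M"
  shows "(LINT x|M. A (q x + w x) - A (q x)) \<le> c * n2 w * (2 * n2 q + n2 w)"
proof -
  have p: "(\<lambda>x. q x + w x) \<in> L2 M" by (intro L2_add q w)
  have "(LINT x|M. A (q x + w x) - A (q x)) \<le> (LINT x|M. \<bar>A (q x + w x) - A (q x)\<bar>)"
    by (intro integral_mono integrable_abs Bochner_Integration.integrable_diff integrable_comp p q) auto
  also have "\<dots> \<le> c * n2 (\<lambda>x. q x + w x - q x) * (n2 (\<lambda>x. q x + w x) + n2 q)"
    by (rule integral_lipschitz[OF p q])
  also have "\<dots> \<le> c * n2 w * (2 * n2 q + n2 w)"
    using l2_norm_triangle[OF q w] c_nonneg l2_norm_nonneg[of M w] by (auto intro!: mult_left_mono)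
  finally show ?thesis .
qed

lemma n2_add_square_le:
  assumes w: "w \<in> L2 M"
  shows "(n2 (\<lambda>x. q x + w x))\<^sup>2 \<le> 2 * (n2 q)\<^sup>2 + 2 * (n2 w)\<^sup>2"
proof -
  have "(n2 (\<lambda>x. q x + w x))\<^sup>2 \<le> (n2 q + n2 w)\<^sup>2"
    by (intro power_mono l2_norm_triangle q w l2_norm_nonneg)
  also have "\<dots> \<le> 2 * (n2 q)\<^sup>2 + 2 * (n2 w)\<^sup>2"
    using sum_squares_bound[of "n2 q" "n2 w"] by (simp add: power2_sum)
  finally show ?thesis .
qed

text \<open>The quadratic penalty forces almost minimizers to tend to \<open>0\<close> with \<open>l\<close>, so that the
  subgradients \<open>yosida l (q + w)\<close> found there become subgradients at \<open>q\<close> in the limit.\<close>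

definition energy :: "real \<Rightarrow> ('x \<Rightarrow> 'a) \<times> real \<Rightarrow> real" where
  "energy l k = (LINT x|M. envelope l (q x + fst k x)) + snd k + (n2 (fst k))\<^sup>2 / 2"

text \<open>By minimality the smoothing error is the only loss. For
  \<open>32 * c\<^sup>2 * l \<le> 1\<close> its part in w costs at most half of the penalty, so a
  quarter of the square remains.\<close>

lemma energy_ge:
  assumes l: "0 < l" "32 * c\<^sup>2 * l \<le> 1" and k: "(w, d) \<in> K"
  shows "(LINT x|M. A (q x)) - 8 * c\<^sup>2 * l * (n2 q)\<^sup>2 + (n2 w)\<^sup>2 / 4 \<le> energy l (w, d)"
proof -
  note w = K_L2[OF k] and p = shifted_L2[OF k]
  have "(LINT x|M. A (q x + w x)) - 4 * c\<^sup>2 * l * (n2 (\<lambda>x. q x + w x))\<^sup>2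
      = (LINT x|M. A (q x + w x) - 4 * c\<^sup>2 * l * (norm (q x + w x))\<^sup>2)"
    using integrable_comp[OF p] L2_integrable_square[OF p] by (simp add: l2_norm_square)
  also have "\<dots> \<le> (LINT x|M. envelope l (q x + w x))"
    using integrable_comp[OF p] L2_integrable_square[OF p] integrable_envelope[OF p l(1)] envelope_ge[OF l(1)]
    by (intro integral_mono) auto
  finally have "(LINT x|M. A (q x + w x)) - 4 * c\<^sup>2 * l * (n2 (\<lambda>x. q x + w x))\<^sup>2
      \<le> (LINT x|M. envelope l (q x + w x))" .
  moreover have "4 * c\<^sup>2 * l * (n2 (\<lambda>x. q x + w x))\<^sup>2 \<le> 4 * c\<^sup>2 * l * (2 * (n2 q)\<^sup>2 + 2 * (n2 w)\<^sup>2)"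
    using l by (intro mult_left_mono n2_add_square_le w) auto
  moreover have "(LINT x|M. A (q x)) \<le> (LINT x|M. A (q x + w x)) + d"
    using K_minimal[OF k] by (simp add: integrable_comp p q)
  moreover have "8 * c\<^sup>2 * l * (n2 w)\<^sup>2 \<le> 1 / 4 * (n2 w)\<^sup>2"
    using l by (intro mult_right_mono) auto
  ultimately show ?thesis by (simp add: energy_def algebra_simps)
qed

text \<open>Upper expansion along a segment in \<open>K\<close>: the coefficient 1 / (2 l) of the
  quadratic term comes from \<open>envelope_add_le\<close>, the 1 / 2 from the penalty, whose
  expansion is exact.\<close>

lemma energy_step:
  assumes l: "0 < l" and k: "(w, d) \<in> K" and k': "(v, e) \<in> K"
  shows "energy l (\<lambda>x. w x + s *\<^sub>R (v x - w x), d + s * (e - d)) \<le> energy l (w, d) +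
    s * ((LINT x|M. yosida l (q x + w x) \<bullet> (v x - w x)) + (e - d) + (LINT x|M. w x \<bullet> (v x - w x)))
    + s\<^sup>2 * (1 / (2 * l) + 1 / 2) * (n2 (\<lambda>x. v x - w x))\<^sup>2"
proof -
  note w = K_L2[OF k] and v = K_L2[OF k'] and p = shifted_L2[OF k]
  have y: "(\<lambda>x. yosida l (q x + w x)) \<in> L2 M"
    by (rule L2_dominated[OF _ _ p, where c = "2 * c"])
       (use norm_yosida_le[OF l] borel_measurable_yosida[OF l] L2_measurable[OF p] in auto)
  have vw: "(\<lambda>x. v x - w x) \<in> L2 M" by (intro L2_diff v w)
  have mix: "(\<lambda>x. (q x + w x) + s *\<^sub>R (v x - w x)) \<in> L2 M" by (intro L2_add L2_scaleR p vw)
  let ?I = "\<lambda>f. LINT x|M. f x"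
  have "?I (\<lambda>x. envelope l ((q x + w x) + s *\<^sub>R (v x - w x))) \<le>
      ?I (\<lambda>x. envelope l (q x + w x) + s * (yosida l (q x + w x) \<bullet> (v x - w x))
        + s\<^sup>2 / (2 * l) * (norm (v x - w x))\<^sup>2)"
  proof (rule integral_mono)
    show "envelope l ((q x + w x) + s *\<^sub>R (v x - w x)) \<le> envelope l (q x + w x)
        + s * (yosida l (q x + w x) \<bullet> (v x - w x)) + s\<^sup>2 / (2 * l) * (norm (v x - w x))\<^sup>2" for x
      using envelope_add_le[OF l, of "q x + w x" "s *\<^sub>R (v x - w x)"] by (simp add: power_mult_distrib)
  qed (intro integrable_envelope mix l Bochner_Integration.integrable_add integrable_mult_right
      L2_inner_integrable L2_integrable_square y vw p)+
  also have "\<dots> = ?I (\<lambda>x. envelope l (q x + w x)) + s * ?I (\<lambda>x. yosida l (q x + w x) \<bullet> (v x - w x))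
      + s\<^sup>2 / (2 * l) * (n2 (\<lambda>x. v x - w x))\<^sup>2"
    using integrable_envelope[OF p l] L2_inner_integrable[OF y vw] L2_integrable_square[OF vw]
    by (simp add: l2_norm_square)
  finally have 1: "?I (\<lambda>x. envelope l ((q x + w x) + s *\<^sub>R (v x - w x))) \<le>
    ?I (\<lambda>x. envelope l (q x + w x)) + s * ?I (\<lambda>x. yosida l (q x + w x) \<bullet> (v x - w x))
      + s\<^sup>2 / (2 * l) * (n2 (\<lambda>x. v x - w x))\<^sup>2" .
  have "(n2 (\<lambda>x. w x + s *\<^sub>R (v x - w x)))\<^sup>2 =
      ?I (\<lambda>x. (norm (w x))\<^sup>2 + 2 * s * (w x \<bullet> (v x - w x)) + s\<^sup>2 * (norm (v x - w x))\<^sup>2)"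
  proof -
    have "(norm (a + s *\<^sub>R b))\<^sup>2 = (norm a)\<^sup>2 + 2 * s * (a \<bullet> b) + s\<^sup>2 * (norm b)\<^sup>2" for a b :: 'a
      by (simp only: power2_norm_eq_inner)
         (simp add: inner_add_left inner_add_right inner_commute power2_eq_square)
    then show ?thesis by (simp add: l2_norm_square)
  qed
  also have "\<dots> = (n2 w)\<^sup>2 + 2 * s * ?I (\<lambda>x. w x \<bullet> (v x - w x)) + s\<^sup>2 * (n2 (\<lambda>x. v x - w x))\<^sup>2"
    using L2_inner_integrable[OF w vw] L2_integrable_square[OF vw] L2_integrable_square[OF w]
    by (simp add: l2_norm_square)
  finally have 2: "(n2 (\<lambda>x. w x + s *\<^sub>R (v x - w x)))\<^sup>2 =
    (n2 w)\<^sup>2 + 2 * s * ?I (\<lambda>x. w x \<bullet> (v x - w x)) + s\<^sup>2 * (n2 (\<lambda>x. v x - w x))\<^sup>2" .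
  show ?thesis unfolding energy_def fst_conv snd_conv 2
    using 1 by (simp add: algebra_simps add_divide_distrib)
qed

text \<open>A first order condition in w alone: the number d paired with w is eliminated by
  \<open>K_minimal\<close> and \<open>integral_A_diff_le\<close>, which produces the term with c.
  The product of norms and the integral of \<open>w x \<bullet> w x\<close> stem from the penalty,
  the term l from the minimization gap, and the multiple of l from the second order terms.\<close>

definition almost_stationary :: "real \<Rightarrow> ('x \<Rightarrow> 'a) \<Rightarrow> bool" where
  "almost_stationary l w \<longleftrightarrow> w \<in> L2 M \<and> (n2 w)\<^sup>2 \<le> 4 * (1 + 8 * c\<^sup>2 * (n2 q)\<^sup>2) * l \<and>
    (\<forall>v e. (v, e) \<in> K \<longrightarrow> (LINT x|M. w x \<bullet> w x) - n2 w * n2 v - l - l * (n2 (\<lambda>x. v x - w x))\<^sup>2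
        - c * n2 w * (2 * n2 q + n2 w) + (LINT x|M. yosida l (q x + w x) \<bullet> w x)
      \<le> (LINT x|M. yosida l (q x + w x) \<bullet> v x) + e)"

lemma almost_stationary_exists:
  assumes l: "0 < l" "32 * c\<^sup>2 * l \<le> 1" "l \<le> 1"
  shows "\<exists>w. almost_stationary l w"
proof -
  define I where "I = (INF k\<in>K. energy l k)"
  have lower: "(LINT x|M. A (q x)) - 8 * c\<^sup>2 * l * (n2 q)\<^sup>2 \<le> energy l k" if "k \<in> K" for k
    using energy_ge[OF l(1,2), of "fst k" "snd k"] that
    by (intro order_trans[OF _ energy_ge[OF l(1,2), of "fst k" "snd k", simplified]]) auto
  have bdd: "bdd_below (energy l ` K)" using lower by (intro bdd_belowI2) auto
  have I_le: "I \<le> energy l k" if "k \<in> K" for k unfolding I_def by (rule cINF_lower[OF bdd that])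
  have "\<exists>k\<in>K. energy l k < I + l ^ 3"
    using cINF_less_iff[OF _ bdd, of "I + l ^ 3"] K_zero l by (auto simp: I_def)
  then obtain w d where k: "(w, d) \<in> K" and kI: "energy l (w, d) < I + l ^ 3" by auto
  note w = K_L2[OF k] and p = shifted_L2[OF k]
  have "I \<le> (LINT x|M. envelope l (q x))"
    using I_le[OF K_zero] by (simp add: energy_def l2_norm_def)
  also have "\<dots> \<le> (LINT x|M. A (q x))"
    by (intro integral_mono integrable_envelope integrable_comp q l envelope_le)
  finally have IA: "I \<le> (LINT x|M. A (q x))" .
  have l_cube: "l ^ 3 \<le> l" using power_decreasing[of 1 3 l] l by simp
  \<comment> \<open>Comparison with (0, 0): a quarter of the square is at most
    \<open>l ^ 3 \<le> l\<close> plus the smoothing error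
    \<open>8 * c\<^sup>2 * l * (n2 q)\<^sup>2\<close>.\<close>
  have w_small: "(n2 w)\<^sup>2 \<le> 4 * (1 + 8 * c\<^sup>2 * (n2 q)\<^sup>2) * l"
    using energy_ge[OF l(1,2) k] kI IA l_cube by (simp add: algebra_simps)
  have "(LINT x|M. w x \<bullet> w x) - n2 w * n2 v - l - l * (n2 (\<lambda>x. v x - w x))\<^sup>2
      - c * n2 w * (2 * n2 q + n2 w) + (LINT x|M. yosida l (q x + w x) \<bullet> w x)
      \<le> (LINT x|M. yosida l (q x + w x) \<bullet> v x) + e" if k': "(v, e) \<in> K" for v e
  proof -
    note v = K_L2[OF k']
    have y: "(\<lambda>x. yosida l (q x + w x)) \<in> L2 M"
      by (rule L2_dominated[OF _ _ p, where c = "2 * c"])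
         (use norm_yosida_le[OF l(1)] borel_measurable_yosida[OF l(1)] L2_measurable[OF p] in auto)
    define N where "N = (n2 (\<lambda>x. v x - w x))\<^sup>2"
    define X where "X = (LINT x|M. yosida l (q x + w x) \<bullet> (v x - w x)) + (e - d) + (LINT x|M. w x \<bullet> (v x - w x))"
    have l_square: "l\<^sup>2 \<le> 1" using l by (simp add: power_le_one)
    \<comment> \<open>A step of length \<open>l\<^sup>2\<close>: the minimization gap \<open>l\<^sup>3\<close> and the curvature \<open>1 / l\<close> of the
      envelope then both contribute an error of order \<open>l\<close>.\<close>
    have "(\<lambda>x. w x + l\<^sup>2 *\<^sub>R (v x - w x), d + l\<^sup>2 * (e - d)) \<in> K"
      using l_square by (intro K_convex k k') auto
    from I_le[OF this] energy_step[OF l(1) k k', of "l\<^sup>2"] kI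
    have "0 \<le> l ^ 3 + l\<^sup>2 * X + (l\<^sup>2)\<^sup>2 * (1 / (2 * l) + 1 / 2) * N"
      by (simp add: X_def N_def)
    also have "\<dots> = l\<^sup>2 * (l + X + (l / 2 + l\<^sup>2 / 2) * N)"
      using l by (simp add: field_simps power2_eq_square power3_eq_cube)
    finally have "0 \<le> l + X + (l / 2 + l\<^sup>2 / 2) * N"
      using l by (simp add: zero_le_mult_iff)
    moreover have "(l / 2 + l\<^sup>2 / 2) * N \<le> l * N"
    proof (rule mult_right_mono)
      have "l\<^sup>2 \<le> l" using l mult_left_mono[of l 1 l] by (simp add: power2_eq_square)
      then show "l / 2 + l\<^sup>2 / 2 \<le> l" by argo
    qed (simp add: N_def)
    moreover have "X = (LINT x|M. yosida l (q x + w x) \<bullet> v x) - (LINT x|M. yosida l (q x + w x) \<bullet> w x)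
        + (e - d) + (LINT x|M. w x \<bullet> v x) - (LINT x|M. w x \<bullet> w x)"
      unfolding X_def inner_diff_right by (simp add: L2_inner_integrable y v w)
    moreover have "(LINT x|M. w x \<bullet> v x) \<le> n2 w * n2 v"
      using l2_norm_Cauchy_Schwarz[OF w v] by simp
    moreover have "- d \<le> c * n2 w * (2 * n2 q + n2 w)"
      using K_minimal[OF k] integral_A_diff_le[OF w] by simp
    ultimately show ?thesis unfolding N_def[symmetric] by linarith
  qed
  then show ?thesis using w w_small unfolding almost_stationary_def by blast
qed

section \<open>Approximate subgradients at the base field\<close>

lemma norm_yosida_l2_le:
  assumes l: "0 < l" and p: "p \<in> L2 M"
  shows "(\<lambda>x. yosida l (p x)) \<in> L2 M" "n2 (\<lambda>x. yosida l (p x)) \<le> 2 * c * n2 p"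
proof -
  have m: "(\<lambda>x. yosida l (p x)) \<in> borel_measurable M"
    using borel_measurable_yosida[OF l] L2_measurable[OF p] by simp
  then show "(\<lambda>x. yosida l (p x)) \<in> L2 M"
    by (rule L2_dominated[OF _ _ p, where c = "2 * c"]) (use norm_yosida_le[OF l] in auto)
  have "n2 (\<lambda>x. yosida l (p x)) \<le> n2 (\<lambda>x. (2 * c) *\<^sub>R p x)"
    using norm_yosida_le[OF l] m c_nonneg by (intro l2_norm_mono L2_scaleR p) auto
  then show "n2 (\<lambda>x. yosida l (p x)) \<le> 2 * c * n2 p"
    using c_nonneg by (simp add: l2_norm_scaleR del: real_scaleR_def)
qed

text \<open>A pointwise \<rho>-subgradient at q whose defect is small in mean. The defect may vary
  with x but not with r, so it averages under midpoints and, along a subsequence, vanishes in the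
  limit at almost every x.\<close>

definition almost_subgradient :: "real \<Rightarrow> ('x \<Rightarrow> 'a) \<Rightarrow> bool" where
  "almost_subgradient \<delta> f \<longleftrightarrow> (\<exists>\<rho>. integrable M \<rho> \<and> (\<forall>x. 0 \<le> \<rho> x) \<and> (LINT x|M. \<rho> x) \<le> \<delta> \<and>
     (\<forall>x r. A (q x) + f x \<bullet> (r - q x) - \<rho> x \<le> A r))"

lemma almost_subgradient_mono:
  "almost_subgradient \<delta> f \<Longrightarrow> \<delta> \<le> \<delta>' \<Longrightarrow> almost_subgradient \<delta>' f"
  unfolding almost_subgradient_def using order_trans by blast

lemma almost_subgradient_midpoint:
  assumes "almost_subgradient \<delta> f" "almost_subgradient \<delta> g"
  shows "almost_subgradient \<delta> (\<lambda>x. (1/2) *\<^sub>R (f x + g x))"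
proof -
  obtain \<rho> \<sigma> where r: "integrable M \<rho>" "\<And>x. 0 \<le> \<rho> x" "(LINT x|M. \<rho> x) \<le> \<delta>"
      "\<And>x r. A (q x) + f x \<bullet> (r - q x) - \<rho> x \<le> A r"
    and s: "integrable M \<sigma>" "\<And>x. 0 \<le> \<sigma> x" "(LINT x|M. \<sigma> x) \<le> \<delta>"
      "\<And>x r. A (q x) + g x \<bullet> (r - q x) - \<sigma> x \<le> A r"
    using assms unfolding almost_subgradient_def by metis
  have "A (q x) + ((1/2) *\<^sub>R (f x + g x)) \<bullet> (r - q x) - (\<rho> x + \<sigma> x) / 2 \<le> A r" for x r
  proof -
    have "((1/2) *\<^sub>R (f x + g x)) \<bullet> (r - q x) = (f x \<bullet> (r - q x) + g x \<bullet> (r - q x)) / 2"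
      by (simp add: inner_add_left)
    then show ?thesis using r(4)[of x r] s(4)[of x r] by argo
  qed
  then show ?thesis unfolding almost_subgradient_def
    by (intro exI[of _ "\<lambda>x. (\<rho> x + \<sigma> x) / 2"]) (use r(1-3) s(1-3) in auto)
qed

text \<open>The field is an exact subgradient at the proximal point z; moving the base point to q
  costs the difference of the values of \<open>A\<close> plus the norm of the subgradient times |z -
  q|. The first factor of the bound estimates z - q, the second the norms of the subgradient, of z
  and of q.\<close>

lemma almost_subgradient_yosida:
  assumes l: "0 < l" and w: "w \<in> L2 M"
  shows "almost_subgradient ((n2 w + 2 * c * l * (n2 q + n2 w)) * (2 * c * (2 * n2 q + n2 w) + c * (2 * n2 q + n2 w)))
    (\<lambda>x. yosida l (q x + w x))"
proof -
  let ?p = "\<lambda>x. q x + w x"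
  let ?z = "\<lambda>x. prox l (?p x)" and ?y = "\<lambda>x. yosida l (?p x)"
  let ?\<rho> = "\<lambda>x. \<bar>A (?z x) - A (q x)\<bar> + norm (?y x) * norm (?z x - q x)"
  have p: "?p \<in> L2 M" by (intro L2_add q w)
  have np: "n2 ?p \<le> n2 q + n2 w" by (rule l2_norm_triangle[OF q w])
  note y = norm_yosida_l2_le[OF l p]
  have zm: "?z \<in> borel_measurable M"
    using borel_measurable_prox[OF l] L2_measurable[OF p] by simp
  have z: "?z \<in> L2 M"
    by (rule L2_dominated[OF zm _ p, where c = 1]) (use norm_prox_le[OF l] in auto)
  have nz: "n2 ?z \<le> n2 ?p" by (rule l2_norm_mono[OF _ zm p]) (use norm_prox_le[OF l] in auto)
  have zq: "(\<lambda>x. ?z x - q x) \<in> L2 M" by (intro L2_diff z q)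
  have "n2 (\<lambda>x. ?z x - q x) = n2 (\<lambda>x. w x - l *\<^sub>R ?y x)"
    using prox_plus_yosida[OF l] by (intro arg_cong[where f = n2] ext) (simp add: algebra_simps)
  also have "\<dots> \<le> n2 w + l * n2 ?y"
    using l2_norm_triangle_diff[OF w L2_scaleR[OF y(1)], of l] l by (simp add: l2_norm_scaleR)
  also have "\<dots> \<le> n2 w + l * (2 * c * (n2 q + n2 w))"
    using y(2) np c_nonneg l by (intro add_left_mono mult_left_mono order_trans[OF y(2)]) auto
  finally have nzq: "n2 (\<lambda>x. ?z x - q x) \<le> n2 w + 2 * c * l * (n2 q + n2 w)" by (simp add: ac_simps)
  have int: "integrable M ?\<rho>"
    by (intro Bochner_Integration.integrable_add integrable_abs Bochner_Integration.integrable_diff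
        integrable_comp z q L2_mult_integrable y zq)
  have "(LINT x|M. ?\<rho> x) = (LINT x|M. \<bar>A (?z x) - A (q x)\<bar>) + (LINT x|M. norm (?y x) * norm (?z x - q x))"
    by (intro Bochner_Integration.integral_add integrable_abs Bochner_Integration.integrable_diff
        integrable_comp z q L2_mult_integrable y zq)
  also have "\<dots> \<le> c * n2 (\<lambda>x. ?z x - q x) * (n2 ?z + n2 q) + n2 ?y * n2 (\<lambda>x. ?z x - q x)"
    by (intro add_mono integral_lipschitz l2_norm_Cauchy_Schwarz_norm z q y zq)
  also have "\<dots> = n2 (\<lambda>x. ?z x - q x) * (n2 ?y + c * (n2 ?z + n2 q))" by (simp add: algebra_simps)
  also have "\<dots> \<le> (n2 w + 2 * c * l * (n2 q + n2 w)) * (2 * c * (2 * n2 q + n2 w) + c * (2 * n2 q + n2 w))"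
  proof (rule mult_mono[OF nzq add_mono])
    have "2 * c * n2 ?p \<le> 2 * c * (2 * n2 q + n2 w)"
      using np c_nonneg l2_norm_nonneg[of M q] by (intro mult_left_mono) auto
    with y(2) show "n2 ?y \<le> 2 * c * (2 * n2 q + n2 w)" by linarith
    show "c * (n2 ?z + n2 q) \<le> c * (2 * n2 q + n2 w)"
      using np nz c_nonneg by (intro mult_left_mono) auto
  qed (use c_nonneg l in \<open>auto intro!: add_nonneg_nonneg mult_nonneg_nonneg l2_norm_nonneg\<close>)
  finally have le: "(LINT x|M. ?\<rho> x) \<le> (n2 w + 2 * c * l * (n2 q + n2 w)) * (2 * c * (2 * n2 q + n2 w) + c * (2 * n2 q + n2 w))" .
  have "A (q x) + ?y x \<bullet> (r - q x) - ?\<rho> x \<le> A r" for x r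
  proof -
    have "A (?z x) + ?y x \<bullet> (r - ?z x) \<le> A r" by (rule yosida_subgradient[OF l])
    moreover have "?y x \<bullet> (r - q x) = ?y x \<bullet> (r - ?z x) + ?y x \<bullet> (?z x - q x)"
      by (simp add: inner_diff_right)
    moreover have "?y x \<bullet> (?z x - q x) \<le> norm (?y x) * norm (?z x - q x)"
      by (rule norm_cauchy_schwarz)
    moreover have "A (q x) - A (?z x) \<le> \<bar>A (?z x) - A (q x)\<bar>" by simp
    ultimately show ?thesis by linarith
  qed
  with int le show ?thesis unfolding almost_subgradient_def
    by (intro exI[of _ ?\<rho>]) auto
qed

text \<open>Both modes of convergence of the convex combinations are used: in norm for the
  inequality, which is an integral, and almost everywhere for the inclusion, which is
  pointwise.\<close>

theorem subgradient_selection: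
  "\<exists>\<xi>\<in>L2 M. (AE x in M. \<xi> x \<in> convex_subdifferential A (q x)) \<and>
    (\<forall>(v, e)\<in>K. 0 \<le> (LINT x|M. \<xi> x \<bullet> v x) + e)"
proof -
  \<comment> \<open>The shift makes \<open>32 * c\<^sup>2 * l n \<le> 1\<close> hold from n = 0
    on.\<close>
  define n0 where "n0 = nat \<lceil>32 * c\<^sup>2\<rceil>"
  define l where "l n = inverse (real (Suc (n + n0)))" for n
  have l: "0 < l n" "l n \<le> 1" "32 * c\<^sup>2 * l n \<le> 1" for n
  proof -
    show "0 < l n" "l n \<le> 1" by (simp_all add: l_def inverse_le_1_iff)
    have "32 * c\<^sup>2 \<le> real (Suc (n + n0))" unfolding n0_def by linarith
    then show "32 * c\<^sup>2 * l n \<le> 1" by (simp add: l_def field_simps)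
  qed
  have l_lim: "l \<longlonglongrightarrow> 0"
    unfolding l_def using LIMSEQ_ignore_initial_segment[OF LIMSEQ_inverse_real_of_nat, of n0] by simp
  have "\<forall>n. \<exists>w. almost_stationary (l n) w"
    using almost_stationary_exists[OF l(1,3,2)] by blast
  then obtain w where "\<forall>n. almost_stationary (l n) (w n)"
    unfolding choice_iff by blast
  then have w: "\<And>n. w n \<in> L2 M"
    and w_bound: "\<And>n. (n2 (w n))\<^sup>2 \<le> 4 * (1 + 8 * c\<^sup>2 * (n2 q)\<^sup>2) * l n"
    and w_stat: "\<And>n v e. (v, e) \<in> K \<Longrightarrow> (LINT x|M. w n x \<bullet> w n x) - n2 (w n) * n2 v - l n
        - l n * (n2 (\<lambda>x. v x - w n x))\<^sup>2
        - c * n2 (w n) * (2 * n2 q + n2 (w n)) + (LINT x|M. yosida (l n) (q x + w n x) \<bullet> w n x)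
      \<le> (LINT x|M. yosida (l n) (q x + w n x) \<bullet> v x) + e"
    unfolding almost_stationary_def by blast+
  have "(\<lambda>n. (n2 (w n))\<^sup>2) \<longlonglongrightarrow> 0"
  proof (rule Lim_null_comparison)
    show "\<forall>\<^sub>F n in sequentially. norm ((n2 (w n))\<^sup>2) \<le> 4 * (1 + 8 * c\<^sup>2 * (n2 q)\<^sup>2) * l n"
      using w_bound by simp
    show "(\<lambda>n. 4 * (1 + 8 * c\<^sup>2 * (n2 q)\<^sup>2) * l n) \<longlonglongrightarrow> 0"
      using tendsto_mult[OF tendsto_const l_lim] by simp
  qed
  from tendsto_real_sqrt[OF this] have w_lim: "(\<lambda>n. n2 (w n)) \<longlonglongrightarrow> 0"
    by (simp add: l2_norm_nonneg)
  define \<xi> where "\<xi> n x = yosida (l n) (q x + w n x)" for n x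
  have p: "(\<lambda>x. q x + w n x) \<in> L2 M" for n by (intro L2_add q w)
  have xi: "\<xi> n \<in> L2 M" for n unfolding \<xi>_def by (rule norm_yosida_l2_le[OF l(1) p])
  obtain W where W: "\<And>n. n2 (w n) \<le> W"
    using convergent_imp_Bseq[OF convergentI[OF w_lim]] unfolding Bseq_def by (auto simp: l2_norm_nonneg)
  have xi_bound: "n2 (\<xi> n) \<le> 2 * c * (n2 q + W)" for n
  proof -
    have "n2 (\<xi> n) \<le> 2 * c * n2 (\<lambda>x. q x + w n x)"
      unfolding \<xi>_def by (rule norm_yosida_l2_le[OF l(1) p])
    also have "\<dots> \<le> 2 * c * (n2 q + W)"
      using c_nonneg W[of n] l2_norm_triangle[OF q w, of n] by (intro mult_left_mono) auto
    finally show ?thesis .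
  qed
  from L2_bounded_Mazur[of \<xi>, OF xi xi_bound] obtain y z where y: "y \<in> L2 M"
    and zH: "\<And>n. z n \<in> midpoint_hull (\<xi> ` {n..})"
    and zy: "AE x in M. (\<lambda>n. z n x) \<longlonglongrightarrow> y x" "(\<lambda>n. n2 (\<lambda>x. z n x - y x)) \<longlonglongrightarrow> 0"
    by blast
  have hull_L2: "f \<in> L2 M" if "f \<in> midpoint_hull (\<xi> ` {n..})" for f n
    using that by induction (auto intro!: xi L2_scaleR L2_add)
  have z: "z n \<in> L2 M" for n by (rule hull_L2[OF zH])
  have dual: "0 \<le> (LINT x|M. y x \<bullet> v x) + e" if K: "(v, e) \<in> K" for v e
  proof -
    note v = K_L2[OF K]
    \<comment> \<open>The last term majorizes the integral of \<open>\<xi> n\<close> against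
      \<open>w n\<close>, the others the errors in \<open>almost_stationary\<close>.\<close>
    define err where "err n = n2 (w n) * n2 v + l n + l n * (n2 v + n2 (w n))\<^sup>2
        + c * n2 (w n) * (2 * n2 q + n2 (w n)) + 2 * c * (n2 q + W) * n2 (w n)" for n
    have "err \<longlonglongrightarrow> 0 * n2 v + 0 + 0 * (n2 v + 0)\<^sup>2 + c * 0 * (2 * n2 q + 0) + 2 * c * (n2 q + W) * 0"
      unfolding err_def by (intro tendsto_intros w_lim l_lim)
    then have err: "err \<longlonglongrightarrow> 0" by simp
    have low: "- err n \<le> (LINT x|M. \<xi> n x \<bullet> v x) + e" for n
    proof -
      have "(n2 (\<lambda>x. v x - w n x))\<^sup>2 \<le> (n2 v + n2 (w n))\<^sup>2"
        by (intro power_mono l2_norm_triangle_diff v w l2_norm_nonneg)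
      then have 1: "l n * (n2 (\<lambda>x. v x - w n x))\<^sup>2 \<le> l n * (n2 v + n2 (w n))\<^sup>2"
        using l(1)[of n] by (intro mult_left_mono) auto
      have "\<bar>LINT x|M. \<xi> n x \<bullet> w n x\<bar> \<le> n2 (\<xi> n) * n2 (w n)"
        by (rule l2_norm_Cauchy_Schwarz[OF xi w])
      also have "\<dots> \<le> 2 * c * (n2 q + W) * n2 (w n)"
        by (intro mult_right_mono xi_bound l2_norm_nonneg)
      finally have 2: "\<bar>LINT x|M. \<xi> n x \<bullet> w n x\<bar> \<le> 2 * c * (n2 q + W) * n2 (w n)" .
      have 3: "0 \<le> (LINT x|M. w n x \<bullet> w n x)" by simp
      from w_stat[OF K, of n] 1 2 3 show ?thesis unfolding err_def \<xi>_def by linarith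
    qed
    \<comment> \<open>A bound valid on a whole tail passes to midpoints because the functional is
      affine.\<close>
    have hull: "- \<delta> \<le> (LINT x|M. f x \<bullet> v x) + e"
      if "f \<in> midpoint_hull (\<xi> ` {n..})" "\<And>k. k \<ge> n \<Longrightarrow> err k \<le> \<delta>" for f n \<delta>
      using that(1)
    proof induction
      case (base f)
      then obtain k where k: "k \<ge> n" "f = \<xi> k" by auto
      then show ?case using low[of k] that(2)[OF k(1)] by simp
    next
      case (midpoint f g)
      have "(LINT x|M. (1/2) *\<^sub>R (f x + g x) \<bullet> v x) = ((LINT x|M. f x \<bullet> v x) + (LINT x|M. g x \<bullet> v x)) / 2"
        using L2_inner_integrable[OF hull_L2[OF midpoint(1)] v] L2_inner_integrable[OF hull_L2[OF midpoint(2)] v]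
        by (simp add: inner_add_left)
      with midpoint.IH show ?case by argo
    qed
    have lim: "(\<lambda>n. (LINT x|M. z n x \<bullet> v x) + e) \<longlonglongrightarrow> (LINT x|M. y x \<bullet> v x) + e"
    proof (intro tendsto_add tendsto_const)
      have "(\<lambda>n. (LINT x|M. z n x \<bullet> v x) - (LINT x|M. y x \<bullet> v x)) \<longlonglongrightarrow> 0"
      proof (rule Lim_null_comparison)
        show "\<forall>\<^sub>F n in sequentially. norm ((LINT x|M. z n x \<bullet> v x) - (LINT x|M. y x \<bullet> v x))
            \<le> n2 (\<lambda>x. z n x - y x) * n2 v"
        proof (intro always_eventually allI)
          fix n
          have "(LINT x|M. z n x \<bullet> v x) - (LINT x|M. y x \<bullet> v x) = (LINT x|M. (z n x - y x) \<bullet> v x)"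
            using L2_inner_integrable[OF z v] L2_inner_integrable[OF y v] by (simp add: inner_diff_left)
          then show "norm ((LINT x|M. z n x \<bullet> v x) - (LINT x|M. y x \<bullet> v x)) \<le> n2 (\<lambda>x. z n x - y x) * n2 v"
            using l2_norm_Cauchy_Schwarz[OF L2_diff[OF z y] v] by simp
        qed
        show "(\<lambda>n. n2 (\<lambda>x. z n x - y x) * n2 v) \<longlonglongrightarrow> 0"
          using tendsto_mult[OF zy(2) tendsto_const] by simp
      qed
      then show "(\<lambda>n. LINT x|M. z n x \<bullet> v x) \<longlonglongrightarrow> (LINT x|M. y x \<bullet> v x)"
        by (simp add: LIM_zero_iff)
    qed
    show ?thesis
    proof (rule field_le_epsilon)
      fix \<delta> :: real assume "0 < \<delta>"
      with order_tendstoD(2)[OF err] obtain n where "\<And>k. k \<ge> n \<Longrightarrow> err k < \<delta>"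
        by (auto simp: eventually_sequentially)
      then have "- \<delta> \<le> (LINT x|M. z k x \<bullet> v x) + e" if "k \<ge> n" for k
        using hull[OF zH[of k], of \<delta>] that by (simp add: less_imp_le)
      then have "- \<delta> \<le> (LINT x|M. y x \<bullet> v x) + e"
        by (intro LIMSEQ_le_const[OF lim]) blast
      then show "0 \<le> (LINT x|M. y x \<bullet> v x) + e + \<delta>" by simp
    qed
  qed
  have sub: "AE x in M. y x \<in> convex_subdifferential A (q x)"
  proof -
    define err where "err n = (n2 (w n) + 2 * c * l n * (n2 q + n2 (w n))) *
      (2 * c * (2 * n2 q + n2 (w n)) + c * (2 * n2 q + n2 (w n)))" for n
    have "err \<longlonglongrightarrow> (0 + 2 * c * 0 * (n2 q + 0)) * (2 * c * (2 * n2 q + 0) + c * (2 * n2 q + 0))"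
      unfolding err_def by (intro tendsto_intros w_lim l_lim)
    then have err: "err \<longlonglongrightarrow> 0" by simp
    have xi_sub: "almost_subgradient (err n) (\<xi> n)" for n
      unfolding err_def \<xi>_def by (rule almost_subgradient_yosida[OF l(1) w])
    have hull: "almost_subgradient \<delta> f"
      if "f \<in> midpoint_hull (\<xi> ` {n..})" "\<And>k. k \<ge> n \<Longrightarrow> err k \<le> \<delta>" for f n \<delta>
      using that(1)
    proof induction
      case (base f)
      then obtain k where k: "k \<ge> n" "f = \<xi> k" by auto
      then show ?case using almost_subgradient_mono[OF xi_sub that(2)[OF k(1)]] by simp
    qed (rule almost_subgradient_midpoint)
    \<comment> \<open>\<open>z k\<close> lies in the hull of the tail from k on, so it inherits a
      defect valid beyond N; \<open>max n N\<close> moreover forces the index to infinity.\<close>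
    have "\<exists>m\<ge>n. almost_subgradient (inverse (real (Suc n))) (z m)" for n
    proof -
      from order_tendstoD(2)[OF err, of "inverse (real (Suc n))"] obtain N
        where "\<And>k. k \<ge> N \<Longrightarrow> err k < inverse (real (Suc n))"
        by (auto simp: eventually_sequentially)
      then have "almost_subgradient (inverse (real (Suc n))) (z (max n N))"
        by (intro hull[OF zH]) (simp add: less_imp_le)
      then show ?thesis by (intro exI[of _ "max n N"]) simp
    qed
    then have "\<forall>n. \<exists>m\<ge>n. almost_subgradient (inverse (real (Suc n))) (z m)" by blast
    then obtain m where m: "\<And>n. m n \<ge> n" "\<And>n. almost_subgradient (inverse (real (Suc n))) (z (m n))"
      unfolding choice_iff by blast
    have "\<forall>n. almost_subgradient (inverse (real (Suc n))) (z (m n))" using m(2) by blast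
    then obtain \<rho> where rho: "\<And>n. integrable M (\<rho> n)" "\<And>n x. 0 \<le> \<rho> n x"
        "\<And>n. (LINT x|M. \<rho> n x) \<le> inverse (real (Suc n))"
      and ineq: "\<And>n x r. A (q x) + z (m n) x \<bullet> (r - q x) - \<rho> n x \<le> A r"
      unfolding almost_subgradient_def choice_iff by blast
    have "(\<lambda>n. LINT x|M. norm (\<rho> n x)) \<longlonglongrightarrow> 0"
      by (rule Lim_null_comparison[OF _ LIMSEQ_inverse_real_of_nat])
         (use rho(2,3) in \<open>auto simp: abs_of_nonneg integral_nonneg\<close>)
    \<comment> \<open>Smallness in mean gives pointwise decay of the defects along a subsequence;
      \<open>z\<close> converges pointwise as a whole and follows.\<close>
    from tendsto_L1_AE_subseq[OF rho(1) this] obtain r :: "nat \<Rightarrow> nat" where r: "strict_mono r"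
      and ae: "AE x in M. (\<lambda>n. \<rho> (r n) x) \<longlonglongrightarrow> 0" by blast
    have mr: "filterlim (\<lambda>n. m (r n)) sequentially sequentially"
      by (rule filterlim_at_top_mono[OF filterlim_ident])
         (use order_trans[OF seq_suble[OF r] m(1)] in auto)
    from zy(1) ae show ?thesis
    proof eventually_elim
      case (elim x)
      have "A (q x) + y x \<bullet> (p - q x) - 0 \<le> A p" for p
      proof (rule LIMSEQ_le_const2)
        have "(\<lambda>n. z (m (r n)) x) \<longlonglongrightarrow> y x" by (rule filterlim_compose[OF elim(1) mr])
        then show "(\<lambda>n. A (q x) + z (m (r n)) x \<bullet> (p - q x) - \<rho> (r n) x)
            \<longlonglongrightarrow> A (q x) + y x \<bullet> (p - q x) - 0"
          by (intro tendsto_intros elim(2))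
        show "\<exists>N. \<forall>n\<ge>N. A (q x) + z (m (r n)) x \<bullet> (p - q x) - \<rho> (r n) x \<le> A p"
          using ineq by blast
      qed
      then show ?case by (auto simp: convex_subdifferential_def algebra_simps)
    qed
  qed
  show ?thesis using y sub dual by blast
qed

end

section \<open>Test functions and weak gradients\<close>

text \<open>The class of functions \<open>p (1 / x) exp (- 1 / x)\<close> is closed under differentiation.\<close>

definition flat_fun :: "real poly \<Rightarrow> real \<Rightarrow> real" where
  "flat_fun p x = (if 0 < x then poly p (1 / x) * exp (- (1 / x)) else 0)"

lemma poly_mult_exp_tendsto_0: "((\<lambda>y. poly p y * exp (- y)) \<longlongrightarrow> 0) at_top" for p :: "real poly"
proof -
  have "((\<lambda>y. \<Sum>i\<le>degree p. coeff p i * (y ^ i / exp y)) \<longlongrightarrow> (\<Sum>i\<le>degree p. coeff p i * 0)) at_top"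
    by (intro tendsto_intros tendsto_power_div_exp_0)
  moreover have "(\<lambda>y. \<Sum>i\<le>degree p. coeff p i * (y ^ i / exp y)) = (\<lambda>y. poly p y * exp (- y))"
    by (simp add: poly_altdef exp_minus sum_distrib_right divide_inverse mult.assoc)
  ultimately show ?thesis by simp
qed

text \<open>With y = 1 / x one has d/dx = - y^2 d/dy, so p(y) exp(-y) turns into y^2 (p - p')(y)
  exp(-y); the two \<open>pCons 0\<close> are the factor y^2. At 0 the right difference quotient is
  y p(y) exp(-y), which tends to 0.\<close>

lemma has_derivative_flat_fun:
  "(flat_fun p has_real_derivative flat_fun (pCons 0 (pCons 0 (p - pderiv p))) x) (at x)"
proof -
  consider "0 < x" | "x < 0" | "x = 0" by linarith
  then show ?thesis
  proof cases
    case 1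
    have "((\<lambda>x. poly p (1 / x) * exp (- (1 / x))) has_real_derivative
        flat_fun (pCons 0 (pCons 0 (p - pderiv p))) x) (at x)"
      using 1 by (auto intro!: derivative_eq_intros simp: flat_fun_def field_simps)
    then show ?thesis
      by (rule has_field_derivative_transform_within_open[OF _ open_greaterThan[of 0]])
         (use 1 in \<open>auto simp: flat_fun_def\<close>)
  next
    case 2
    have "((\<lambda>x. 0) has_real_derivative flat_fun (pCons 0 (pCons 0 (p - pderiv p))) x) (at x)"
      using 2 by (auto simp: flat_fun_def)
    then show ?thesis
      by (rule has_field_derivative_transform_within_open[OF _ open_lessThan[of 0]])
         (use 2 in \<open>auto simp: flat_fun_def\<close>)
  next
    case 3
    have "((\<lambda>h. (flat_fun p h - flat_fun p 0) / h) \<longlongrightarrow> 0) (at_left 0)"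
      by (rule tendsto_eventually) (auto simp: flat_fun_def eventually_at_left_field intro!: exI[of _ "-1"])
    moreover have "((\<lambda>h. (flat_fun p h - flat_fun p 0) / h) \<longlongrightarrow> 0) (at_right 0)"
    proof (rule Lim_transform_eventually)
      show "((\<lambda>h. poly (pCons 0 p) (inverse h) * exp (- inverse h)) \<longlongrightarrow> 0) (at_right 0)"
        by (rule filterlim_compose[OF poly_mult_exp_tendsto_0 filterlim_inverse_at_top_right])
      show "\<forall>\<^sub>F h in at_right 0. poly (pCons 0 p) (inverse h) * exp (- inverse h) =
          (flat_fun p h - flat_fun p 0) / h"
        by (auto simp: flat_fun_def eventually_at_right_field field_simps intro!: exI[of _ 1])
    qed
    ultimately have "((\<lambda>h. (flat_fun p h - flat_fun p 0) / h) \<longlongrightarrow> 0) (at 0)"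
      by (simp add: filterlim_at_split)
    then show ?thesis using 3 by (simp add: has_field_derivative_iff flat_fun_def)
  qed
qed

text \<open>An algebra of differentiable functions closed under partial derivatives, so that the
  infinitely many conditions of \<open>smooth_fun\<close> reduce to one induction.\<close>

inductive_set flat_algebra :: "(real ^ 'd \<Rightarrow> real) set" where
  const: "(\<lambda>x. c) \<in> flat_algebra"
| flat: "(\<lambda>x. flat_fun p (k * x $ i + c)) \<in> flat_algebra"
| add: "f \<in> flat_algebra \<Longrightarrow> g \<in> flat_algebra \<Longrightarrow> (\<lambda>x. f x + g x) \<in> flat_algebra"
| mult: "f \<in> flat_algebra \<Longrightarrow> g \<in> flat_algebra \<Longrightarrow> (\<lambda>x. f x * g x) \<in> flat_algebra"

lemma pderiv_atI:
  assumes "\<And>x. (f has_derivative F x) (at x)"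
  shows "pderiv_at j f = (\<lambda>x. F x (axis j 1))"
  using frechet_derivative_at[OF assms] by (auto simp: pderiv_at_def)

lemma flat_algebra_derivative:
  fixes f :: "real ^ 'd::finite \<Rightarrow> real"
  assumes "f \<in> flat_algebra"
  shows "(\<forall>x. f differentiable (at x)) \<and> (\<forall>j. pderiv_at j f \<in> flat_algebra)"
  using assms
proof induction
  case (const c)
  then show ?case by (auto simp: pderiv_atI[of _ "\<lambda>x h. 0"] intro: flat_algebra.const)
next
  case (flat p k i c)
  let ?q = "pCons 0 (pCons 0 (p - pderiv p))"
  have D: "((\<lambda>x::real^'d. flat_fun p (k * x $ i + c)) has_derivative
      (\<lambda>h. flat_fun ?q (k * x $ i + c) * (k * h $ i))) (at x)" for x
  proof -
    have "((\<lambda>x::real^'d. k * x $ i + c) has_derivative (\<lambda>h. k * h $ i)) (at x)"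
      by (auto intro!: derivative_eq_intros bounded_linear_imp_has_derivative[OF bounded_linear_vec_nth])
    from has_derivative_compose[OF this has_derivative_flat_fun[unfolded has_field_derivative_def]]
    show ?thesis .
  qed
  have "pderiv_at j (\<lambda>x::real^'d. flat_fun p (k * x $ i + c)) =
      (\<lambda>x. flat_fun ?q (k * x $ i + c) * (k * axis j 1 $ i))" for j
    by (rule pderiv_atI[OF D])
  moreover have "(\<lambda>x::real^'d. flat_fun ?q (k * x $ i + c) * (k * axis j 1 $ i)) \<in> flat_algebra" for j
    by (intro flat_algebra.intros)
  ultimately show ?case using D by (auto simp: differentiable_def)
next
  case (add f g)
  have D: "((\<lambda>x. f x + g x) has_derivative
      (\<lambda>h. frechet_derivative f (at x) h + frechet_derivative g (at x) h)) (at x)" for x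
    using add.IH by (intro has_derivative_add) (auto simp: frechet_derivative_works)
  have "pderiv_at j (\<lambda>x. f x + g x) = (\<lambda>x. pderiv_at j f x + pderiv_at j g x)" for j
    unfolding pderiv_atI[OF D] by (simp add: pderiv_at_def)
  moreover have "(\<lambda>x. pderiv_at j f x + pderiv_at j g x) \<in> flat_algebra" for j
    using add.IH by (intro flat_algebra.add) auto
  ultimately show ?case using D by (auto simp: differentiable_def)
next
  case (mult f g)
  have D: "((\<lambda>x. f x * g x) has_derivative
      (\<lambda>h. f x * frechet_derivative g (at x) h + frechet_derivative f (at x) h * g x)) (at x)" for x
    using mult.IH by (intro has_derivative_mult) (auto simp: frechet_derivative_works)
  have "pderiv_at j (\<lambda>x. f x * g x) = (\<lambda>x. f x * pderiv_at j g x + pderiv_at j f x * g x)" for j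
    unfolding pderiv_atI[OF D] by (simp add: pderiv_at_def)
  moreover have "(\<lambda>x. f x * pderiv_at j g x + pderiv_at j f x * g x) \<in> flat_algebra" for j
    using mult by (intro flat_algebra.add flat_algebra.mult) auto
  ultimately show ?case using D by (auto simp: differentiable_def)
qed

lemma flat_algebra_smooth:
  assumes "f \<in> flat_algebra"
  shows "smooth_fun f"
proof -
  have "iter_pderiv is f \<in> flat_algebra" for "is"
    by (induction "is") (use assms flat_algebra_derivative in auto)
  then show ?thesis unfolding smooth_fun_def using flat_algebra_derivative by blast
qed

lemma flat_algebra_prod:
  assumes "finite I" "\<And>i. i \<in> I \<Longrightarrow> f i \<in> flat_algebra"
  shows "(\<lambda>x. \<Prod>i\<in>I. f i x) \<in> flat_algebra"
  using assms by (induction) (auto intro: flat_algebra.const flat_algebra.mult)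

text \<open>Approximates the indicator of the open box as k grows: at distance t > 0 inside a face
  the factor is exp(-1/(k t)). The products with k are expanded to match the generators of
  \<open>flat_algebra\<close>.\<close>

definition box_bump :: "real ^ 'd \<Rightarrow> real ^ 'd \<Rightarrow> nat \<Rightarrow> real ^ 'd \<Rightarrow> real" where
  "box_bump a b k x = (\<Prod>i\<in>UNIV. flat_fun 1 (real k * x $ i - real k * a $ i) *
     flat_fun 1 (real k * b $ i - real k * x $ i))"

lemma flat_fun_one_bounds: "0 \<le> flat_fun 1 x" "flat_fun 1 x \<le> 1"
  by (auto simp: flat_fun_def)

lemma flat_fun_one_tendsto: "(\<lambda>k. flat_fun 1 (real k * t)) \<longlonglongrightarrow> (if 0 < t then 1 else 0)"
proof (cases "0 < t")
  case True
  have "(\<lambda>k. exp (- ((1 / t) * inverse (real k)))) \<longlonglongrightarrow> exp (- ((1 / t) * 0))"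
    by (intro tendsto_intros lim_inverse_n)
  then have "(\<lambda>k. exp (- ((1 / t) * inverse (real k)))) \<longlonglongrightarrow> 1" by simp
  then have "(\<lambda>k. flat_fun 1 (real k * t)) \<longlonglongrightarrow> 1"
  proof (rule Lim_transform_eventually)
    show "\<forall>\<^sub>F k in sequentially. exp (- ((1 / t) * inverse (real k))) = flat_fun 1 (real k * t)"
      using True by (intro eventually_sequentiallyI[of 1]) (auto simp: flat_fun_def field_simps)
  qed
  then show ?thesis using True by simp
next
  case False
  then have "flat_fun 1 (real k * t) = 0" for k
    by (auto simp: flat_fun_def zero_less_mult_iff)
  then show ?thesis using False by simp
qed

lemma box_bump_bounds: "0 \<le> box_bump a b k x" "box_bump a b k x \<le> 1"
  unfolding box_bump_def
  by (auto intro!: prod_nonneg prod_le_1 mult_nonneg_nonneg mult_le_one flat_fun_one_bounds)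

lemma box_bump_tendsto:
  "(\<lambda>k. box_bump a b k x) \<longlonglongrightarrow> indicat_real (box a b) x" for x :: "real ^ 'd::finite"
proof -
  have "(\<lambda>k. box_bump a b k x) \<longlonglongrightarrow>
      (\<Prod>i\<in>UNIV. (if 0 < x $ i - a $ i then 1 else 0) * (if 0 < b $ i - x $ i then 1 else 0))"
    unfolding box_bump_def right_diff_distrib[symmetric]
    by (intro tendsto_prod tendsto_mult flat_fun_one_tendsto)
  also have "(\<Prod>i\<in>UNIV. (if 0 < x $ i - a $ i then 1 else 0) * (if 0 < b $ i - x $ i then 1 else 0 :: real)) =
      indicat_real (box a b) x"
    by (cases "\<forall>i. a $ i < x $ i \<and> x $ i < b $ i") (auto simp: indicator_def mem_box_cart prod_zero_iff)
  finally show ?thesis .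
qed

lemma test_fun_box_bump:
  fixes a b :: "real ^ 'd::finite"
  assumes "cbox a b \<subseteq> \<Omega>"
  shows "test_fun \<Omega> (box_bump a b k)"
proof -
  have "(\<lambda>x. flat_fun 1 (real k * x $ i - real k * a $ i) * flat_fun 1 (real k * b $ i - real k * x $ i))
      \<in> flat_algebra" for i
    using flat_algebra.mult[OF flat_algebra.flat[of 1 "real k" i "- (real k * a $ i)"]
        flat_algebra.flat[of 1 "- real k" i "real k * b $ i"]] by simp
  then have "smooth_fun (box_bump a b k)"
    unfolding box_bump_def[abs_def] by (intro flat_algebra_smooth flat_algebra_prod) auto
  moreover have "{x. box_bump a b k x \<noteq> 0} \<subseteq> cbox a b"
  proof
    fix x assume "x \<in> {x. box_bump a b k x \<noteq> 0}"
    then have "flat_fun 1 (real k * x $ i - real k * a $ i) \<noteq> 0"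
      "flat_fun 1 (real k * b $ i - real k * x $ i) \<noteq> 0" for i
      by (auto simp: box_bump_def)
    then have "0 < real k * (x $ i - a $ i)" "0 < real k * (b $ i - x $ i)" for i
      by (metis flat_fun_def right_diff_distrib)+
    then show "x \<in> cbox a b" by (auto simp: mem_box_cart zero_less_mult_iff less_imp_le)
  qed
  then have "closure {x. box_bump a b k x \<noteq> 0} \<subseteq> cbox a b" "bounded {x. box_bump a b k x \<noteq> 0}"
    by (rule closure_minimal[OF _ closed_cbox], rule bounded_subset[OF bounded_cbox])
  ultimately show ?thesis using assms by (auto simp: test_fun_def compact_closure)
qed

lemma smooth_fun_continuous:
  assumes "smooth_fun f"
  shows "continuous_on S f" "continuous_on S (pderiv_at i f)"
proof -
  have "iter_pderiv [] f differentiable (at x)" "iter_pderiv [i] f differentiable (at x)" for x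
    using assms unfolding smooth_fun_def by blast+
  then have D: "f differentiable (at x)" "pderiv_at i f differentiable (at x)" for x by simp_all
  show "continuous_on S f"
    by (rule differentiable_imp_continuous_on, rule differentiable_at_imp_differentiable_on, rule D(1))
  show "continuous_on S (pderiv_at i f)"
    by (rule differentiable_imp_continuous_on, rule differentiable_at_imp_differentiable_on, rule D(2))
qed

section \<open>Weak gradients on a bounded open set\<close>

locale bounded_open =
  fixes \<Omega> :: "(real ^ 'd::finite) set"
  assumes \<Omega>_open: "open \<Omega>" and \<Omega>_bounded: "bounded \<Omega>"
begin

abbreviation M where "M \<equiv> lebesgue_on \<Omega>"

lemma \<Omega>_lmeasurable: "\<Omega> \<in> lmeasurable"
  by (rule lmeasurable_open[OF \<Omega>_bounded \<Omega>_open])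

lemma \<Omega>_sets [measurable]: "\<Omega> \<in> sets lebesgue"
  using \<Omega>_lmeasurable by (rule fmeasurableD)

sublocale finite_measure M
  by (rule finite_measureI) (use \<Omega>_lmeasurable in \<open>auto simp: emeasure_restrict_space fmeasurable_def\<close>)

lemma continuous_L2:
  fixes f :: "real ^ 'd \<Rightarrow> 'b::euclidean_space"
  assumes "continuous_on UNIV f"
  shows "f \<in> L2 M"
proof -
  have m: "f \<in> borel_measurable M"
    by (intro continuous_imp_measurable_on_sets_lebesgue continuous_on_subset[OF assms]) auto
  have "compact (f ` closure \<Omega>)"
    using \<Omega>_bounded by (intro compact_continuous_image continuous_on_subset[OF assms]) (auto simp: compact_closure)
  then obtain B where B: "\<And>y. y \<in> f ` closure \<Omega> \<Longrightarrow> norm y \<le> B"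
    using compact_imp_bounded bounded_iff by metis
  have "(\<lambda>x. 1::real) \<in> L2 M" by (simp add: L2_def)
  then show ?thesis
    by (rule L2_dominated[OF m, rotated, where c = B])
       (use B closure_subset[of \<Omega>] in \<open>auto simp: space_restrict_space intro!: AE_I2\<close>)
qed

lemma test_fun_L2:
  assumes "test_fun \<Omega> \<psi>"
  shows "\<psi> \<in> L2 M" "pderiv_at i \<psi> \<in> L2 M"
  using assms smooth_fun_continuous by (auto simp: test_fun_def intro!: continuous_L2)

lemma L2_mult_integrable_real:
  fixes f g :: "real ^ 'd \<Rightarrow> real"
  shows "f \<in> L2 M \<Longrightarrow> g \<in> L2 M \<Longrightarrow> integrable M (\<lambda>x. f x * g x)"
  using L2_inner_integrable[of f M g] by simp

lemma L2_component:
  fixes G :: "real ^ 'd \<Rightarrow> real ^ 'n::finite"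
  assumes "G \<in> L2 M"
  shows "(\<lambda>x. G x $ i) \<in> L2 M"
proof (rule L2_dominated[OF _ _ assms, where c = 1])
  show "(\<lambda>x. G x $ i) \<in> borel_measurable M"
    using borel_measurable_inner[OF L2_measurable[OF assms] borel_measurable_const[of "axis i 1"]]
    by (simp add: inner_axis)
qed (simp add: component_le_norm_cart)

lemma is_weak_grad_linear:
  assumes u: "u \<in> L2 M" and v: "v \<in> L2 M" and G: "is_weak_grad \<Omega> u G" and H: "is_weak_grad \<Omega> v H"
  shows "is_weak_grad \<Omega> (\<lambda>x. a * u x + b * v x) (\<lambda>x. a *\<^sub>R G x + b *\<^sub>R H x)"
  unfolding is_weak_grad_def
proof (intro conjI allI impI)
  have GL: "G \<in> L2 M" and HL: "H \<in> L2 M" using G H by (auto simp: is_weak_grad_def)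
  then show "(\<lambda>x. a *\<^sub>R G x + b *\<^sub>R H x) \<in> L2 M" by (intro L2_add L2_scaleR)
  fix \<psi> i assume \<psi>: "test_fun \<Omega> \<psi>"
  note L = test_fun_L2[OF \<psi>]
  have "(LINT x|M. (a * u x + b * v x) * pderiv_at i \<psi> x)
      = a * (LINT x|M. u x * pderiv_at i \<psi> x) + b * (LINT x|M. v x * pderiv_at i \<psi> x)"
    using L2_mult_integrable_real[OF u L(2)[of i]] L2_mult_integrable_real[OF v L(2)[of i]]
    by (simp add: distrib_right mult.assoc)
  also have "\<dots> = - (a * (LINT x|M. G x $ i * \<psi> x) + b * (LINT x|M. H x $ i * \<psi> x))"
    using G H \<psi> by (simp add: is_weak_grad_def)
  also have "\<dots> = - (LINT x|M. (a *\<^sub>R G x + b *\<^sub>R H x) $ i * \<psi> x)"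
    using L2_mult_integrable_real[OF L2_component[OF GL] L(1)] L2_mult_integrable_real[OF L2_component[OF HL] L(1)]
    by (simp add: distrib_right mult.assoc)
  finally show "(LINT x|M. (a * u x + b * v x) * pderiv_at i \<psi> x)
      = - (LINT x|M. (a *\<^sub>R G x + b *\<^sub>R H x) $ i * \<psi> x)" .
qed

lemma box_integral_zero:
  assumes g: "g \<in> L2 M" and orth: "\<And>\<psi>. test_fun \<Omega> \<psi> \<Longrightarrow> (LINT x|M. g x * \<psi> x) = 0"
    and box: "cbox a b \<subseteq> \<Omega>"
  shows "(LINT x|M. g x * indicat_real (box a b) x) = 0"
proof -
  have "(\<lambda>k. LINT x|M. g x * box_bump a b k x) \<longlonglongrightarrow> (LINT x|M. g x * indicat_real (box a b) x)"
  proof (rule integral_dominated_convergence)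
    have "box a b \<inter> \<Omega> \<in> sets M"
      by (subst sets_restrict_space_iff) (use \<Omega>_sets sets.Int[OF _ \<Omega>_sets, of "box a b"] in simp_all)
    then show "(\<lambda>x. g x * indicat_real (box a b) x) \<in> borel_measurable M"
      using L2_measurable[OF g] by (intro borel_measurable_times) (auto simp: borel_measurable_indicator_iff Int_commute space_restrict_space)
    show "(\<lambda>x. g x * box_bump a b k x) \<in> borel_measurable M" for k
      using L2_measurable[OF g] L2_measurable[OF test_fun_L2(1)[OF test_fun_box_bump[OF box]]]
      by (intro borel_measurable_times)
    show "integrable M (\<lambda>x. \<bar>g x\<bar>)" by (intro integrable_abs L2_integrable g)
    show "AE x in M. (\<lambda>k. g x * box_bump a b k x) \<longlonglongrightarrow> g x * indicat_real (box a b) x"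
      by (intro AE_I2 tendsto_intros box_bump_tendsto)
    show "AE x in M. norm (g x * box_bump a b k x) \<le> \<bar>g x\<bar>" for k
      using box_bump_bounds[of a b k] by (intro AE_I2) (simp add: abs_mult mult_left_le)
  qed
  then show ?thesis
    using orth[OF test_fun_box_bump[OF box]] by (simp add: LIMSEQ_const_iff)
qed

text \<open>Fundamental lemma of the calculus of variations. Integrals over boxes in \<Omega>
  vanish, hence by Lebesgue differentiation of the extension by zero so does the function outside a
  null set.\<close>

lemma test_orthogonal_AE_zero:
  assumes g: "g \<in> L2 M" and orth: "\<And>\<psi>. test_fun \<Omega> \<psi> \<Longrightarrow> (LINT x|M. g x * \<psi> x) = 0"
  shows "AE x in M. g x = 0"
proof -
  define f where "f x = indicat_real \<Omega> x *\<^sub>R g x" for x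
  have f_int: "integrable lebesgue f"
    using L2_integrable[OF g] by (simp add: f_def[abs_def] integrable_restrict_space)
  have f_set: "set_integrable lebesgue S f" if "S \<in> sets lebesgue" for S
    using integrable_mult_indicator[OF that f_int] by (simp add: set_integrable_def)
  have zero: "integral (cbox a b) f = 0" if "cbox a b \<subseteq> \<Omega>" for a b
  proof -
    have "integral (box a b) f = (LINT x:box a b|lebesgue. f x)"
      by (rule set_lebesgue_integral_eq_integral(2)[symmetric, OF f_set]) simp
    also have "\<dots> = (LINT x|lebesgue. indicat_real \<Omega> x *\<^sub>R (g x * indicat_real (box a b) x))"
      by (simp add: set_lebesgue_integral_def f_def mult_ac)
    also have "\<dots> = (LINT x|M. g x * indicat_real (box a b) x)"
      by (rule integral_restrict_space[symmetric]) simp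
    also have "\<dots> = 0" by (rule box_integral_zero[OF g orth that])
    finally show ?thesis by (simp add: integral_open_interval)
  qed
  have f_int_cbox: "f integrable_on cbox a b" for a b
    by (rule set_lebesgue_integral_eq_integral(1)[OF f_set]) simp
  obtain N where N: "negligible N"
    and conv: "\<And>x e. \<lbrakk>x \<notin> N; 0 < e\<rbrakk> \<Longrightarrow> \<exists>d>0. \<forall>h. 0 < h \<and> h < d \<longrightarrow>
      norm (integral (cbox x (x + h *\<^sub>R One)) f /\<^sub>R h ^ DIM(real ^ 'd) - f x) < e"
    by (rule integrable_ccontinuous_explicit[OF f_int_cbox]) (erule that, blast)
  have "g x = 0" if x: "x \<in> \<Omega>" "x \<notin> N" for x
  proof (rule ccontr)
    assume "g x \<noteq> 0"
    then have fx: "f x = g x" "0 < norm (f x)" using x by (auto simp: f_def)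
    \<comment> \<open>The tolerance is the norm of \<open>f x\<close> itself, so a vanishing cube
      integral is contradictory.\<close>
    obtain d where d: "d > 0" "\<And>h. 0 < h \<Longrightarrow> h < d \<Longrightarrow>
        norm (integral (cbox x (x + h *\<^sub>R One)) f /\<^sub>R h ^ DIM(real ^ 'd) - f x) < norm (f x)"
      using conv[OF x(2) fx(2)] by blast
    obtain e where e: "e > 0" "ball x e \<subseteq> \<Omega>" using \<Omega>_open x(1) openE by blast
    \<comment> \<open>The side length keeps the cube with corner x inside the ball of radius
      e.\<close>
    define h where "h = min (d / 2) (e / (2 * (1 + norm (One :: real ^ 'd))))"
    have h: "0 < h" "h < d" using d(1) e(1) by (auto simp: h_def add_pos_nonneg)
    have he: "h * norm (One :: real ^ 'd) < e"
    proof -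
      let ?n = "norm (One :: real ^ 'd)"
      have "0 < 2 * (1 + ?n)" by (simp add: add_pos_nonneg)
      moreover have "h \<le> e / (2 * (1 + ?n))" by (simp add: h_def)
      ultimately have "h * (2 * (1 + ?n)) \<le> e" by (simp only: pos_le_divide_eq)
      moreover have "h * (2 * (1 + ?n)) = 2 * h + h * ?n + h * ?n" by (simp add: algebra_simps)
      moreover have "0 \<le> h * ?n" using h by simp
      ultimately show ?thesis using h by linarith
    qed
    have "cbox x (x + h *\<^sub>R One) \<subseteq> ball x e"
    proof
      fix y assume y: "y \<in> cbox x (x + h *\<^sub>R One)"
      have "norm (y - x) \<le> norm (h *\<^sub>R One :: real ^ 'd)"
        by (rule norm_le_componentwise)
           (use y h in \<open>auto simp: mem_box inner_diff_left inner_add_left algebra_simps\<close>)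
      then show "y \<in> ball x e" using he h by (simp add: dist_norm norm_minus_commute)
    qed
    with e have "integral (cbox x (x + h *\<^sub>R One)) f = 0" by (intro zero) auto
    with d(2)[OF h] show False by simp
  qed
  moreover have "N \<in> null_sets lebesgue" using N by (simp add: negligible_iff_null_sets)
  ultimately have "AE x in lebesgue. x \<in> \<Omega> \<longrightarrow> g x = 0"
    by (intro AE_I'[of N]) auto
  then show ?thesis by (simp add: AE_restrict_space_iff)
qed

text \<open>\<open>weak_grad\<close> is a choice, so identities between weak gradients, such as the
  one in \<open>H1_linear\<close>, rest on this.\<close>

lemma is_weak_grad_unique:
  assumes "is_weak_grad \<Omega> u G" "is_weak_grad \<Omega> u H"
  shows "AE x in M. G x = H x"
proof -
  have GL: "G \<in> L2 M" and HL: "H \<in> L2 M" using assms by (auto simp: is_weak_grad_def)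
  have "AE x in M. G x $ i - H x $ i = 0" for i
  proof (rule test_orthogonal_AE_zero)
    show "(\<lambda>x. G x $ i - H x $ i) \<in> L2 M" by (intro L2_diff L2_component GL HL)
    fix \<psi> assume \<psi>: "test_fun \<Omega> \<psi>"
    have "(LINT x|M. u x * pderiv_at i \<psi> x) = - (LINT x|M. G x $ i * \<psi> x)"
      "(LINT x|M. u x * pderiv_at i \<psi> x) = - (LINT x|M. H x $ i * \<psi> x)"
      using assms \<psi> unfolding is_weak_grad_def by blast+
    then show "(LINT x|M. (G x $ i - H x $ i) * \<psi> x) = 0"
      using L2_mult_integrable_real[OF L2_component[OF GL] test_fun_L2(1)[OF \<psi>]]
        L2_mult_integrable_real[OF L2_component[OF HL] test_fun_L2(1)[OF \<psi>]]
      by (simp add: left_diff_distrib)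
  qed
  then have "AE x in M. \<forall>i\<in>UNIV. G x $ i - H x $ i = 0"
    by (intro AE_finite_allI) auto
  then show ?thesis by eventually_elim (simp add: vec_eq_iff)
qed

lemma is_weak_grad_weak_grad: "u \<in> H1 \<Omega> \<Longrightarrow> is_weak_grad \<Omega> u (weak_grad \<Omega> u)"
  unfolding H1_def weak_grad_def using someI_ex[of "is_weak_grad \<Omega> u"] by blast

lemma weak_grad_L2: "u \<in> H1 \<Omega> \<Longrightarrow> weak_grad \<Omega> u \<in> L2 M"
  using is_weak_grad_weak_grad by (auto simp: is_weak_grad_def)

lemma H1_L2: "u \<in> H1 \<Omega> \<Longrightarrow> u \<in> L2 M"
  by (simp add: H1_def)

lemma H1_linear:
  assumes "u \<in> H1 \<Omega>" "v \<in> H1 \<Omega>"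
  shows "(\<lambda>x. a * u x + b * v x) \<in> H1 \<Omega>"
    and "AE x in M. weak_grad \<Omega> (\<lambda>x. a * u x + b * v x) x = a *\<^sub>R weak_grad \<Omega> u x + b *\<^sub>R weak_grad \<Omega> v x"
proof -
  note lin = is_weak_grad_linear[OF H1_L2 H1_L2 is_weak_grad_weak_grad is_weak_grad_weak_grad, OF assms assms]
  have "(\<lambda>x. a * u x + b * v x) \<in> L2 M"
    using L2_add[OF L2_scaleR[OF H1_L2[OF assms(1)], of a] L2_scaleR[OF H1_L2[OF assms(2)], of b]] by simp
  then show H: "(\<lambda>x. a * u x + b * v x) \<in> H1 \<Omega>" using lin unfolding H1_def by blast
  show "AE x in M. weak_grad \<Omega> (\<lambda>x. a * u x + b * v x) x = a *\<^sub>R weak_grad \<Omega> u x + b *\<^sub>R weak_grad \<Omega> v x"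
    by (rule is_weak_grad_unique[OF is_weak_grad_weak_grad[OF H] lin])
qed

end

section \<open>Elasticity forms\<close>

lemma norm_vec_square: "(norm x)\<^sup>2 = (\<Sum>i\<in>UNIV. (norm (x $ i))\<^sup>2)"
  by (simp add: norm_vec_def L2_set_def sum_nonneg)

lemma tensor_apply_nth: "tensor_apply C M $ i $ j = C $ i $ j \<bullet> M"
  by (simp add: tensor_apply_def inner_vec_def)

text \<open>Entry (i, j) is the inner product of \<open>C $ i $ j\<close> with M, to which
  Cauchy-Schwarz applies.\<close>

lemma norm_tensor_apply_le: "norm (tensor_apply C M) \<le> norm C * norm M"
proof (rule power2_le_imp_le)
  have "(norm (tensor_apply C M))\<^sup>2 = (\<Sum>i\<in>UNIV. \<Sum>j\<in>UNIV. (C $ i $ j \<bullet> M)\<^sup>2)"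
    by (simp add: norm_vec_square tensor_apply_nth)
  also have "\<dots> \<le> (\<Sum>i\<in>UNIV. \<Sum>j\<in>UNIV. (norm (C $ i $ j))\<^sup>2 * (norm M)\<^sup>2)"
  proof (intro sum_mono)
    fix i j
    have "\<bar>C $ i $ j \<bullet> M\<bar>\<^sup>2 \<le> (norm (C $ i $ j) * norm M)\<^sup>2"
      by (intro power_mono Cauchy_Schwarz_ineq2) simp
    then show "(C $ i $ j \<bullet> M)\<^sup>2 \<le> (norm (C $ i $ j))\<^sup>2 * (norm M)\<^sup>2"
      by (simp add: power_mult_distrib)
  qed
  also have "\<dots> = (norm C * norm M)\<^sup>2"
    by (simp add: norm_vec_square[of C] norm_vec_square[of "C $ _"] power_mult_distrib sum_distrib_right)
  finally show "(norm (tensor_apply C M))\<^sup>2 \<le> (norm C * norm M)\<^sup>2" .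
qed simp

interpretation tensor: bounded_bilinear tensor_apply
proof
  show "\<exists>K. \<forall>(a::'a tensor4) b. norm (tensor_apply a b) \<le> norm a * norm b * K"
    by (intro exI[of _ 1]) (simp add: norm_tensor_apply_le)
qed (simp_all add: vec_eq_iff tensor_apply_nth inner_add_left inner_add_right)

lemma sum_rotate:
  "(\<Sum>j\<in>A. \<Sum>k\<in>B. \<Sum>l\<in>D. F j k l) = (\<Sum>k\<in>B. \<Sum>l\<in>D. \<Sum>j\<in>A. F j k l)"
proof -
  have "(\<Sum>j\<in>A. \<Sum>k\<in>B. \<Sum>l\<in>D. F j k l) = (\<Sum>k\<in>B. \<Sum>j\<in>A. \<Sum>l\<in>D. F j k l)"
    by (rule sum.swap)
  also have "\<dots> = (\<Sum>k\<in>B. \<Sum>l\<in>D. \<Sum>j\<in>A. F j k l)"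
    by (rule sum.cong[OF refl], rule sum.swap)
  finally show ?thesis .
qed

lemma tensor_apply_symmetric:
  assumes "\<And>i j k l. C $ i $ j $ k $ l = C $ k $ l $ i $ j"
  shows "tensor_apply C M \<bullet> B = tensor_apply C B \<bullet> M"
proof -
  let ?F = "\<lambda>i j k l. C $ i $ j $ k $ l * M $ k $ l * B $ i $ j"
  have swap: "(\<Sum>i\<in>UNIV. \<Sum>j\<in>UNIV. \<Sum>k\<in>UNIV. \<Sum>l\<in>UNIV. ?F i j k l) =
      (\<Sum>k\<in>UNIV. \<Sum>l\<in>UNIV. \<Sum>i\<in>UNIV. \<Sum>j\<in>UNIV. ?F i j k l)"
  proof -
    have "(\<Sum>i\<in>UNIV. \<Sum>j\<in>UNIV. \<Sum>k\<in>UNIV. \<Sum>l\<in>UNIV. ?F i j k l) =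
        (\<Sum>i\<in>UNIV. \<Sum>k\<in>UNIV. \<Sum>l\<in>UNIV. \<Sum>j\<in>UNIV. ?F i j k l)"
      by (rule sum.cong[OF refl], rule sum_rotate)
    also have "\<dots> = (\<Sum>k\<in>UNIV. \<Sum>l\<in>UNIV. \<Sum>i\<in>UNIV. \<Sum>j\<in>UNIV. ?F i j k l)"
      by (rule sum_rotate)
    finally show ?thesis .
  qed
  have "tensor_apply C M \<bullet> B = (\<Sum>i\<in>UNIV. \<Sum>j\<in>UNIV. \<Sum>k\<in>UNIV. \<Sum>l\<in>UNIV. ?F i j k l)"
    by (simp add: inner_vec_def[of _ B] inner_vec_def[of _ "B $ _"] tensor_apply_def sum_distrib_right)
  also note swap
  also have "(\<Sum>k\<in>UNIV. \<Sum>l\<in>UNIV. \<Sum>i\<in>UNIV. \<Sum>j\<in>UNIV. ?F i j k l) = tensor_apply C B \<bullet> M"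
    by (simp add: inner_vec_def[of _ M] inner_vec_def[of _ "M $ _"] tensor_apply_def sum_distrib_right)
       (intro sum.cong refl, simp add: assms mult_ac)
  finally show ?thesis .
qed

lemma elasticity_tensor_symmetric:
  "elasticity_tensor C \<Longrightarrow> tensor_apply C M \<bullet> B = tensor_apply C B \<bullet> M"
  unfolding elasticity_tensor_def by (rule tensor_apply_symmetric) blast

definition form :: "'x measure \<Rightarrow> ('x \<Rightarrow> 'd::finite tensor4) \<Rightarrow> ('x \<Rightarrow> real ^ 'd ^ 'd) \<Rightarrow> ('x \<Rightarrow> real ^ 'd ^ 'd) \<Rightarrow> real" where
  "form M a e e' = (LINT x|M. tensor_apply (a x) (e x) \<bullet> e' x)"

definition bounded_coeff :: "'x measure \<Rightarrow> real \<Rightarrow> ('x \<Rightarrow> 'd::finite tensor4) \<Rightarrow> bool" where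
  "bounded_coeff M B a \<longleftrightarrow> a \<in> borel_measurable M \<and> 0 \<le> B \<and> (AE x in M. norm (a x) \<le> B)"

lemma tensor_apply_measurable:
  assumes "a \<in> borel_measurable M" "e \<in> borel_measurable M"
  shows "(\<lambda>x. tensor_apply (a x) (e x)) \<in> borel_measurable M"
  by (rule borel_measurable_continuous_Pair[OF assms])
     (intro tensor.continuous_on continuous_intros)

lemma form_L2:
  assumes a: "bounded_coeff M B a" and e: "e \<in> L2 M"
  shows "(\<lambda>x. tensor_apply (a x) (e x)) \<in> L2 M"
    and "l2_norm M (\<lambda>x. tensor_apply (a x) (e x)) \<le> B * l2_norm M e"
proof -
  have m: "(\<lambda>x. tensor_apply (a x) (e x)) \<in> borel_measurable M"
    using a L2_measurable[OF e] by (intro tensor_apply_measurable) (auto simp: bounded_coeff_def)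
  have "AE x in M. norm (a x) \<le> B" using a by (simp add: bounded_coeff_def)
  then have le: "AE x in M. norm (tensor_apply (a x) (e x)) \<le> B * norm (e x)"
    by eventually_elim (meson mult_right_mono norm_ge_zero norm_tensor_apply_le order_trans)
  show "(\<lambda>x. tensor_apply (a x) (e x)) \<in> L2 M" by (rule L2_dominated[OF m le e])
  have "0 \<le> B" using a by (simp add: bounded_coeff_def)
  then have "l2_norm M (\<lambda>x. tensor_apply (a x) (e x)) \<le> l2_norm M (\<lambda>x. B *\<^sub>R e x)"
    using le by (intro l2_norm_mono m L2_scaleR e) simp
  with \<open>0 \<le> B\<close> show "l2_norm M (\<lambda>x. tensor_apply (a x) (e x)) \<le> B * l2_norm M e"
    by (simp add: l2_norm_scaleR)
qed

lemma form_integrable: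
  "bounded_coeff M B a \<Longrightarrow> e \<in> L2 M \<Longrightarrow> e' \<in> L2 M \<Longrightarrow> integrable M (\<lambda>x. tensor_apply (a x) (e x) \<bullet> e' x)"
  by (intro L2_inner_integrable form_L2)

lemma form_bound:
  assumes "bounded_coeff M B a" "e \<in> L2 M" "e' \<in> L2 M"
  shows "\<bar>form M a e e'\<bar> \<le> B * l2_norm M e * l2_norm M e'"
  unfolding form_def
  using l2_norm_Cauchy_Schwarz[OF form_L2(1)[OF assms(1,2)] assms(3)]
    mult_right_mono[OF form_L2(2)[OF assms(1,2)] l2_norm_nonneg[of M e']] by linarith

lemma form_diff_left:
  assumes "bounded_coeff M B a" "e1 \<in> L2 M" "e2 \<in> L2 M" "e' \<in> L2 M"
  shows "form M a (\<lambda>x. e1 x - e2 x) e' = form M a e1 e' - form M a e2 e'"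
  unfolding form_def using form_integrable[OF assms(1,2,4)] form_integrable[OF assms(1,3,4)]
  by (simp add: tensor.diff_right inner_diff_left)

lemma form_diff_right:
  assumes "bounded_coeff M B a" "e \<in> L2 M" "e1 \<in> L2 M" "e2 \<in> L2 M"
  shows "form M a e (\<lambda>x. e1 x - e2 x) = form M a e e1 - form M a e e2"
  unfolding form_def using form_integrable[OF assms(1,2,3)] form_integrable[OF assms(1,2,4)]
  by (simp add: inner_diff_right)

lemma form_diff_coeff:
  assumes "bounded_coeff M B a" "bounded_coeff M B' b" "e \<in> L2 M" "e' \<in> L2 M"
  shows "form M (\<lambda>x. a x - b x) e e' = form M a e e' - form M b e e'"
  unfolding form_def using form_integrable[OF assms(1,3,4)] form_integrable[OF assms(2,3,4)]
  by (simp add: tensor.diff_left inner_diff_left)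

lemma form_scaleR: "form M (\<lambda>x. r *\<^sub>R a x) e e' = r * form M a e e'"
  by (simp add: form_def tensor.scaleR_left)

lemma L2_vec:
  fixes F :: "'x \<Rightarrow> 'b::euclidean_space ^ 'n::finite"
  assumes "\<And>i. (\<lambda>x. F x $ i) \<in> L2 M"
  shows "F \<in> L2 M"
proof -
  have "F \<in> borel_measurable M"
  proof (rule borel_measurable_euclidean_space[THEN iffD2], rule ballI)
    fix b :: "'b ^ 'n" assume "b \<in> Basis"
    then obtain i u where "b = axis i u" by (auto simp: Basis_vec_def)
    then show "(\<lambda>x. F x \<bullet> b) \<in> borel_measurable M"
      using borel_measurable_inner[OF L2_measurable[OF assms[of i]] borel_measurable_const[of u]]
      by (simp add: inner_axis)
  qed
  moreover have "integrable M (\<lambda>x. (norm (F x))\<^sup>2)"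
    unfolding norm_vec_square using assms by (intro Bochner_Integration.integrable_sum L2_integrable_square)
  ultimately show ?thesis by (simp add: L2_def)
qed

context bounded_open
begin

lemma sym_grad_L2:
  assumes "u \<in> H1_vec \<Omega>"
  shows "sym_grad \<Omega> u \<in> L2 M"
proof (intro L2_vec)
  fix i j
  have w: "weak_grad \<Omega> (\<lambda>y. u y $ k) \<in> L2 M" for k
    using assms by (intro weak_grad_L2) (simp add: H1_vec_def)
  have "(\<lambda>x. (1/2) *\<^sub>R (weak_grad \<Omega> (\<lambda>y. u y $ i) x $ j + weak_grad \<Omega> (\<lambda>y. u y $ j) x $ i)) \<in> L2 M"
    by (intro L2_scaleR L2_add L2_component w)
  then show "(\<lambda>x. sym_grad \<Omega> u x $ i $ j) \<in> L2 M"
    by (simp add: sym_grad_def weak_jacobian_def transpose_def)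
qed

lemma H1_vec_L2: "u \<in> H1_vec \<Omega> \<Longrightarrow> u \<in> L2 M"
  by (intro L2_vec H1_L2) (simp add: H1_vec_def)

lemma transpose_sym_grad: "transpose (sym_grad \<Omega> u x) = sym_grad \<Omega> u x"
  by (simp add: sym_grad_def transpose_def vec_eq_iff add.commute)

text \<open>Lebesgue measure is complete, so h inherits measurability from the pointwise limit with
  which it agrees almost everywhere. Integrands containing \<open>C'\<close> become measurable in
  this way, as limits of difference quotients.\<close>

lemma borel_measurable_AE_limit:
  fixes f :: "nat \<Rightarrow> real ^ 'd \<Rightarrow> real"
  assumes f: "\<And>n. f n \<in> borel_measurable M" and lim: "AE x in M. (\<lambda>n. f n x) \<longlonglongrightarrow> h x"
  shows "h \<in> borel_measurable M"
proof -
  define h' where "h' x = lim (\<lambda>n. f n x)" for x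
  have "h' \<in> borel_measurable M" unfolding h'_def by (intro borel_measurable_lim_metric f)
  then have "(\<lambda>x. if x \<in> \<Omega> then h' x else 0) \<in> borel_measurable lebesgue"
    by (subst borel_measurable_if) auto
  moreover have "AE x in M. h' x = h x"
    using lim by eventually_elim (simp add: h'_def limI)
  then have "AE x in lebesgue. (if x \<in> \<Omega> then h' x else 0) = (if x \<in> \<Omega> then h x else 0)"
    by (subst (asm) AE_restrict_space_iff) auto
  ultimately have "(\<lambda>x. if x \<in> \<Omega> then h x else 0) \<in> borel_measurable lebesgue"
    by (rule borel_measurable_AE)
  then show ?thesis by (subst (asm) borel_measurable_if) auto
qed

end

section \<open>The compliance along a segment of designs\<close>

locale elasticity = bounded_open \<Omega> for \<Omega> :: "(real ^ 'd::finite) set" +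
  fixes \<Gamma>\<^sub>D \<Gamma>\<^sub>g :: "(real ^ 'd) set" and C0 C1 :: "'d tensor4" and g :: "real \<Rightarrow> real"
    and f gs :: "real ^ 'd \<Rightarrow> real ^ 'd" and \<theta> \<Lambda> L :: real
  assumes tensors: "elasticity_tensor C0" "elasticity_tensor C1"
    and elliptic: "0 < \<theta>" "elliptic_tensor \<theta> \<Lambda> C0" "elliptic_tensor \<theta> \<Lambda> C1"
    and g_range: "g s \<in> {-1..1}" and g_mono: "mono g"
    and g_diff: "g differentiable_on {-1..1}" and g_lipschitz: "L-lipschitz_on {-1..1} g"
    and f_L2: "f \<in> L2 M"
begin

abbreviation C where "C \<equiv> interp_tensor g C0 C1"
abbreviation C' where "C' \<equiv> interp_tensor' g C0 C1"

definition CB :: real where "CB = norm (C0 - C1) + norm (C0 + C1)"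
definition CL :: real where "CL = L * norm (C0 - C1)"

lemma L_nonneg: "0 \<le> L" using g_lipschitz by (rule lipschitz_on_nonneg)
lemma CL_nonneg: "0 \<le> CL" by (simp add: CL_def L_nonneg)

lemma C_bound: "norm (C s) \<le> CB"
proof -
  have "norm (C s) \<le> norm ((1/2 * g s) *\<^sub>R (C0 - C1)) + norm ((1/2::real) *\<^sub>R (C0 + C1))"
    unfolding interp_tensor_def by (rule norm_triangle_ineq)
  also have "\<dots> = \<bar>g s\<bar> / 2 * norm (C0 - C1) + 1/2 * norm (C0 + C1)" by simp
  also have "\<dots> \<le> 1 * norm (C0 - C1) + 1 * norm (C0 + C1)"
    using g_range[of s] by (intro add_mono mult_right_mono) auto
  finally show ?thesis by (simp add: CB_def)
qed

lemma C_diff: "C s - C t = (1/2 * (g s - g t)) *\<^sub>R (C0 - C1)"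
  by (simp add: interp_tensor_def scaleR_diff_left right_diff_distrib diff_divide_distrib)

lemma C_lipschitz:
  assumes "s \<in> {-1..1}" "t \<in> {-1..1}"
  shows "norm (C s - C t) \<le> CL * \<bar>s - t\<bar>"
proof -
  have "\<bar>g s - g t\<bar> \<le> L * \<bar>s - t\<bar>"
    using lipschitz_onD[OF g_lipschitz assms] by (simp add: dist_real_def)
  then have "\<bar>g s - g t\<bar> / 2 * norm (C0 - C1) \<le> L * \<bar>s - t\<bar> * norm (C0 - C1)"
    by (intro mult_right_mono) auto
  then show ?thesis by (simp add: C_diff CL_def mult_ac)
qed

text \<open>The weights are nonnegative and add up to 1, so symmetry and ellipticity pass from
  \<open>C0\<close> and \<open>C1\<close> to the interpolated tensor.\<close>

lemma tensor_C: "tensor_apply (C s) X \<bullet> Y =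
    (1 + g s) / 2 * (tensor_apply C0 X \<bullet> Y) + (1 - g s) / 2 * (tensor_apply C1 X \<bullet> Y)"
  unfolding interp_tensor_def tensor.add_left tensor.scaleR_left tensor.diff_left
  by (simp add: inner_add_left inner_diff_left algebra_simps add_divide_distrib diff_divide_distrib)

lemma C_symmetric: "tensor_apply (C s) X \<bullet> Y = tensor_apply (C s) Y \<bullet> X"
  unfolding tensor_C using elasticity_tensor_symmetric tensors by metis

lemma C_elliptic:
  assumes "transpose X = X"
  shows "\<theta> * (norm X)\<^sup>2 \<le> tensor_apply (C s) X \<bullet> X"
proof (cases "X = 0")
  case False
  then have "\<theta> * (norm X)\<^sup>2 \<le> tensor_apply C0 X \<bullet> X" "\<theta> * (norm X)\<^sup>2 \<le> tensor_apply C1 X \<bullet> X"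
    using elliptic assms unfolding elliptic_tensor_def by blast+
  then have "(1 + g s) / 2 * (\<theta> * (norm X)\<^sup>2) + (1 - g s) / 2 * (\<theta> * (norm X)\<^sup>2) \<le> tensor_apply (C s) X \<bullet> X"
    unfolding tensor_C using g_range[of s] by (intro add_mono mult_left_mono) auto
  then show ?thesis by (simp add: algebra_simps add_divide_distrib diff_divide_distrib)
qed (simp add: tensor.zero_right)

lemma C_measurable: "\<phi> \<in> borel_measurable M \<Longrightarrow> (\<lambda>x. C (\<phi> x)) \<in> borel_measurable M"
  unfolding interp_tensor_def
  by (intro borel_measurable_add borel_measurable_scaleR borel_measurable_const borel_measurable_times
      measurable_compose[OF _ borel_measurable_mono[OF g_mono]])

lemma C_coeff: "\<phi> \<in> borel_measurable M \<Longrightarrow> bounded_coeff M CB (\<lambda>x. C (\<phi> x))"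
  using C_measurable C_bound by (simp add: bounded_coeff_def CB_def)

lemma C_derivative:
  assumes s: "s \<in> {-1..1}"
  shows "\<exists>d. (g has_real_derivative d) (at s within {-1..1}) \<and> C' s = (1/2 * d) *\<^sub>R (C0 - C1)"
proof -
  have "g differentiable (at s within {-1..1})"
    using g_diff s unfolding differentiable_on_def by blast
  then obtain d where d: "(g has_real_derivative d) (at s within {-1..1})"
    unfolding real_differentiable_def by blast
  then have "(C has_vector_derivative (1/2 * d) *\<^sub>R (C0 - C1)) (at s within {-1..1})"
    unfolding interp_tensor_def
    by (auto intro!: derivative_eq_intros simp: has_real_derivative_iff_has_vector_derivative)
  then have "C' s = (1/2 * d) *\<^sub>R (C0 - C1)"
    unfolding interp_tensor'_def using s by (intro vector_derivative_within_closed_interval) auto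
  with d show ?thesis by blast
qed

lemma C_difference_quotient:
  assumes p: "p \<in> {-1..1}" and q: "q \<in> {-1..1}" and t: "\<And>n. 0 < t n" "\<And>n. t n \<le> 1" "t \<longlonglongrightarrow> 0"
  shows "(\<lambda>n. (1 / t n) *\<^sub>R (C ((1 - t n) * p + t n * q) - C p)) \<longlonglongrightarrow> (q - p) *\<^sub>R C' p"
proof (cases "p = q")
  case True
  then show ?thesis by (simp add: algebra_simps)
next
  case False
  let ?s = "\<lambda>n. (1 - t n) * p + t n * q"
  have s: "?s n \<in> {-1..1}" for n
    using convexD_alt[OF convex_real_interval(5) p q, of "t n"] t(1,2)[of n] by simp
  have sp: "?s n - p = t n * (q - p)" for n by (simp add: algebra_simps)
  \<comment> \<open>The derivative within [-1,1] is evaluated along points different from p; hence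
    the separate case p = q.\<close>
  have ne: "?s n \<noteq> p" for n using False sp[of n] t(1)[of n] by auto
  have "(\<lambda>n. (1 - t n) * p + t n * q) \<longlonglongrightarrow> (1 - 0) * p + 0 * q" by (intro tendsto_intros t(3))
  then have "?s \<longlonglongrightarrow> p" by simp
  then have fl: "filterlim ?s (at p within {-1..1}) sequentially"
    unfolding filterlim_at using s ne by auto
  obtain d where d: "(g has_real_derivative d) (at p within {-1..1})"
    and C': "C' p = (1/2 * d) *\<^sub>R (C0 - C1)" using C_derivative[OF p] by blast
  have "((\<lambda>y. (g y - g p) / (y - p)) \<longlongrightarrow> d) (at p within {-1..1})"
    using d by (simp add: has_field_derivative_iff)
  from filterlim_compose[OF this fl]
  have "(\<lambda>n. ((q - p) / 2 * ((g (?s n) - g p) / (?s n - p))) *\<^sub>R (C0 - C1)) \<longlonglongrightarrow> ((q - p) / 2 * d) *\<^sub>R (C0 - C1)"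
    by (intro tendsto_intros)
  moreover have "((q - p) / 2 * ((g (?s n) - g p) / (?s n - p))) *\<^sub>R (C0 - C1) = (1 / t n) *\<^sub>R (C (?s n) - C p)" for n
  proof -
    have "(q - p) / 2 * (D / (t n * (q - p))) = 1 / t n * (1 / 2 * D)" for D
      using False t(1)[of n] by simp
    then show ?thesis unfolding sp C_diff scaleR_scaleR by simp
  qed
  ultimately show ?thesis by (simp add: C')
qed

end

lemma integrable_bounded_mult:
  fixes a F :: "'x \<Rightarrow> real"
  assumes "a \<in> borel_measurable M" "AE x in M. \<bar>a x\<bar> \<le> B" "integrable M F"
  shows "integrable M (\<lambda>x. a x * F x)"
proof (rule Bochner_Integration.integrable_bound)
  show "integrable M (\<lambda>x. B * F x)" using assms(3) by simp
  show "(\<lambda>x. a x * F x) \<in> borel_measurable M" using assms(1,3) by (intro borel_measurable_times) auto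
  show "AE x in M. norm (a x * F x) \<le> norm (B * F x)"
    using assms(2)
  proof eventually_elim
    case (elim x)
    then have "\<bar>a x\<bar> * \<bar>F x\<bar> \<le> \<bar>B\<bar> * \<bar>F x\<bar>" by (intro mult_right_mono) auto
    then show ?case by (simp add: abs_mult)
  qed
qed

lemma borel_measurable_h_load: "h_load \<in> borel_measurable borel"
  unfolding h_load_def[abs_def] by measurable

lemma H1D_H1_vec: "v \<in> H1D \<Omega> \<Gamma>\<^sub>D \<Longrightarrow> v \<in> H1_vec \<Omega>"
  by (simp add: H1D_def)

text \<open>A null sequence of steps from \<open>\<phi>0\<close> towards \<open>\<phi>1\<close>,
  with any choice of states. The state \<open>u1\<close> at the far end serves to express the load
  increment by elastic forms.\<close>

locale design_segment = elasticity +
  fixes \<phi>0 \<phi>1 :: "real ^ 'a \<Rightarrow> real" and t :: "nat \<Rightarrow> real"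
    and u0 u1 :: "real ^ 'a \<Rightarrow> real ^ 'a" and u :: "nat \<Rightarrow> real ^ 'a \<Rightarrow> real ^ 'a"
  assumes \<phi>_measurable: "\<phi>0 \<in> borel_measurable M" "\<phi>1 \<in> borel_measurable M"
    and \<phi>_range: "AE x in M. \<phi>0 x \<in> {-1..1}" "AE x in M. \<phi>1 x \<in> {-1..1}"
    and t: "\<And>n. 0 < t n" "\<And>n. t n \<le> 1" "t \<longlonglongrightarrow> 0"
    and state0: "is_state \<Omega> \<Gamma>\<^sub>D \<Gamma>\<^sub>g C f gs \<phi>0 u0"
    and state1: "is_state \<Omega> \<Gamma>\<^sub>D \<Gamma>\<^sub>g C f gs \<phi>1 u1"
    and state: "\<And>n. is_state \<Omega> \<Gamma>\<^sub>D \<Gamma>\<^sub>g C f gs (\<lambda>x. (1 - t n) * \<phi>0 x + t n * \<phi>1 x) (u n)"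
begin

abbreviation V where "V \<equiv> H1D \<Omega> \<Gamma>\<^sub>D"
abbreviation ld where "ld \<equiv> load \<Omega> \<Gamma>\<^sub>g f gs"
abbreviation E where "E \<equiv> sym_grad \<Omega>"

definition \<phi> where "\<phi> n x = (1 - t n) * \<phi>0 x + t n * \<phi>1 x"
definition \<eta> where "\<eta> x = \<phi>1 x - \<phi>0 x"
definition load_dir :: "(real ^ 'a \<Rightarrow> real ^ 'a) \<Rightarrow> real" where "load_dir v = (LINT x|M. \<eta> x * (f x \<bullet> v x))"
definition gap where "gap n = l2_norm M (\<lambda>x. E (u n) x - E u0 x)"

lemma \<phi>n_measurable: "\<phi> n \<in> borel_measurable M"
  unfolding \<phi>_def by (intro borel_measurable_add borel_measurable_times borel_measurable_const \<phi>_measurable)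

lemma \<eta>_measurable: "\<eta> \<in> borel_measurable M"
  unfolding \<eta>_def[abs_def] by (intro borel_measurable_diff \<phi>_measurable)

lemma \<phi>n_range: "AE x in M. \<phi> n x \<in> {-1..1}"
  using \<phi>_range
proof eventually_elim
  case (elim x)
  then show ?case
    using convexD_alt[OF convex_real_interval(5) elim, of "t n"] t(1,2)[of n] by (simp add: \<phi>_def)
qed

lemma \<eta>_range: "AE x in M. \<bar>\<eta> x\<bar> \<le> 2"
  using \<phi>_range by eventually_elim (auto simp: \<eta>_def)

lemma state_V: "u0 \<in> V" "u1 \<in> V" "u n \<in> V"
  using state0 state1 state by (auto simp: is_state_def)

lemma E_L2: "v \<in> V \<Longrightarrow> E v \<in> L2 M"
  by (intro sym_grad_L2 H1D_H1_vec)

lemma V_L2: "v \<in> V \<Longrightarrow> v \<in> L2 M"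
  by (intro H1_vec_L2 H1D_H1_vec)

lemma state_form:
  assumes "v \<in> V"
  shows "form M (\<lambda>x. C (\<phi>0 x)) (E u0) (E v) = ld \<phi>0 v"
    and "form M (\<lambda>x. C (\<phi>1 x)) (E u1) (E v) = ld \<phi>1 v"
    and "form M (\<lambda>x. C (\<phi> n x)) (E (u n)) (E v) = ld (\<phi> n) v"
  using state0 state1 state[of n] assms by (auto simp: is_state_def form_def \<phi>_def[abs_def])

text \<open>On [-1,1] \<open>h_load\<close> is affine, and the traction integral cancels because it
  is the same for both designs.\<close>

lemma load_diff:
  assumes p: "p \<in> borel_measurable M" "AE x in M. p x \<in> {-1..1}"
    and q: "q \<in> borel_measurable M" "AE x in M. q x \<in> {-1..1}" and v: "v \<in> V"
  shows "ld p v - ld q v = - 1/2 * (LINT x|M. (p x - q x) * (f x \<bullet> v x))"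
proof -
  have fv: "integrable M (\<lambda>x. f x \<bullet> v x)" by (rule L2_inner_integrable[OF f_L2 V_L2[OF v]])
  have int: "integrable M (\<lambda>x. h_load (r x) * (f x \<bullet> v x))" if "r \<in> borel_measurable M" for r
    by (rule integrable_bounded_mult[OF measurable_compose[OF that borel_measurable_h_load] _ fv, of 1])
       (auto simp: h_load_def)
  have "ld p v - ld q v = (LINT x|M. h_load (p x) * (f x \<bullet> v x) - h_load (q x) * (f x \<bullet> v x))"
    using int[OF p(1)] int[OF q(1)] by (simp add: load_def)
  also have "\<dots> = (LINT x|M. - 1/2 * ((p x - q x) * (f x \<bullet> v x)))"
  proof (rule integral_cong_AE)
    show "(\<lambda>x. h_load (p x) * (f x \<bullet> v x) - h_load (q x) * (f x \<bullet> v x)) \<in> borel_measurable M"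
      using int[OF p(1)] int[OF q(1)] by (intro borel_measurable_diff borel_measurable_integrable)
    show "(\<lambda>x. - 1/2 * ((p x - q x) * (f x \<bullet> v x))) \<in> borel_measurable M"
      using fv p q by (intro borel_measurable_times borel_measurable_diff borel_measurable_const) auto
    show "AE x in M. h_load (p x) * (f x \<bullet> v x) - h_load (q x) * (f x \<bullet> v x) = - 1/2 * ((p x - q x) * (f x \<bullet> v x))"
      using p(2) q(2)
    proof eventually_elim
      case (elim x)
      then have "h_load (p x) - h_load (q x) = - 1/2 * (p x - q x)"
        by (simp add: h_load_def diff_divide_distrib)
      then show ?case by (simp only: left_diff_distrib[symmetric] mult.assoc[symmetric])
    qed
  qed
  also have "\<dots> = - 1/2 * (LINT x|M. (p x - q x) * (f x \<bullet> v x))" by (rule integral_mult_right_zero)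
  finally show ?thesis .
qed

lemma load_step: "v \<in> V \<Longrightarrow> ld (\<phi> n) v - ld \<phi>0 v = - t n / 2 * load_dir v"
proof -
  assume v: "v \<in> V"
  have "(LINT x|M. (\<phi> n x - \<phi>0 x) * (f x \<bullet> v x)) = (LINT x|M. t n * (\<eta> x * (f x \<bullet> v x)))"
    by (rule Bochner_Integration.integral_cong) (auto simp: \<phi>_def \<eta>_def algebra_simps)
  also have "\<dots> = t n * load_dir v" by (simp add: load_dir_def)
  finally show "ld (\<phi> n) v - ld \<phi>0 v = - t n / 2 * load_dir v"
    using load_diff[OF \<phi>n_measurable \<phi>n_range \<phi>_measurable(1) \<phi>_range(1) v] by simp
qed

lemma load_dir_form: "v \<in> V \<Longrightarrow>
    load_dir v = 2 * (form M (\<lambda>x. C (\<phi>0 x)) (E u0) (E v) - form M (\<lambda>x. C (\<phi>1 x)) (E u1) (E v))"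
  using load_diff[OF \<phi>_measurable(2) \<phi>_range(2) \<phi>_measurable(1) \<phi>_range(1), of v] state_form(1,2)[of v]
  by (simp add: load_dir_def \<eta>_def)

lemma coeff: "bounded_coeff M CB (\<lambda>x. C (\<phi>0 x))" "bounded_coeff M CB (\<lambda>x. C (\<phi>1 x))"
  "bounded_coeff M CB (\<lambda>x. C (\<phi> n x))"
  by (intro C_coeff \<phi>_measurable \<phi>n_measurable)+

lemma dE_L2: "(\<lambda>x. E (u n) x - E u0 x) \<in> L2 M"
  by (intro L2_diff E_L2 state_V)

text \<open>No Korn inequality is needed: the state equations at both ends of the segment bound the
  load increment by the energy norm. Moreover the state equations are only tested with states, so
  linearity and continuity of the trace never enter.\<close>

lemma load_dir_diff_bound:
  "\<bar>load_dir (u n) - load_dir u0\<bar> \<le> 2 * CB * (l2_norm M (E u0) + l2_norm M (E u1)) * gap n"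
proof -
  have "load_dir (u n) - load_dir u0 = 2 * (form M (\<lambda>x. C (\<phi>0 x)) (E u0) (\<lambda>x. E (u n) x - E u0 x)
      - form M (\<lambda>x. C (\<phi>1 x)) (E u1) (\<lambda>x. E (u n) x - E u0 x))"
    unfolding form_diff_right[OF coeff(1) E_L2 E_L2 E_L2, OF state_V(1,3,1)]
      form_diff_right[OF coeff(2) E_L2 E_L2 E_L2, OF state_V(2,3,1)]
    by (simp add: load_dir_form state_V)
  moreover have "\<bar>form M (\<lambda>x. C (\<phi>0 x)) (E u0) (\<lambda>x. E (u n) x - E u0 x)\<bar> \<le> CB * l2_norm M (E u0) * gap n"
    "\<bar>form M (\<lambda>x. C (\<phi>1 x)) (E u1) (\<lambda>x. E (u n) x - E u0 x)\<bar> \<le> CB * l2_norm M (E u1) * gap n"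
    unfolding gap_def by (intro form_bound coeff E_L2 state_V dE_L2)+
  ultimately show ?thesis by (simp add: algebra_simps)
qed

lemma coeff_diff: "bounded_coeff M (2 * CL * t n) (\<lambda>x. C (\<phi> n x) - C (\<phi>0 x))"
  unfolding bounded_coeff_def
proof (intro conjI)
  show "(\<lambda>x. C (\<phi> n x) - C (\<phi>0 x)) \<in> borel_measurable M"
    by (intro borel_measurable_diff C_measurable \<phi>n_measurable \<phi>_measurable)
  show "0 \<le> 2 * CL * t n" using CL_nonneg t(1)[of n] by simp
  show "AE x in M. norm (C (\<phi> n x) - C (\<phi>0 x)) \<le> 2 * CL * t n"
    using \<phi>n_range[of n] \<phi>_range(1) \<eta>_range
  proof eventually_elim
    case (elim x)
    have "\<phi> n x - \<phi>0 x = t n * \<eta> x" by (simp add: \<phi>_def \<eta>_def algebra_simps)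
    then have "\<bar>\<phi> n x - \<phi>0 x\<bar> = t n * \<bar>\<eta> x\<bar>" using t(1)[of n] by (simp add: abs_mult)
    also have "\<dots> \<le> t n * 2" using elim(3) t(1)[of n] by (intro mult_left_mono) auto
    finally have "CL * \<bar>\<phi> n x - \<phi>0 x\<bar> \<le> CL * (t n * 2)" by (intro mult_left_mono CL_nonneg)
    then show ?case using C_lipschitz[OF elim(1,2)] by simp
  qed
qed

section \<open>Convergence of the states and of the difference quotients\<close>

lemma form_diff_square:
  assumes a: "bounded_coeff M B a" and e: "e \<in> L2 M" "e' \<in> L2 M"
  shows "form M a (\<lambda>x. e x - e' x) (\<lambda>x. e x - e' x) =
    form M a e e - form M a e e' - form M a e' e + form M a e' e'"
  using form_diff_left[OF a e L2_diff[OF e]] form_diff_right[OF a e(1) e] form_diff_right[OF a e(2) e] by simp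

lemma form_C_coercive:
  "\<theta> * (gap n)\<^sup>2 \<le> form M (\<lambda>x. C (p x)) (\<lambda>x. E (u n) x - E u0 x) (\<lambda>x. E (u n) x - E u0 x)"
  if "p \<in> borel_measurable M" for p
proof -
  have tr: "transpose (E (u n) x - E u0 x) = E (u n) x - E u0 x" for x
    using transpose_sym_grad[of "u n" x] transpose_sym_grad[of u0 x]
    by (simp add: transpose_def vec_eq_iff)
  have "\<theta> * (gap n)\<^sup>2 = (LINT x|M. \<theta> * (norm (E (u n) x - E u0 x))\<^sup>2)"
    by (simp add: gap_def l2_norm_square)
  also have "\<dots> \<le> form M (\<lambda>x. C (p x)) (\<lambda>x. E (u n) x - E u0 x) (\<lambda>x. E (u n) x - E u0 x)"
    unfolding form_def
    by (intro integral_mono integrable_mult_right L2_integrable_square dE_L2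
        form_integrable[OF C_coeff] that C_elliptic tr)
  finally show ?thesis .
qed

text \<open>The summands come from the load increment and from the change of the coefficients, the
  division by \<theta> from coercivity.\<close>

definition gap_rate :: real where
  "gap_rate = (CB * (l2_norm M (E u0) + l2_norm M (E u1)) + 2 * CL * l2_norm M (E u0)) / \<theta>"

lemma theta_gap_rate: "\<theta> * gap_rate = CB * (l2_norm M (E u0) + l2_norm M (E u1)) + 2 * CL * l2_norm M (E u0)"
  using elliptic(1) by (simp add: gap_rate_def)

lemma gap_nonneg: "0 \<le> gap n" by (simp add: gap_def l2_norm_nonneg)

text \<open>Coercivity at the new design is applied to the difference of the strains. There
  \<open>u0\<close> satisfies the old equation up to the change of coefficients, so the right-hand
  side is of order t n times \<open>gap n\<close>, and one factor \<open>gap n\<close>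
  cancels.\<close>

lemma gap_bound: "gap n \<le> gap_rate * t n"
proof -
  let ?d = "\<lambda>x. E (u n) x - E u0 x"
  have "\<theta> * (gap n)\<^sup>2 \<le> form M (\<lambda>x. C (\<phi> n x)) ?d ?d"
    by (rule form_C_coercive[OF \<phi>n_measurable])
  also have "\<dots> = form M (\<lambda>x. C (\<phi> n x)) (E (u n)) ?d - form M (\<lambda>x. C (\<phi> n x)) (E u0) ?d"
    by (rule form_diff_left[OF coeff(3) E_L2 E_L2 dE_L2, OF state_V(3,1)])
  also have "form M (\<lambda>x. C (\<phi> n x)) (E (u n)) ?d = ld (\<phi> n) (u n) - ld (\<phi> n) u0"
    unfolding form_diff_right[OF coeff(3) E_L2 E_L2 E_L2, OF state_V(3,3,1)]
    by (simp add: state_form state_V)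
  also have "form M (\<lambda>x. C (\<phi> n x)) (E u0) ?d =
      form M (\<lambda>x. C (\<phi> n x) - C (\<phi>0 x)) (E u0) ?d + (ld \<phi>0 (u n) - ld \<phi>0 u0)"
    unfolding form_diff_coeff[OF coeff(3,1) E_L2 dE_L2, OF state_V(1)]
      form_diff_right[OF coeff(1) E_L2 E_L2 E_L2, OF state_V(1,3,1)]
    by (simp add: state_form state_V)
  finally have "\<theta> * (gap n)\<^sup>2 \<le> - t n / 2 * (load_dir (u n) - load_dir u0)
      - form M (\<lambda>x. C (\<phi> n x) - C (\<phi>0 x)) (E u0) ?d"
    using load_step[of "u n" n, OF state_V(3)] load_step[of u0 n, OF state_V(1)] by (simp add: algebra_simps)
  also have "\<dots> \<le> t n / 2 * \<bar>load_dir (u n) - load_dir u0\<bar> + \<bar>form M (\<lambda>x. C (\<phi> n x) - C (\<phi>0 x)) (E u0) ?d\<bar>"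
  proof -
    have "t n / 2 * - (load_dir (u n) - load_dir u0) \<le> t n / 2 * \<bar>load_dir (u n) - load_dir u0\<bar>"
      using t(1)[of n] by (intro mult_left_mono) auto
    then show ?thesis by linarith
  qed
  also have "\<dots> \<le> t n / 2 * (2 * CB * (l2_norm M (E u0) + l2_norm M (E u1)) * gap n)
      + 2 * CL * t n * l2_norm M (E u0) * gap n"
    using t(1)[of n] form_bound[OF coeff_diff E_L2[OF state_V(1)] dE_L2] unfolding gap_def[symmetric]
    by (intro add_mono mult_left_mono load_dir_diff_bound) auto
  also have "\<dots> = \<theta> * gap_rate * t n * gap n" unfolding theta_gap_rate by (simp add: algebra_simps)
  finally have "\<theta> * gap n * gap n \<le> \<theta> * (gap_rate * t n) * gap n" by (simp add: power2_eq_square mult_ac)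
  moreover have "0 \<le> gap_rate * t n"
    using t(1)[of n] elliptic(1) CL_nonneg l2_norm_nonneg[of M "E u0"] l2_norm_nonneg[of M "E u1"]
    by (auto simp: gap_rate_def CB_def intro!: mult_nonneg_nonneg divide_nonneg_nonneg add_nonneg_nonneg)
  ultimately show ?thesis
    using gap_nonneg[of n] elliptic(1) by (cases "gap n = 0") (simp_all add: mult_le_cancel_right)
qed

lemma gap_lim: "gap \<longlonglongrightarrow> 0"
proof (rule Lim_null_comparison)
  show "\<forall>\<^sub>F n in sequentially. norm (gap n) \<le> gap_rate * t n" using gap_bound gap_nonneg by simp
  show "(\<lambda>n. gap_rate * t n) \<longlonglongrightarrow> 0" using tendsto_mult[OF tendsto_const t(3)] by simp
qed

text \<open>Half the compliance is minus the minimal elastic energy; the state at the new design is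
  inserted as a competitor at the old one.\<close>

lemma compliance_increment:
  "ld (\<phi> n) (u n) - ld \<phi>0 u0 \<le>
    - t n * load_dir (u n) - form M (\<lambda>x. C (\<phi> n x) - C (\<phi>0 x)) (E (u n)) (E (u n))"
proof -
  let ?d = "\<lambda>x. E (u n) x - E u0 x"
  have "0 \<le> form M (\<lambda>x. C (\<phi>0 x)) ?d ?d"
    using form_C_coercive[OF \<phi>_measurable(1), of n] elliptic(1) by (meson mult_nonneg_nonneg order_trans less_imp_le zero_le_power2)
  also have "\<dots> = form M (\<lambda>x. C (\<phi>0 x)) (E (u n)) (E (u n)) - form M (\<lambda>x. C (\<phi>0 x)) (E (u n)) (E u0)
      - ld \<phi>0 (u n) + ld \<phi>0 u0"
    unfolding form_diff_square[OF coeff(1) E_L2 E_L2, OF state_V(3,1)] by (simp add: state_form state_V)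
  \<comment> \<open>Symmetry of the tensor turns the mixed term into the old state equation tested
    with \<open>u n\<close>.\<close>
  also have "form M (\<lambda>x. C (\<phi>0 x)) (E (u n)) (E u0) = ld \<phi>0 (u n)"
    using state_form(1)[OF state_V(3)] unfolding form_def by (subst C_symmetric)
  also have "form M (\<lambda>x. C (\<phi>0 x)) (E (u n)) (E (u n)) =
      ld (\<phi> n) (u n) - form M (\<lambda>x. C (\<phi> n x) - C (\<phi>0 x)) (E (u n)) (E (u n))"
    unfolding form_diff_coeff[OF coeff(3,1) E_L2 E_L2, OF state_V(3,3)] by (simp add: state_form state_V)
  finally show ?thesis using load_step[of "u n" n, OF state_V(3)] by simp
qed

text \<open>An upper bound for the difference quotient of the compliance, not the quotient
  itself.\<close>

definition slope where
  "slope n = - load_dir (u n) - form M (\<lambda>x. (1 / t n) *\<^sub>R (C (\<phi> n x) - C (\<phi>0 x))) (E (u n)) (E (u n))"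

lemma compliance_increment_le: "ld (\<phi> n) (u n) - ld \<phi>0 u0 \<le> t n * slope n"
  using compliance_increment[of n] t(1)[of n] unfolding slope_def form_scaleR by (simp add: algebra_simps)

lemma load_dir_lim: "(\<lambda>n. load_dir (u n)) \<longlonglongrightarrow> load_dir u0"
proof -
  have "(\<lambda>n. load_dir (u n) - load_dir u0) \<longlonglongrightarrow> 0"
  proof (rule Lim_null_comparison)
    show "\<forall>\<^sub>F n in sequentially. norm (load_dir (u n) - load_dir u0) \<le>
        2 * CB * (l2_norm M (E u0) + l2_norm M (E u1)) * gap n"
      using load_dir_diff_bound by simp
    show "(\<lambda>n. 2 * CB * (l2_norm M (E u0) + l2_norm M (E u1)) * gap n) \<longlonglongrightarrow> 0"
      using tendsto_mult[OF tendsto_const gap_lim] by simp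
  qed
  then show ?thesis by (simp add: LIM_zero_iff)
qed

lemma coeff_quotient: "bounded_coeff M (2 * CL) (\<lambda>x. (1 / t n) *\<^sub>R (C (\<phi> n x) - C (\<phi>0 x)))"
  unfolding bounded_coeff_def
proof (intro conjI)
  show "(\<lambda>x. (1 / t n) *\<^sub>R (C (\<phi> n x) - C (\<phi>0 x))) \<in> borel_measurable M"
    using coeff_diff[of n] by (intro borel_measurable_scaleR borel_measurable_const) (simp add: bounded_coeff_def)
  show "0 \<le> 2 * CL" using CL_nonneg by simp
  have "AE x in M. norm (C (\<phi> n x) - C (\<phi>0 x)) \<le> 2 * CL * t n"
    using coeff_diff[of n] by (simp add: bounded_coeff_def)
  then show "AE x in M. norm ((1 / t n) *\<^sub>R (C (\<phi> n x) - C (\<phi>0 x))) \<le> 2 * CL"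
  proof eventually_elim
    case (elim x)
    have "norm ((1 / t n) *\<^sub>R (C (\<phi> n x) - C (\<phi>0 x))) = norm (C (\<phi> n x) - C (\<phi>0 x)) / t n"
      using t(1)[of n] by simp
    also have "\<dots> \<le> 2 * CL" using elim t(1)[of n] by (simp add: pos_divide_le_eq)
    finally show ?case .
  qed
qed

text \<open>The coefficient quotients are bounded by \<open>2 * CL\<close> uniformly in n, so
  replacing \<open>u n\<close> by \<open>u0\<close> costs a term that vanishes with
  \<open>gap n\<close>.\<close>

lemma form_quotient_diff:
  "\<bar>form M (\<lambda>x. (1 / t n) *\<^sub>R (C (\<phi> n x) - C (\<phi>0 x))) (E (u n)) (E (u n))
    - form M (\<lambda>x. (1 / t n) *\<^sub>R (C (\<phi> n x) - C (\<phi>0 x))) (E u0) (E u0)\<bar>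
   \<le> 2 * CL * gap n * (2 * l2_norm M (E u0) + gap n)"
proof -
  let ?a = "\<lambda>x. (1 / t n) *\<^sub>R (C (\<phi> n x) - C (\<phi>0 x))" and ?d = "\<lambda>x. E (u n) x - E u0 x"
  note a = coeff_quotient[of n] and e = E_L2[OF state_V(3)] E_L2[OF state_V(1)]
  have "l2_norm M (\<lambda>x. ?d x + E u0 x) \<le> gap n + l2_norm M (E u0)"
    unfolding gap_def by (intro l2_norm_triangle dE_L2 e)
  then have n1: "l2_norm M (E (u n)) \<le> gap n + l2_norm M (E u0)" by simp
  have "form M ?a (E (u n)) (E (u n)) - form M ?a (E u0) (E u0) = form M ?a ?d (E (u n)) + form M ?a (E u0) ?d"
    using form_diff_left[OF a e(1) e(2) e(1)] form_diff_right[OF a e(2) e(1) e(2)] by simp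
  moreover have "\<bar>form M ?a ?d (E (u n))\<bar> \<le> 2 * CL * gap n * l2_norm M (E (u n))"
    unfolding gap_def by (rule form_bound[OF a dE_L2 e(1)])
  moreover have "\<dots> \<le> 2 * CL * gap n * (gap n + l2_norm M (E u0))"
    using CL_nonneg gap_nonneg[of n] by (intro mult_left_mono n1) auto
  moreover have "\<bar>form M ?a (E u0) ?d\<bar> \<le> 2 * CL * l2_norm M (E u0) * gap n"
    unfolding gap_def by (rule form_bound[OF a e(2) dE_L2])
  ultimately show ?thesis by (simp add: algebra_simps)
qed

text \<open>With the state frozen this is dominated convergence; the majorant comes from the
  Lipschitz continuity of g.\<close>

lemma form_quotient_lim:
  defines "k \<equiv> \<lambda>x. \<eta> x * (tensor_apply (C' (\<phi>0 x)) (E u0 x) \<bullet> E u0 x)"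
  shows "integrable M k"
    and "(\<lambda>n. form M (\<lambda>x. (1 / t n) *\<^sub>R (C (\<phi> n x) - C (\<phi>0 x))) (E u0) (E u0)) \<longlonglongrightarrow> (LINT x|M. k x)"
proof -
  let ?k = "\<lambda>n x. tensor_apply ((1 / t n) *\<^sub>R (C (\<phi> n x) - C (\<phi>0 x))) (E u0 x) \<bullet> E u0 x"
  note e = E_L2[OF state_V(1)]
  have km: "?k n \<in> borel_measurable M" for n
    by (rule borel_measurable_integrable[OF form_integrable[OF coeff_quotient e e]])
  have lim: "AE x in M. (\<lambda>n. ?k n x) \<longlonglongrightarrow> k x"
    using \<phi>_range
  proof eventually_elim
    case (elim x)
    have "(\<lambda>n. ?k n x) \<longlonglongrightarrow> tensor_apply ((\<phi>1 x - \<phi>0 x) *\<^sub>R C' (\<phi>0 x)) (E u0 x) \<bullet> E u0 x"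
      unfolding \<phi>_def
      by (intro tendsto_inner tendsto_const tensor.tendsto C_difference_quotient elim t)
    then show ?case by (simp add: k_def \<eta>_def tensor.scaleR_left)
  qed
  have bound: "AE x in M. norm (?k n x) \<le> 2 * CL * (norm (E u0 x))\<^sup>2" for n
  proof -
    have "AE x in M. norm ((1 / t n) *\<^sub>R (C (\<phi> n x) - C (\<phi>0 x))) \<le> 2 * CL"
      using coeff_quotient[of n] unfolding bounded_coeff_def by blast
    then show ?thesis
    proof eventually_elim
      case (elim x)
      let ?a = "(1 / t n) *\<^sub>R (C (\<phi> n x) - C (\<phi>0 x))"
      have "norm (?k n x) \<le> norm (tensor_apply ?a (E u0 x)) * norm (E u0 x)"
        by (simp only: real_norm_def Cauchy_Schwarz_ineq2)
      also have "\<dots> \<le> (norm ?a * norm (E u0 x)) * norm (E u0 x)"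
        by (intro mult_right_mono norm_tensor_apply_le) simp
      also have "\<dots> \<le> (2 * CL * norm (E u0 x)) * norm (E u0 x)"
        using elim by (intro mult_right_mono) auto
      finally show ?case by (simp add: power2_eq_square)
    qed
  qed
  have dom: "integrable M (\<lambda>x. 2 * CL * (norm (E u0 x))\<^sup>2)"
    by (intro integrable_mult_right L2_integrable_square e)
  have kmeas: "k \<in> borel_measurable M" by (rule borel_measurable_AE_limit[OF km lim])
  show "integrable M k" by (rule integrable_dominated_convergence[OF kmeas km dom lim bound])
  show "(\<lambda>n. form M (\<lambda>x. (1 / t n) *\<^sub>R (C (\<phi> n x) - C (\<phi>0 x))) (E u0) (E u0)) \<longlonglongrightarrow> (LINT x|M. k x)"
    unfolding form_def by (rule integral_dominated_convergence[OF kmeas km dom lim bound])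
qed

definition cost_density where
  "cost_density x = 2 * h_load' (\<phi>0 x) * (\<phi>1 x - \<phi>0 x) * (f x \<bullet> u0 x)
    - (\<phi>1 x - \<phi>0 x) * (tensor_apply (C' (\<phi>0 x)) (E u0 x) \<bullet> E u0 x)"

lemma cost_density:
  shows "integrable M cost_density"
    and "(LINT x|M. cost_density x) =
      - load_dir u0 - (LINT x|M. \<eta> x * (tensor_apply (C' (\<phi>0 x)) (E u0 x) \<bullet> E u0 x))"
proof -
  let ?k = "\<lambda>x. \<eta> x * (tensor_apply (C' (\<phi>0 x)) (E u0 x) \<bullet> E u0 x)"
  let ?h = "\<lambda>x. - (\<eta> x * (f x \<bullet> u0 x)) - ?k x"
  have fu: "integrable M (\<lambda>x. \<eta> x * (f x \<bullet> u0 x))"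
    by (rule integrable_bounded_mult[OF \<eta>_measurable \<eta>_range L2_inner_integrable[OF f_L2 V_L2[OF state_V(1)]]])
  have int: "integrable M ?h"
    by (intro Bochner_Integration.integrable_diff integrable_minus fu form_quotient_lim(1))
  have ae: "AE x in M. ?h x = cost_density x"
    using \<phi>_range(1) by eventually_elim (auto simp: h_load'_def \<eta>_def cost_density_def algebra_simps)
  \<comment> \<open>Applied to a constant sequence, the limit lemma says that a function equal
    almost everywhere to a measurable one is measurable.\<close>
  have m: "cost_density \<in> borel_measurable M"
    by (rule borel_measurable_AE_limit[of "\<lambda>n. ?h", OF borel_measurable_integrable[OF int]])
       (use ae in eventually_elim, simp)
  show "integrable M cost_density" by (rule integrable_cong_AE_imp[OF int m ae])
  have "(LINT x|M. cost_density x) = (LINT x|M. ?h x)"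
    using ae by (intro integral_cong_AE m borel_measurable_integrable[OF int]) (auto elim: eventually_mono)
  also have "\<dots> = - load_dir u0 - (LINT x|M. ?k x)"
    using fu form_quotient_lim(1) by (simp add: load_dir_def)
  finally show "(LINT x|M. cost_density x) = - load_dir u0 - (LINT x|M. ?k x)" .
qed

lemma slope_lim: "slope \<longlonglongrightarrow> (LINT x|M. cost_density x)"
proof -
  let ?k = "\<lambda>x. \<eta> x * (tensor_apply (C' (\<phi>0 x)) (E u0 x) \<bullet> E u0 x)"
  let ?a = "\<lambda>n x. (1 / t n) *\<^sub>R (C (\<phi> n x) - C (\<phi>0 x))"
  have "(\<lambda>n. form M (?a n) (E (u n)) (E (u n)) - form M (?a n) (E u0) (E u0)) \<longlonglongrightarrow> 0"
  proof (rule Lim_null_comparison)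
    show "\<forall>\<^sub>F n in sequentially. norm (form M (?a n) (E (u n)) (E (u n)) - form M (?a n) (E u0) (E u0))
        \<le> 2 * CL * gap n * (2 * l2_norm M (E u0) + gap n)"
      using form_quotient_diff by simp
    have "(\<lambda>n. 2 * CL * gap n * (2 * l2_norm M (E u0) + gap n)) \<longlonglongrightarrow> 2 * CL * 0 * (2 * l2_norm M (E u0) + 0)"
      by (intro tendsto_intros gap_lim)
    then show "(\<lambda>n. 2 * CL * gap n * (2 * l2_norm M (E u0) + gap n)) \<longlonglongrightarrow> 0" by simp
  qed
  from tendsto_add[OF this form_quotient_lim(2)]
  have "(\<lambda>n. form M (?a n) (E (u n)) (E (u n))) \<longlonglongrightarrow> (LINT x|M. ?k x)" by simp
  from tendsto_diff[OF tendsto_minus[OF load_dir_lim] this]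
  show ?thesis unfolding cost_density(2) slope_def .
qed

end

section \<open>The optimality condition\<close>

text \<open>Compactness of the unit sphere bounds \<gamma> by c times the norm; convexity and
  homogeneity make \<gamma> subadditive, hence Lipschitz with the same c. Factoring the difference
  of squares gives the constant \<open>c\<^sup>2 / 2\<close>.\<close>

lemma anisotropy_quadratic_convex:
  fixes \<gamma> :: "'a::euclidean_space \<Rightarrow> real"
  assumes hom: "\<forall>q l. q \<noteq> 0 \<and> l \<ge> 0 \<longrightarrow> \<gamma> (l *\<^sub>R q) = l * \<gamma> q"
    and pos: "\<forall>q. q \<noteq> 0 \<longrightarrow> \<gamma> q > 0" and cvx: "convex_on UNIV \<gamma>"
  shows "\<exists>c. quadratic_convex (\<lambda>q. 1/2 * \<bar>\<gamma> q\<bar>\<^sup>2) c"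
proof -
  obtain b :: 'a where "b \<in> Basis" using nonempty_Basis by blast
  then have "b \<noteq> 0" by (rule nonzero_Basis)
  \<comment> \<open>Homogeneity is assumed away from 0, so the value at 0 comes from l = 0 at a
    nonzero vector.\<close>
  then have zero: "\<gamma> 0 = 0" using hom[rule_format, of b 0] by simp
  have nonneg: "0 \<le> \<gamma> p" for p using pos zero by (cases "p = 0") (auto simp: less_imp_le)
  have "continuous_on (sphere 0 1) \<gamma>"
    by (rule continuous_on_subset[OF convex_on_continuous[OF open_UNIV cvx]]) simp
  then have "compact (\<gamma> ` sphere 0 1)" by (rule compact_continuous_image) simp
  then have "bounded (\<gamma> ` sphere 0 1)" by (rule compact_imp_bounded)
  then obtain c where "\<forall>y\<in>\<gamma> ` sphere 0 1. norm y \<le> c"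
    unfolding bounded_iff by blast
  then have c: "norm (\<gamma> p) \<le> c" if "p \<in> sphere 0 1" for p
    using that by blast
  have bound: "\<gamma> p \<le> c * norm p" for p
  proof (cases "p = 0")
    case False
    then have "\<gamma> (norm p *\<^sub>R ((1 / norm p) *\<^sub>R p)) = norm p * \<gamma> ((1 / norm p) *\<^sub>R p)"
      by (intro hom[rule_format]) simp
    moreover have "norm (\<gamma> ((1 / norm p) *\<^sub>R p)) \<le> c" using False by (intro c) simp
    ultimately have "\<gamma> p \<le> norm p * c" using False by (simp add: mult_left_mono)
    then show ?thesis by (simp add: mult.commute)
  qed (simp add: zero)
  have c0: "0 \<le> c" using bound[of b] nonneg[of b] \<open>b \<in> Basis\<close> by simp
  have subadd: "\<gamma> (p + q) \<le> \<gamma> p + \<gamma> q" for p q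
  proof (cases "p + q = 0")
    case True
    then show ?thesis using nonneg zero by simp
  next
    case False
    then have "\<gamma> ((1/2) *\<^sub>R (p + q)) = 1/2 * \<gamma> (p + q)" using hom by simp
    moreover have "\<gamma> ((1 - 1/2) *\<^sub>R p + (1/2) *\<^sub>R q) \<le> (1 - 1/2) * \<gamma> p + 1/2 * \<gamma> q"
      by (rule convex_onD[OF cvx]) auto
    ultimately show ?thesis by (simp add: scaleR_add_right)
  qed
  have lip1: "\<gamma> p - \<gamma> q \<le> c * norm (p - q)" for p q
    using subadd[of q "p - q"] bound[of "p - q"] by simp
  have lip: "\<bar>\<gamma> p - \<gamma> q\<bar> \<le> c * norm (p - q)" for p q
    using lip1[of p q] lip1[of q p] by (simp add: abs_le_iff norm_minus_commute)
  have "quadratic_convex (\<lambda>q. 1/2 * \<bar>\<gamma> q\<bar>\<^sup>2) (c\<^sup>2 / 2)"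
  proof
    show "convex_on UNIV (\<lambda>q. 1/2 * \<bar>\<gamma> q\<bar>\<^sup>2)"
    proof (rule convex_onI)
      fix s :: real and p q :: 'a assume s: "0 < s" "s < 1"
      have "\<gamma> ((1 - s) *\<^sub>R p + s *\<^sub>R q) \<le> (1 - s) * \<gamma> p + s * \<gamma> q"
        by (rule convex_onD[OF cvx]) (use s in auto)
      then have "(\<gamma> ((1 - s) *\<^sub>R p + s *\<^sub>R q))\<^sup>2 \<le> ((1 - s) * \<gamma> p + s * \<gamma> q)\<^sup>2"
        by (intro power_mono nonneg)
      also have "\<dots> = (1 - s) * (\<gamma> p)\<^sup>2 + s * (\<gamma> q)\<^sup>2 - s * (1 - s) * (\<gamma> p - \<gamma> q)\<^sup>2"
        by (simp add: power2_eq_square algebra_simps)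
      also have "\<dots> \<le> (1 - s) * (\<gamma> p)\<^sup>2 + s * (\<gamma> q)\<^sup>2" using s by simp
      finally show "1/2 * \<bar>\<gamma> ((1 - s) *\<^sub>R p + s *\<^sub>R q)\<bar>\<^sup>2 \<le> (1 - s) * (1/2 * \<bar>\<gamma> p\<bar>\<^sup>2) + s * (1/2 * \<bar>\<gamma> q\<bar>\<^sup>2)"
        by simp
    qed simp
    show "\<bar>1/2 * \<bar>\<gamma> p\<bar>\<^sup>2 - 1/2 * \<bar>\<gamma> q\<bar>\<^sup>2\<bar> \<le> c\<^sup>2 / 2 * norm (p - q) * (norm p + norm q)" for p q
    proof -
      have "\<bar>(\<gamma> p)\<^sup>2 - (\<gamma> q)\<^sup>2\<bar> = \<bar>\<gamma> p - \<gamma> q\<bar> * (\<gamma> p + \<gamma> q)"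
        using nonneg[of p] nonneg[of q] by (simp add: power2_eq_square square_diff_square_factored abs_mult)
      also have "\<dots> \<le> (c * norm (p - q)) * (c * norm p + c * norm q)"
        using c0 nonneg[of p] nonneg[of q] by (intro mult_mono lip add_mono bound) auto
      also have "\<dots> = c\<^sup>2 * norm (p - q) * (norm p + norm q)" by (simp add: power2_eq_square algebra_simps)
      finally show ?thesis
        unfolding power2_abs right_diff_distrib[symmetric] abs_mult by simp
    qed
  qed (auto simp: zero)
  then show ?thesis by blast
qed

locale optimal_design = elasticity +
  fixes \<gamma> :: "real ^ 'a \<Rightarrow> real" and c m \<alpha> \<beta> \<epsilon> :: real and \<phi>b :: "real ^ 'a \<Rightarrow> real"
  assumes A_quadratic: "quadratic_convex (\<lambda>q. 1/2 * \<bar>\<gamma> q\<bar>\<^sup>2) c"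
    and params: "0 < \<alpha>" "0 < \<beta>" "0 < \<epsilon>"
    and solvable: "uniquely_solvable \<Omega> \<Gamma>\<^sub>D \<Gamma>\<^sub>g C f gs"
    and \<phi>b: "\<phi>b \<in> design_space \<Omega> m"
    and optimal: "\<forall>\<phi>\<in>design_space \<Omega> m.
      cost \<Omega> \<Gamma>\<^sub>g \<gamma> \<alpha> \<beta> \<epsilon> f gs \<phi>b (state_op \<Omega> \<Gamma>\<^sub>D \<Gamma>\<^sub>g C f gs \<phi>b) \<le>
      cost \<Omega> \<Gamma>\<^sub>g \<gamma> \<alpha> \<beta> \<epsilon> f gs \<phi> (state_op \<Omega> \<Gamma>\<^sub>D \<Gamma>\<^sub>g C f gs \<phi>)"
begin

abbreviation V where "V \<equiv> design_space \<Omega> m"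
abbreviation S where "S \<equiv> state_op \<Omega> \<Gamma>\<^sub>D \<Gamma>\<^sub>g C f gs"
abbreviation A where "A \<equiv> \<lambda>q. 1/2 * \<bar>\<gamma> q\<bar>\<^sup>2"
abbreviation wg where "wg \<equiv> weak_grad \<Omega>"
abbreviation Eb where "Eb \<equiv> sym_grad \<Omega> (S \<phi>b)"

sublocale A: quadratic_convex A c by (rule A_quadratic)

lemma design_spaceD:
  assumes "\<phi> \<in> V"
  shows "\<phi> \<in> H1 \<Omega>" "\<phi> \<in> L2 M" "\<phi> \<in> borel_measurable M" "AE x in M. \<phi> x \<in> {-1..1}" "wg \<phi> \<in> L2 M"
  using assms by (auto simp: design_space_def H1_L2 L2_measurable weak_grad_L2)

lemma state:
  assumes "\<phi> \<in> V" shows "is_state \<Omega> \<Gamma>\<^sub>D \<Gamma>\<^sub>g C f gs \<phi> (S \<phi>)"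
proof -
  have "AE x in M. \<bar>\<phi> x\<bar> \<le> 1" using design_spaceD(4)[OF assms] by eventually_elim auto
  then have "\<phi> \<in> Linf M" unfolding Linf_def using design_spaceD(3)[OF assms] by blast
  then have "\<exists>u. is_state \<Omega> \<Gamma>\<^sub>D \<Gamma>\<^sub>g C f gs \<phi> u" using solvable unfolding uniquely_solvable_def by blast
  then show ?thesis unfolding state_op_def by (rule someI_ex)
qed

lemma V_convex:
  assumes p: "p \<in> V" and q: "q \<in> V" and t: "0 \<le> t" "t \<le> 1"
  shows "(\<lambda>x. (1 - t) * p x + t * q x) \<in> V"
  unfolding design_space_def
proof (intro CollectI conjI)
  show "(\<lambda>x. (1 - t) * p x + t * q x) \<in> H1 \<Omega>" by (intro H1_linear design_spaceD p q)
  show "AE x in M. (1 - t) * p x + t * q x \<in> {-1..1}"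
    using design_spaceD(4)[OF p] design_spaceD(4)[OF q]
  proof eventually_elim
    case (elim x)
    then show ?case using convexD_alt[OF convex_real_interval(5) elim t] by simp
  qed
  show "(LINT x|M. (1 - t) * p x + t * q x) = m * measure lebesgue \<Omega>"
    using p q L2_integrable[OF design_spaceD(2)[OF p]] L2_integrable[OF design_spaceD(2)[OF q]]
    by (simp add: design_space_def algebra_simps)
qed

lemma bounded_product_integrable:
  assumes "p \<in> V" "q \<in> V" shows "integrable M (\<lambda>x. p x * q x)"
  using L2_inner_integrable[OF design_spaceD(2) design_spaceD(2), OF assms] by simp

definition interface where "interface \<phi> x = \<epsilon> * A (wg \<phi> x) + 1/\<epsilon> * (1/2 * (1 - (\<phi> x)\<^sup>2))"

lemma interface_integrable:
  assumes "\<phi> \<in> V" shows "integrable M (interface \<phi>)"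
proof -
  have sq: "integrable M (\<lambda>x. (\<phi> x)\<^sup>2)"
    using bounded_product_integrable[OF assms assms] by (simp add: power2_eq_square)
  then show ?thesis unfolding interface_def
    by (intro Bochner_Integration.integrable_add Bochner_Integration.integrable_diff integrable_mult_right
        integrable_const A.integrable_comp[OF design_spaceD(5)[OF assms]] sq)
qed

text \<open>The potential is finite almost everywhere because designs take values in [-1,1]. From
  here on costs are compared as real numbers.\<close>

lemma cost_eq:
  assumes "\<phi> \<in> V"
  shows "cost \<Omega> \<Gamma>\<^sub>g \<gamma> \<alpha> \<beta> \<epsilon> f gs \<phi> v = ereal (\<alpha> * (LINT x|M. interface \<phi> x) + \<beta> * load \<Omega> \<Gamma>\<^sub>g f gs \<phi> v)"
proof -
  have ae: "AE x in M. 0 \<le> interface \<phi> x \<and> ennreal (\<epsilon>/2 * \<bar>\<gamma> (wg \<phi> x)\<bar>\<^sup>2) + ennreal (1/\<epsilon>) * obstacle_potential (\<phi> x)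
      = ennreal (interface \<phi> x)"
    using design_spaceD(4)[OF assms]
  proof eventually_elim
    case (elim x)
    then have "\<bar>\<phi> x\<bar> \<le> 1" by auto
    then have sq: "0 \<le> 1/2 * (1 - (\<phi> x)\<^sup>2)" by (simp add: abs_square_le_1)
    have "ennreal (\<epsilon>/2 * \<bar>\<gamma> (wg \<phi> x)\<bar>\<^sup>2) + ennreal (1/\<epsilon>) * obstacle_potential (\<phi> x)
        = ennreal (\<epsilon> * A (wg \<phi> x)) + ennreal (1/\<epsilon> * (1/2 * (1 - (\<phi> x)\<^sup>2)))"
      using elim params(3) sq unfolding obstacle_potential_def by (subst ennreal_mult) auto
    also have "\<dots> = ennreal (interface \<phi> x)"
      unfolding interface_def using params(3) sq by (intro ennreal_plus[symmetric] mult_nonneg_nonneg) auto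
    moreover have "0 \<le> interface \<phi> x"
      unfolding interface_def using params(3) sq by (intro add_nonneg_nonneg mult_nonneg_nonneg) auto
    ultimately show ?case by simp
  qed
  then have nn: "AE x in M. 0 \<le> interface \<phi> x" by eventually_elim simp
  have "(\<integral>\<^sup>+x. ennreal (\<epsilon>/2 * \<bar>\<gamma> (wg \<phi> x)\<bar>\<^sup>2) + ennreal (1/\<epsilon>) * obstacle_potential (\<phi> x) \<partial>M)
      = (\<integral>\<^sup>+x. ennreal (interface \<phi> x) \<partial>M)"
    using ae by (intro nn_integral_cong_AE) (auto elim: eventually_mono)
  also have "\<dots> = ennreal (LINT x|M. interface \<phi> x)"
    by (rule nn_integral_eq_integral[OF interface_integrable[OF assms] nn])
  finally show ?thesis unfolding cost_def
    using integral_nonneg_AE[OF nn] by (simp add: enn2ereal_ennreal)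
qed

definition density where
  "density \<phi> x = 2 * h_load' (\<phi>b x) * (\<phi> x - \<phi>b x) * (f x \<bullet> S \<phi>b x)
    - (\<phi> x - \<phi>b x) * (tensor_apply (C' (\<phi>b x)) (Eb x) \<bullet> Eb x)"

definition well where "well \<phi> x = 1/\<epsilon> * Psi0' (\<phi>b x) * (\<phi> x - \<phi>b x)"

definition linear_part where
  "linear_part \<phi> = \<alpha> * (LINT x|M. well \<phi> x) + \<beta> * (LINT x|M. density \<phi> x)"

lemma segment:
  assumes "\<phi> \<in> V"
  shows "design_segment \<Omega> \<Gamma>\<^sub>D \<Gamma>\<^sub>g C0 C1 g f gs \<theta> \<Lambda> L \<phi>b \<phi> (\<lambda>n. inverse (real (Suc n)))
    (S \<phi>b) (S \<phi>) (\<lambda>n. S (\<lambda>x. (1 - inverse (real (Suc n))) * \<phi>b x + inverse (real (Suc n)) * \<phi> x))"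
proof
  show le1: "inverse (real (Suc n)) \<le> 1" for n by (simp add: inverse_le_1_iff)
  show "is_state \<Omega> \<Gamma>\<^sub>D \<Gamma>\<^sub>g C f gs (\<lambda>x. (1 - inverse (real (Suc n))) * \<phi>b x + inverse (real (Suc n)) * \<phi> x)
    (S (\<lambda>x. (1 - inverse (real (Suc n))) * \<phi>b x + inverse (real (Suc n)) * \<phi> x))" for n
    using le1[of n] by (intro state V_convex \<phi>b assms) auto
qed (use assms \<phi>b design_spaceD state LIMSEQ_inverse_real_of_nat in auto)

lemma density_integrable:
  assumes \<phi>: "\<phi> \<in> V" shows "integrable M (density \<phi>)"
proof -
  have "design_segment.cost_density \<Omega> C0 C1 g f \<phi>b \<phi> (S \<phi>b) = density \<phi>"
    unfolding density_def[abs_def] by (rule ext) (rule design_segment.cost_density_def[OF segment[OF \<phi>]])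
  with design_segment.cost_density(1)[OF segment[OF \<phi>]] show ?thesis by simp
qed

lemma well_integrable:
  assumes "\<phi> \<in> V" shows "integrable M (well \<phi>)"
proof -
  have "integrable M (\<lambda>x. 1/\<epsilon> * (\<phi>b x * \<phi>b x) - 1/\<epsilon> * (\<phi>b x * \<phi> x))"
    by (intro Bochner_Integration.integrable_diff integrable_mult_right bounded_product_integrable \<phi>b assms)
  then show ?thesis by (simp add: well_def[abs_def] Psi0'_def algebra_simps diff_divide_distrib)
qed

text \<open>The gradient term is convex along the segment and lies below its secant; the potential
  is concave and lies below its tangent, which is where \<open>Psi0'\<close> arises. Both estimates
  point in the same direction.\<close>

lemma interface_step:
  assumes \<phi>: "\<phi> \<in> V" and t: "0 \<le> t" "t \<le> 1"
  shows "(LINT x|M. interface (\<lambda>x. (1 - t) * \<phi>b x + t * \<phi> x) x) - (LINT x|M. interface \<phi>b x)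
    \<le> t * (\<epsilon> * (LINT x|M. A (wg \<phi> x) - A (wg \<phi>b x)) + (LINT x|M. well \<phi> x))"
proof -
  let ?p = "\<lambda>x. (1 - t) * \<phi>b x + t * \<phi> x"
  have p: "?p \<in> V" by (rule V_convex[OF \<phi>b \<phi> t])
  have Aint: "integrable M (\<lambda>x. A (wg \<phi> x) - A (wg \<phi>b x))"
    by (intro Bochner_Integration.integrable_diff A.integrable_comp design_spaceD \<phi> \<phi>b)
  have "(LINT x|M. interface ?p x) - (LINT x|M. interface \<phi>b x) = (LINT x|M. interface ?p x - interface \<phi>b x)"
    by (intro Bochner_Integration.integral_diff[symmetric] interface_integrable p \<phi>b)
  also have "\<dots> \<le> (LINT x|M. t * (\<epsilon> * (A (wg \<phi> x) - A (wg \<phi>b x)) + well \<phi> x))"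
  proof (rule integral_mono_AE)
    show "integrable M (\<lambda>x. interface ?p x - interface \<phi>b x)"
      by (intro Bochner_Integration.integrable_diff interface_integrable p \<phi>b)
    show "integrable M (\<lambda>x. t * (\<epsilon> * (A (wg \<phi> x) - A (wg \<phi>b x)) + well \<phi> x))"
      by (intro integrable_mult_right Bochner_Integration.integrable_add well_integrable \<phi> Aint)
    show "AE x in M. interface ?p x - interface \<phi>b x \<le> t * (\<epsilon> * (A (wg \<phi> x) - A (wg \<phi>b x)) + well \<phi> x)"
      using H1_linear(2)[OF design_spaceD(1)[OF \<phi>b] design_spaceD(1)[OF \<phi>], of "1 - t" t]
    proof eventually_elim
      case (elim x)
      have mix: "X \<le> (1 - t) * Y + t * Z \<Longrightarrow> X - Y \<le> t * (Z - Y)" for X Y Z :: real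
        by (simp add: algebra_simps)
      have "A (wg ?p x) - A (wg \<phi>b x) \<le> t * (A (wg \<phi> x) - A (wg \<phi>b x))"
        unfolding elim by (rule mix, rule convex_onD[OF A.convex]) (use t in auto)
      then have 1: "\<epsilon> * (A (wg ?p x) - A (wg \<phi>b x)) \<le> \<epsilon> * (t * (A (wg \<phi> x) - A (wg \<phi>b x)))"
        using params(3) by (intro mult_left_mono) auto
      have "1/2 * (1 - (?p x)\<^sup>2) - 1/2 * (1 - (\<phi>b x)\<^sup>2) = t * (- \<phi>b x * (\<phi> x - \<phi>b x)) - 1/2 * (t * (\<phi> x - \<phi>b x))\<^sup>2"
        by (simp add: power2_eq_square field_simps)
      also have "\<dots> \<le> t * (- \<phi>b x * (\<phi> x - \<phi>b x))" by simp
      finally have "1/\<epsilon> * (1/2 * (1 - (?p x)\<^sup>2) - 1/2 * (1 - (\<phi>b x)\<^sup>2)) \<le> 1/\<epsilon> * (t * (- \<phi>b x * (\<phi> x - \<phi>b x)))"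
        using params(3) by (intro mult_left_mono) auto
      moreover have "1/\<epsilon> * (t * (- \<phi>b x * (\<phi> x - \<phi>b x))) = t * well \<phi> x"
        by (simp add: well_def Psi0'_def)
      moreover have "interface ?p x - interface \<phi>b x =
          \<epsilon> * (A (wg ?p x) - A (wg \<phi>b x)) + 1/\<epsilon> * (1/2 * (1 - (?p x)\<^sup>2) - 1/2 * (1 - (\<phi>b x)\<^sup>2))"
        unfolding interface_def right_diff_distrib by simp
      moreover have "t * (\<epsilon> * (A (wg \<phi> x) - A (wg \<phi>b x)) + well \<phi> x) =
          \<epsilon> * (t * (A (wg \<phi> x) - A (wg \<phi>b x))) + t * well \<phi> x"
        by (simp only: distrib_left mult.left_commute)
      ultimately show ?case using 1 by linarith
    qed
  qed
  also have "\<dots> = t * (\<epsilon> * (LINT x|M. A (wg \<phi> x) - A (wg \<phi>b x)) + (LINT x|M. well \<phi> x))"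
    using Aint well_integrable[OF \<phi>] by (simp del: Bochner_Integration.integral_diff)
  finally show ?thesis .
qed

text \<open>The cost increment is nonnegative and at most t n times an explicit bound; after
  division by t n the slope is the only term that depends on n. The difference of \<open>A\<close>
  is kept whole, so \<gamma> is never differentiated.\<close>

lemma convex_minimality:
  assumes \<phi>: "\<phi> \<in> V"
  shows "0 \<le> \<alpha> * \<epsilon> * (LINT x|M. A (wg \<phi> x) - A (wg \<phi>b x)) + linear_part \<phi>"
proof -
  define t where "t n = inverse (real (Suc n))" for n
  let ?p = "\<lambda>n x. (1 - t n) * \<phi>b x + t n * \<phi> x"
  let ?ld = "load \<Omega> \<Gamma>\<^sub>g f gs"
  let ?G = "\<alpha> * (\<epsilon> * (LINT x|M. A (wg \<phi> x) - A (wg \<phi>b x)) + (LINT x|M. well \<phi> x))"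
  interpret s: design_segment \<Omega> \<Gamma>\<^sub>D \<Gamma>\<^sub>g C0 C1 g f gs \<theta> \<Lambda> L \<phi>b \<phi> t "S \<phi>b" "S \<phi>" "\<lambda>n. S (?p n)"
    unfolding t_def by (rule segment[OF \<phi>])
  have "0 \<le> ?G + \<beta> * s.slope n" for n
  proof -
    have tn: "0 < t n" "t n \<le> 1" by (rule s.t)+
    have p: "?p n \<in> V" using tn by (intro V_convex \<phi>b \<phi>) auto
    have "cost \<Omega> \<Gamma>\<^sub>g \<gamma> \<alpha> \<beta> \<epsilon> f gs \<phi>b (S \<phi>b) \<le> cost \<Omega> \<Gamma>\<^sub>g \<gamma> \<alpha> \<beta> \<epsilon> f gs (?p n) (S (?p n))"
      using optimal p by blast
    then have opt: "\<alpha> * (LINT x|M. interface \<phi>b x) + \<beta> * ?ld \<phi>b (S \<phi>b)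
        \<le> \<alpha> * (LINT x|M. interface (?p n) x) + \<beta> * ?ld (?p n) (S (?p n))"
      unfolding cost_eq[OF p] cost_eq[OF \<phi>b] by simp
    have "\<alpha> * ((LINT x|M. interface (?p n) x) - (LINT x|M. interface \<phi>b x)) \<le> t n * ?G"
      using mult_left_mono[OF interface_step[OF \<phi>, of "t n"], of \<alpha>] tn params(1) by (simp add: mult_ac)
    moreover have "s.\<phi> n = ?p n" by (auto simp: s.\<phi>_def)
    then have "\<beta> * (?ld (?p n) (S (?p n)) - ?ld \<phi>b (S \<phi>b)) \<le> \<beta> * (t n * s.slope n)"
      using s.compliance_increment_le[of n] params(2) by (intro mult_left_mono) auto
    ultimately have "0 \<le> t n * ?G + \<beta> * (t n * s.slope n)"
      using opt unfolding right_diff_distrib by linarith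
    also have "\<dots> = t n * (?G + \<beta> * s.slope n)" by (simp only: distrib_left mult.left_commute)
    finally show ?thesis using tn by (simp only: zero_le_mult_iff) auto
  qed
  moreover have "(\<lambda>n. ?G + \<beta> * s.slope n) \<longlonglongrightarrow> ?G + \<beta> * (LINT x|M. s.cost_density x)"
    by (intro tendsto_intros s.slope_lim)
  ultimately have "0 \<le> ?G + \<beta> * (LINT x|M. s.cost_density x)"
    by (intro LIMSEQ_le_const) auto
  moreover have "s.cost_density = density \<phi>" by (auto simp: s.cost_density_def density_def)
  ultimately show ?thesis unfolding linear_part_def by (simp only: distrib_left mult.assoc add.assoc)
qed

text \<open>Agreement almost everywhere is allowed because \<open>weak_grad\<close> is linear only
  up to null sets, while \<open>K_convex\<close> asks for the pointwise combination of the fields.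
  Division by \<open>\<alpha> * \<epsilon>\<close> normalizes the weight of \<open>A\<close> to
  1.\<close>

definition directions where
  "directions = {(w, d). w \<in> L2 M \<and> (\<exists>\<phi>\<in>V. (AE x in M. w x = wg \<phi> x - wg \<phi>b x) \<and> d = linear_part \<phi> / (\<alpha> * \<epsilon>))}"

lemma linear_part_mix:
  assumes p: "p \<in> V" and q: "q \<in> V"
  shows "linear_part (\<lambda>x. (1 - s) * p x + s * q x) = (1 - s) * linear_part p + s * linear_part q"
proof -
  have "well (\<lambda>x. (1 - s) * p x + s * q x) = (\<lambda>x. (1 - s) * well p x + s * well q x)"
    "density (\<lambda>x. (1 - s) * p x + s * q x) = (\<lambda>x. (1 - s) * density p x + s * density q x)"
  proof -
    have m: "(1 - s) * p x + s * q x - \<phi>b x = (1 - s) * (p x - \<phi>b x) + s * (q x - \<phi>b x)" for x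
      by (simp add: algebra_simps)
    have "k * ((1 - s) * a + s * b) = (1 - s) * (k * a) + s * (k * b)" for k a b
      by (simp add: algebra_simps)
    then show "well (\<lambda>x. (1 - s) * p x + s * q x) = (\<lambda>x. (1 - s) * well p x + s * well q x)"
      unfolding well_def[abs_def] m by blast
    have "h * ((1 - s) * a + s * b) * e - ((1 - s) * a + s * b) * z =
        (1 - s) * (h * a * e - a * z) + s * (h * b * e - b * z)" for h e z a b
      by (simp add: algebra_simps)
    then show "density (\<lambda>x. (1 - s) * p x + s * q x) = (\<lambda>x. (1 - s) * density p x + s * density q x)"
      unfolding density_def[abs_def] m by blast
  qed
  then show ?thesis unfolding linear_part_def
    using well_integrable[OF p] well_integrable[OF q] density_integrable[OF p] density_integrable[OF q]
    by (simp add: algebra_simps)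
qed

sublocale convex_directions A c M "wg \<phi>b" directions
proof
  show "wg \<phi>b \<in> L2 M" by (rule design_spaceD(5)[OF \<phi>b])
  show "w \<in> L2 M" if "(w, d) \<in> directions" for w d using that by (simp add: directions_def)
  have "linear_part \<phi>b = 0" by (simp add: linear_part_def well_def density_def)
  then show "(\<lambda>x. 0, 0) \<in> directions" using \<phi>b by (auto simp: directions_def L2_zero intro!: bexI[of _ \<phi>b])
next
  fix v d w e s assume vd: "(v, d) \<in> directions" and we: "(w, e) \<in> directions" and s: "0 \<le> s" "s \<le> (1::real)"
  obtain p where p: "p \<in> V" "AE x in M. v x = wg p x - wg \<phi>b x" "d = linear_part p / (\<alpha> * \<epsilon>)"
    using vd by (auto simp: directions_def)
  obtain q where q: "q \<in> V" "AE x in M. w x = wg q x - wg \<phi>b x" "e = linear_part q / (\<alpha> * \<epsilon>)"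
    using we by (auto simp: directions_def)
  let ?r = "\<lambda>x. (1 - s) * p x + s * q x"
  have "?r \<in> V" by (rule V_convex[OF p(1) q(1) s])
  moreover have "AE x in M. v x + s *\<^sub>R (w x - v x) = wg ?r x - wg \<phi>b x"
    using p(2) q(2) H1_linear(2)[OF design_spaceD(1)[OF p(1)] design_spaceD(1)[OF q(1)], of "1 - s" s]
  proof eventually_elim
    case (elim x)
    show ?case unfolding elim by (simp add: algebra_simps)
  qed
  moreover have "d + s * (e - d) = linear_part ?r / (\<alpha> * \<epsilon>)"
    unfolding linear_part_mix[OF p(1) q(1)] p(3) q(3) by (simp add: algebra_simps diff_divide_distrib add_divide_distrib)
  moreover have "(\<lambda>x. v x + s *\<^sub>R (w x - v x)) \<in> L2 M"
    using vd we by (intro L2_add L2_scaleR L2_diff) (auto simp: directions_def)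
  ultimately show "(\<lambda>x. v x + s *\<^sub>R (w x - v x), d + s * (e - d)) \<in> directions" by (auto simp: directions_def)
next
  fix w d assume "(w, d) \<in> directions"
  then obtain p where w: "w \<in> L2 M" and p: "p \<in> V" "AE x in M. w x = wg p x - wg \<phi>b x" "d = linear_part p / (\<alpha> * \<epsilon>)"
    by (auto simp: directions_def)
  have "(LINT x|M. A (wg \<phi>b x + w x) - A (wg \<phi>b x)) = (LINT x|M. A (wg p x) - A (wg \<phi>b x))"
  proof (rule integral_cong_AE)
    show "(\<lambda>x. A (wg \<phi>b x + w x) - A (wg \<phi>b x)) \<in> borel_measurable M"
      "(\<lambda>x. A (wg p x) - A (wg \<phi>b x)) \<in> borel_measurable M"
      by (intro borel_measurable_integrable Bochner_Integration.integrable_diff A.integrable_comp L2_add design_spaceD \<phi>b p w)+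
    show "AE x in M. A (wg \<phi>b x + w x) - A (wg \<phi>b x) = A (wg p x) - A (wg \<phi>b x)"
      using p(2) by eventually_elim simp
  qed
  then have "0 \<le> \<alpha> * \<epsilon> * (LINT x|M. A (wg \<phi>b x + w x) - A (wg \<phi>b x)) + linear_part p"
    using convex_minimality[OF p(1)] by simp
  also have "\<dots> = \<alpha> * \<epsilon> * ((LINT x|M. A (wg \<phi>b x + w x) - A (wg \<phi>b x)) + d)"
    using params unfolding p(3) distrib_left by simp
  finally show "0 \<le> (LINT x|M. A (wg \<phi>b x + w x) - A (wg \<phi>b x)) + d"
    using mult_pos_pos[OF params(1,3)] by (simp only: zero_le_mult_iff) auto
qed

theorem optimality_condition:
  "\<exists>\<xi>\<in>L2 M. (AE x in M. \<xi> x \<in> convex_subdifferential A (wg \<phi>b x)) \<and>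
    (\<forall>\<phi>\<in>V. \<alpha> * (LINT x|M. \<epsilon> * (\<xi> x \<bullet> wg (\<lambda>y. \<phi> y - \<phi>b y) x) + 1/\<epsilon> * Psi0' (\<phi>b x) * (\<phi> x - \<phi>b x))
      + \<beta> * (LINT x|M. 2 * h_load' (\<phi>b x) * (\<phi> x - \<phi>b x) * (f x \<bullet> S \<phi>b x)
          - (\<phi> x - \<phi>b x) * (tensor_apply (C' (\<phi>b x)) (Eb x) \<bullet> Eb x)) \<ge> 0)"
proof -
  obtain \<xi> where \<xi>: "\<xi> \<in> L2 M" "AE x in M. \<xi> x \<in> convex_subdifferential A (wg \<phi>b x)"
    and ineq: "\<And>v e. (v, e) \<in> directions \<Longrightarrow> 0 \<le> (LINT x|M. \<xi> x \<bullet> v x) + e"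
    using subgradient_selection by blast
  have "0 \<le> \<alpha> * (LINT x|M. \<epsilon> * (\<xi> x \<bullet> wg (\<lambda>y. \<phi> y - \<phi>b y) x) + well \<phi> x) + \<beta> * (LINT x|M. density \<phi> x)"
    if \<phi>: "\<phi> \<in> V" for \<phi>
  proof -
    let ?w = "wg (\<lambda>y. \<phi> y - \<phi>b y)"
    have H: "(\<lambda>y. \<phi> y - \<phi>b y) \<in> H1 \<Omega>" "AE x in M. ?w x = wg \<phi> x - wg \<phi>b x"
      using H1_linear[OF design_spaceD(1)[OF \<phi>] design_spaceD(1)[OF \<phi>b], of 1 "-1"] by simp_all
    have w: "?w \<in> L2 M" by (rule weak_grad_L2[OF H(1)])
    \<comment> \<open>The representative chosen for the gradient of the difference, which is the one
      in the claim, is itself a direction.\<close>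
    have "(?w, linear_part \<phi> / (\<alpha> * \<epsilon>)) \<in> directions" using H w \<phi> by (auto simp: directions_def)
    from mult_left_mono[OF ineq[OF this], of "\<alpha> * \<epsilon>"] params
    have "0 \<le> \<alpha> * \<epsilon> * (LINT x|M. \<xi> x \<bullet> ?w x) + linear_part \<phi>" by (simp add: distrib_left)
    moreover have "(LINT x|M. \<epsilon> * (\<xi> x \<bullet> ?w x) + well \<phi> x) = \<epsilon> * (LINT x|M. \<xi> x \<bullet> ?w x) + (LINT x|M. well \<phi> x)"
      using L2_inner_integrable[OF \<xi>(1) w] well_integrable[OF \<phi>] by simp
    ultimately show ?thesis by (simp add: linear_part_def algebra_simps)
  qed
  then show ?thesis using \<xi> unfolding well_def density_def by blast
qed

end

theorem theorem4p2:
  fixes \<Omega> \<Gamma>\<^sub>D \<Gamma>\<^sub>g \<Gamma>\<^sub>0 :: "(real ^ 'd) set"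
    and C0 C1 :: "'d::finite tensor4"
    and g :: "real \<Rightarrow> real"
    and f gs :: "real ^ 'd \<Rightarrow> real ^ 'd"
    and \<gamma> :: "real ^ 'd \<Rightarrow> real"
    and \<theta> \<Lambda> m \<alpha> \<beta> \<epsilon> :: real
    and \<phi>\<^sub>b :: "real ^ 'd \<Rightarrow> real"
  defines "C \<equiv> interp_tensor g C0 C1"
    and "C' \<equiv> interp_tensor' g C0 C1"
  defines "S \<equiv> state_op \<Omega> \<Gamma>\<^sub>D \<Gamma>\<^sub>g C f gs"
    and "J \<equiv> cost \<Omega> \<Gamma>\<^sub>g \<gamma> \<alpha> \<beta> \<epsilon> f gs"
    and "V \<equiv> design_space \<Omega> m"
  defines "u\<^sub>b \<equiv> S \<phi>\<^sub>b"
    and "A \<equiv> \<lambda>q. 1/2 * \<bar>\<gamma> q\<bar>\<^sup>2"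
  assumes domain: "bounded_lipschitz_domain \<Omega>"
    and boundary: "frontier \<Omega> = \<Gamma>\<^sub>D \<union> \<Gamma>\<^sub>g \<union> \<Gamma>\<^sub>0"
    and boundary_measurable: "{\<Gamma>\<^sub>D, \<Gamma>\<^sub>g, \<Gamma>\<^sub>0} \<subseteq> sets (hausdorff_measure (CARD('d) - 1))"
    and tensors: "elasticity_tensor C0" "elasticity_tensor C1"
    and elliptic: "\<theta> > 0" "\<Lambda> > 0" "elliptic_tensor \<theta> \<Lambda> C0" "elliptic_tensor \<theta> \<Lambda> C1"
    and g_interp: "\<forall>s. g s \<in> {-1..1}" "mono g" "g (-1) = -1" "g 1 = 1"
    and g_regular: "g differentiable_on {-1..1}" "\<exists>L. L-lipschitz_on {-1..1} g"
    and params: "m \<in> {-1<..<1}" "\<alpha> > 0" "\<beta> > 0" "\<epsilon> > 0"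
    and \<gamma>_homogeneous: "\<forall>q l. q \<noteq> 0 \<and> l \<ge> 0 \<longrightarrow> \<gamma> (l *\<^sub>R q) = l * \<gamma> q"
    and \<gamma>_pos: "\<forall>q. q \<noteq> 0 \<longrightarrow> \<gamma> q > 0"
    and \<gamma>_convex: "convex_on UNIV \<gamma>"
    and forces: "f \<in> L2 (lebesgue_on \<Omega>)" "gs \<in> L2 (surface_measure \<Gamma>\<^sub>g)"
    and state_system: "uniquely_solvable \<Omega> \<Gamma>\<^sub>D \<Gamma>\<^sub>g C f gs"
    and optimal: "\<phi>\<^sub>b \<in> V" "\<forall>\<phi>\<in>V. J \<phi>\<^sub>b (S \<phi>\<^sub>b) \<le> J \<phi> (S \<phi>)"
  shows "\<exists>\<xi>\<in>L2 (lebesgue_on \<Omega>).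
           (AE x in lebesgue_on \<Omega>. \<xi> x \<in> convex_subdifferential A (weak_grad \<Omega> \<phi>\<^sub>b x)) \<and>
           (\<forall>\<phi>\<in>V.
              \<alpha> * (LINT x|lebesgue_on \<Omega>.
                     \<epsilon> * (\<xi> x \<bullet> weak_grad \<Omega> (\<lambda>y. \<phi> y - \<phi>\<^sub>b y) x)
                     + 1/\<epsilon> * Psi0' (\<phi>\<^sub>b x) * (\<phi> x - \<phi>\<^sub>b x))
              + \<beta> * (LINT x|lebesgue_on \<Omega>.
                     2 * h_load' (\<phi>\<^sub>b x) * (\<phi> x - \<phi>\<^sub>b x) * (f x \<bullet> u\<^sub>b x)
                     - (\<phi> x - \<phi>\<^sub>b x) *
                       (tensor_apply (C' (\<phi>\<^sub>b x)) (sym_grad \<Omega> u\<^sub>b x) \<bullet> sym_grad \<Omega> u\<^sub>b x))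
              \<ge> 0)"
proof -
  have o: "open \<Omega>" "bounded \<Omega>" using domain by (auto simp: bounded_lipschitz_domain_def)
  obtain L where L: "L-lipschitz_on {-1..1} g" using g_regular(2) by blast
  obtain c where c: "quadratic_convex A c"
    unfolding A_def using anisotropy_quadratic_convex[OF \<gamma>_homogeneous \<gamma>_pos \<gamma>_convex] by blast
  interpret optimal_design \<Omega> \<Gamma>\<^sub>D \<Gamma>\<^sub>g C0 C1 g f gs \<theta> \<Lambda> L \<gamma> c m \<alpha> \<beta> \<epsilon> \<phi>\<^sub>b
  proof (intro optimal_design.intro optimal_design_axioms.intro elasticity.intro elasticity_axioms.intro
      bounded_open.intro)
    show "quadratic_convex (\<lambda>q. 1/2 * \<bar>\<gamma> q\<bar>\<^sup>2) c" using c by (simp only: A_def)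
    show "g s \<in> {-1..1}" for s using g_interp(1) by blast
  qed (use o tensors elliptic g_interp g_regular L forces params state_system optimal in
      \<open>simp_all add: C_def V_def J_def S_def\<close>)
  show ?thesis
    unfolding u\<^sub>b_def S_def C_def C'_def V_def A_def by (rule optimality_condition)
qed

end
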